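(* Let $G$ be a finite simple graph such that its toric ideal $I_G$ is geometrically vertex decomposable in $\mathbb{K}[E(G)]$. Let $H$ be the graph obtained from $G$ by gluing a cycle of length $2d$ ($d\ge2$) along an edge of $G$. Then $$\operatorname{reg}(\mathbb{K}[E(H)]/I_H)=\operatorname{reg}(\mathbb{K}[E(G)]/I_G)+(d-1).$$
   Context: $\mathbb{K}$ is an algebraically closed field of characteristic $0$. For a finite simple graph $G=(V,E)$ with vertices $x_1,\ldots,x_p$ and edges $e_1,\ldots,e_q$ (also used as names of variables of degree $1$), the toric ideal $I_G$ is the kernel of the $\mathbb{K}$-algebra homomorphism $\mathbb{K}[E(G)]=\mathbb{K}[e_1,\ldots,e_q]\to\mathbb{K}[x_1,\ldots,x_p]$ with $e_i\mapsto x_jx_k$ where $e_i=\{x_j,x_k\}$. Gluing: let $C_m$ be the cycle graph on $m$ vertices, fix an edge $e$ of $G$ and an edge $f$ of $C_m$. The graph obtained from $G$ by gluing a cycle of length $m$ along the edge $e$ is obtained from the disjoint union of $G$ and $C_m$ by identifying $e$ with $f$ (and the endpoints of $e$ with those of $f$), with no other identifications. Geometric vertex decomposability: let $S=\mathbb{K}[x_1,\ldots,x_n]$ and let $y=x_j$. A nonzero $f\in S$ is written $f=\sum_{i=0}^d\alpha_iy^i$ with $\alpha_i$ not involving $y$ and $\alpha_d\neq0$; $\mathrm{in}_y(f)=\alpha_dy^d$ and $\mathrm{in}_y(J)=\langle\mathrm{in}_y(f):f\in J\rangle$. A monomial order is $y$-compatible if $\mathrm{in}_<(\mathrm{in}_y(f))=\mathrm{in}_<(f)$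 for all $f$. For a Gröbner basis $\{g_1,\ldots,g_m\}$ of $I$ with respect to such an order write $g_i=y^{d_i}q_i+r_i$ with $\mathrm{in}_y(g_i)=y^{d_i}q_i$, $q_i$ not involving $y$; put $C_{y,I}=\langle q_1,\ldots,q_m\rangle$, $N_{y,I}=\langle q_i:d_i=0\rangle$. An equality $\mathrm{in}_y(I)=C_{y,I}\cap(N_{y,I}+\langle y\rangle)$ is a geometric vertex decomposition of $I$ with respect to $y$. An ideal is unmixed if all associated primes $P$ of $S/I$ have $\dim(S/P)=\dim(S/I)$. $I$ is geometrically vertex decomposable if it is unmixed and either $I=\langle1\rangle$, or $I$ is generated by a (possibly empty) subset of the variables, or for some variable $y=x_j$ and $y$-compatible order there is a geometric vertex decomposition of $I$ such that the contractions of $C_{y,I}$ and $N_{y,I}$ to $\mathbb{K}[x_1,\ldots,\widehat{x_j},\ldots,x_n]$ are geometrically vertex decomposable. $\operatorname{reg}$ denotes Castelnuovo–Mumford regularity. *)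

theory Defs
  imports
    "HOL-Library.Poly_Mapping"
    "HOL-Library.Extended_Nat"
    "HOL-Library.Extended_Real"
    "HOL-Algebra.QuotRing"
    "HOL-Computational_Algebra.Polynomial"
    "Jordan_Normal_Form.Matrix"
begin

section \<open>Polynomial rings\<close>

text \<open>A polynomial is a finitely supported map from monomials to coefficients, and a monomial is a
  finitely supported map from variables to exponents. The ring \<open>K[V]\<close> consists of the polynomials
  all of whose monomials involve only variables from the set \<open>V\<close>.\<close>

type_synonym ('v, 'k) mpoly = "('v \<Rightarrow>\<^sub>0 nat) \<Rightarrow>\<^sub>0 'k"

definition monomials :: "'v set \<Rightarrow> ('v \<Rightarrow>\<^sub>0 nat) set" where
  "monomials V = {m. Poly_Mapping.keys m \<subseteq> V}"

definition poly_ring :: "'v set \<Rightarrow> ('v, 'k::field) mpoly ring" where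
  "poly_ring V =
     \<lparr>carrier = {p. Poly_Mapping.keys p \<subseteq> monomials V},
      monoid.mult = (*), one = 1, zero = 0, add = (+)\<rparr>"

definition Cst :: "'k::field \<Rightarrow> ('v, 'k) mpoly" where
  "Cst c = Poly_Mapping.single 0 c"

definition Var :: "'v \<Rightarrow> ('v, 'k::field) mpoly" where
  "Var x = Poly_Mapping.single (Poly_Mapping.single x 1) 1"

definition subst :: "('v \<Rightarrow> ('w, 'k::field) mpoly) \<Rightarrow> ('v, 'k) mpoly \<Rightarrow> ('w, 'k) mpoly" where
  "subst \<sigma> p = (\<Sum>m\<in>Poly_Mapping.keys p. Cst (Poly_Mapping.lookup p m) *
     (\<Prod>x\<in>Poly_Mapping.keys m. \<sigma> x ^ Poly_Mapping.lookup m x))"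

definition mdeg :: "('v \<Rightarrow>\<^sub>0 nat) \<Rightarrow> nat" where
  "mdeg m = (\<Sum>x\<in>Poly_Mapping.keys m. Poly_Mapping.lookup m x)"

text \<open>The degree is an integer, so that entries of negative degree in a graded map are zero.\<close>

definition homogeneous :: "int \<Rightarrow> ('v, 'k::field) mpoly \<Rightarrow> bool" where
  "homogeneous n p \<longleftrightarrow> (\<forall>m\<in>Poly_Mapping.keys p. int (mdeg m) = n)"


section \<open>Dimension, associated primes, unmixed ideals\<close>

definition krull_dim :: "('a, 'b) ring_scheme \<Rightarrow> enat" where
  "krull_dim R = Sup {enat n | n. \<exists>P :: nat \<Rightarrow> 'a set.
     (\<forall>i\<le>n. primeideal (P i) R) \<and> (\<forall>i<n. P i \<subset> P (Suc i))}"

text \<open>The associated primes of the module \<open>R/I\<close>: the prime ideals that are the annihilator of the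
  class of some \<open>f\<close>.\<close>

definition assoc_primes :: "('a, 'b) ring_scheme \<Rightarrow> 'a set \<Rightarrow> 'a set set" where
  "assoc_primes R I =
     {P. primeideal P R \<and> (\<exists>f\<in>carrier R. P = {g \<in> carrier R. g \<otimes>\<^bsub>R\<^esub> f \<in> I})}"

definition unmixed :: "('a, 'b) ring_scheme \<Rightarrow> 'a set \<Rightarrow> bool" where
  "unmixed R I \<longleftrightarrow> (\<forall>P\<in>assoc_primes R I. krull_dim (R Quot P) = krull_dim (R Quot I))"


section \<open>Geometric vertex decomposability\<close>

text \<open>If \<open>f = \<Sum>i. \<alpha>\<^sub>i y\<^sup>i\<close> with \<open>\<alpha>\<^sub>i\<close> not involving \<open>y\<close>, then \<open>ydeg y f\<close> is the largest \<open>i\<close> with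
  \<open>\<alpha>\<^sub>i \<noteq> 0\<close> and \<open>ycoeff y f i\<close> is \<open>\<alpha>\<^sub>i\<close>. With \<open>d = ydeg y g\<close>, the polynomial \<open>q\<close> in
  \<open>g = y\<^sup>d q + r\<close> is therefore \<open>ylead y g\<close>.\<close>

definition ydeg :: "'v \<Rightarrow> ('v, 'k::field) mpoly \<Rightarrow> nat" where
  "ydeg y f = Max (insert 0 ((\<lambda>m. Poly_Mapping.lookup m y) ` Poly_Mapping.keys f))"

definition ycoeff :: "'v \<Rightarrow> ('v, 'k::field) mpoly \<Rightarrow> nat \<Rightarrow> ('v, 'k) mpoly" where
  "ycoeff y f i = (\<Sum>m\<in>{m\<in>Poly_Mapping.keys f. Poly_Mapping.lookup m y = i}.
     Poly_Mapping.single (m - Poly_Mapping.single y i) (Poly_Mapping.lookup f m))"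

definition ylead :: "'v \<Rightarrow> ('v, 'k::field) mpoly \<Rightarrow> ('v, 'k) mpoly" where
  "ylead y f = ycoeff y f (ydeg y f)"

definition in_y :: "'v \<Rightarrow> ('v, 'k::field) mpoly \<Rightarrow> ('v, 'k) mpoly" where
  "in_y y f = ylead y f * Var y ^ ydeg y f"

definition in_y_ideal :: "'v set \<Rightarrow> 'v \<Rightarrow> ('v, 'k::field) mpoly set \<Rightarrow> ('v, 'k) mpoly set" where
  "in_y_ideal V y J = Idl\<^bsub>poly_ring V\<^esub> (in_y y ` (J - {0}))"

text \<open>A monomial order is given by its reflexive relation, \<open>(m, n) \<in> r\<close> meaning \<open>m \<le> n\<close>.\<close>

definition monomial_order :: "'v set \<Rightarrow> ('v \<Rightarrow>\<^sub>0 nat) rel \<Rightarrow> bool" where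
  "monomial_order V r \<longleftrightarrow>
     linear_order_on (monomials V) r \<and>
     (\<forall>m\<in>monomials V. (0, m) \<in> r) \<and>
     (\<forall>m n. \<forall>u\<in>monomials V. (m, n) \<in> r \<longrightarrow> (m + u, n + u) \<in> r)"

text \<open>The leading term of a nonzero polynomial.\<close>

definition lterm :: "('v \<Rightarrow>\<^sub>0 nat) rel \<Rightarrow> ('v, 'k::field) mpoly \<Rightarrow> ('v, 'k) mpoly" where
  "lterm r f = (let m = (THE m. m \<in> Poly_Mapping.keys f \<and> (\<forall>n\<in>Poly_Mapping.keys f. (n, m) \<in> r))
                in Poly_Mapping.single m (Poly_Mapping.lookup f m))"

definition y_compatible :: "'k::field itself \<Rightarrow> 'v set \<Rightarrow> 'v \<Rightarrow> ('v \<Rightarrow>\<^sub>0 nat) rel \<Rightarrow> bool" where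
  "y_compatible _ V y r \<longleftrightarrow>
     (\<forall>f :: ('v, 'k) mpoly. f \<in> carrier (poly_ring V) - {0} \<longrightarrow> lterm r (in_y y f) = lterm r f)"

definition groebner_basis ::
    "'v set \<Rightarrow> ('v \<Rightarrow>\<^sub>0 nat) rel \<Rightarrow> ('v, 'k::field) mpoly set \<Rightarrow> ('v, 'k) mpoly set \<Rightarrow> bool" where
  "groebner_basis V r I B \<longleftrightarrow> finite B \<and> B \<subseteq> I - {0} \<and>
     Idl\<^bsub>poly_ring V\<^esub> (lterm r ` B) = Idl\<^bsub>poly_ring V\<^esub> (lterm r ` (I - {0}))"

definition C_ideal :: "'v set \<Rightarrow> 'v \<Rightarrow> ('v, 'k::field) mpoly set \<Rightarrow> ('v, 'k) mpoly set" where
  "C_ideal V y B = Idl\<^bsub>poly_ring V\<^esub> (ylead y ` B)"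

definition N_ideal :: "'v set \<Rightarrow> 'v \<Rightarrow> ('v, 'k::field) mpoly set \<Rightarrow> ('v, 'k) mpoly set" where
  "N_ideal V y B = Idl\<^bsub>poly_ring V\<^esub> (ylead y ` {g\<in>B. ydeg y g = 0})"

inductive geom_vertex_decomposable :: "'v set \<Rightarrow> ('v, 'k::field) mpoly set \<Rightarrow> bool" where
  unit: "geom_vertex_decomposable V I"
    if "finite V" "ideal I (poly_ring V)" "unmixed (poly_ring V) I"
       "I = carrier (poly_ring V)"
| variables: "geom_vertex_decomposable V I"
    if "finite V" "ideal I (poly_ring V)" "unmixed (poly_ring V) I"
       "W \<subseteq> V" "I = Idl\<^bsub>poly_ring V\<^esub> (Var ` W)"
| decomposition: "geom_vertex_decomposable V I"
    if "finite V" "ideal I (poly_ring V)" "unmixed (poly_ring V) I"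
       "y \<in> V" "monomial_order V r" "y_compatible TYPE('k) V y r" "groebner_basis V r I B"
       "in_y_ideal V y I =
          C_ideal V y B \<inter> (N_ideal V y B <+>\<^bsub>poly_ring V\<^esub> Idl\<^bsub>poly_ring V\<^esub> {Var y})"
       "geom_vertex_decomposable (V - {y}) (C_ideal V y B \<inter> carrier (poly_ring (V - {y})))"
       "geom_vertex_decomposable (V - {y}) (N_ideal V y B \<inter> carrier (poly_ring (V - {y})))"
  for V :: "'v set" and I :: "('v, 'k) mpoly set"


section \<open>Castelnuovo--Mumford regularity\<close>

definition free_module :: "'v set \<Rightarrow> nat \<Rightarrow> ('v, 'k::field) mpoly vec set" where
  "free_module V n = {v \<in> carrier_vec n. \<forall>i<n. v $ i \<in> carrier (poly_ring V)}"

text \<open>Minimal graded free resolutions of \<open>S/I\<close>, where \<open>S = K[V]\<close> has all variables in degree 1: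
  \[\cdots \to F_2 \to F_1 \to F_0 \to S/I \to 0.\]
  The module \<open>F\<^sub>i\<close> is the direct sum of the \<open>S(-j)\<close>, \<open>j\<close> running through the list \<open>s i\<close>; the matrix
  \<open>D i\<close> is the map from \<open>F\<^bsub>i+1\<^esub>\<close> to \<open>F\<^sub>i\<close>; the row vector \<open>a\<close> lifts the augmentation to a map from
  \<open>F\<^sub>0\<close> to \<open>S\<close>. All maps have degree 0, and minimality says that the entries of the \<open>D i\<close>
  lie in the ideal generated by the variables. Resolutions are indexed by all natural numbers; a
  finite one has \<open>s i = []\<close> from some point on.\<close>

definition min_graded_free_resolution ::
    "'v set \<Rightarrow> ('v, 'k::field) mpoly set \<Rightarrow>
     ('v, 'k) mpoly vec \<Rightarrow> (nat \<Rightarrow> int list) \<Rightarrow> (nat \<Rightarrow> ('v, 'k) mpoly mat) \<Rightarrow> bool" where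
  "min_graded_free_resolution V I a s D \<longleftrightarrow>
     (let S = poly_ring V; F = (\<lambda>i. free_module V (length (s i))) in
       a \<in> F 0 \<and>
       (\<forall>k<length (s 0). homogeneous (s 0 ! k) (a $ k)) \<and>
       (\<forall>i. D i \<in> carrier_mat (length (s i)) (length (s (Suc i)))) \<and>
       (\<forall>i. \<forall>k<length (s i). \<forall>l<length (s (Suc i)).
          D i $$ (k, l) \<in> carrier S \<and>
          homogeneous (s (Suc i) ! l - s i ! k) (D i $$ (k, l)) \<and>
          D i $$ (k, l) \<in> Idl\<^bsub>S\<^esub> (Var ` V)) \<and>
       (\<forall>f\<in>carrier S. \<exists>v\<in>F 0. f - a \<bullet> v \<in> I) \<and>
       {v \<in> F 0. a \<bullet> v \<in> I} = (\<lambda>w. D 0 *\<^sub>v w) ` F 1 \<and>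
       (\<forall>i. {v \<in> F (Suc i). D i *\<^sub>v v = 0\<^sub>v (length (s i))} =
            (\<lambda>w. D (Suc i) *\<^sub>v w) ` F (Suc (Suc i))))"

text \<open>The graded Betti number \<open>\<beta>\<^bsub>i,j\<^esub>(S/I)\<close>, the multiplicity of \<open>S(-j)\<close> in \<open>F\<^sub>i\<close>. For a homogeneous
  ideal \<open>I\<close> and finite \<open>V\<close> a minimal resolution exists and is unique up to isomorphism.\<close>

definition graded_betti :: "'v set \<Rightarrow> ('v, 'k::field) mpoly set \<Rightarrow> nat \<Rightarrow> int \<Rightarrow> nat" where
  "graded_betti V I i j =
     (THE n. \<exists>a s D. min_graded_free_resolution V I a s D \<and> n = count_list (s i) j)"

text \<open>The regularity of \<open>S/I\<close>. The supremum is taken in the extended reals; it is \<open>-\<infinity>\<close> for the zero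
  module, and a finite maximum for \<open>I\<close> homogeneous and proper and \<open>V\<close> finite.\<close>

definition reg_quotient :: "'v set \<Rightarrow> ('v, 'k::field) mpoly set \<Rightarrow> ereal" where
  "reg_quotient V I =
     Sup {ereal (real_of_int (j - int i)) | i j. graded_betti V I i j \<noteq> 0}"


section \<open>Graphs and toric ideals\<close>

record 'v graph =
  verts :: "'v set"
  edges :: "'v set set"

definition finite_simple_graph :: "'v graph \<Rightarrow> bool" where
  "finite_simple_graph G \<longleftrightarrow>
     finite (verts G) \<and> (\<forall>e\<in>edges G. e \<subseteq> verts G \<and> card e = 2)"

text \<open>The edges themselves are the variables of \<open>K[E(G)]\<close>, the vertices those of the target ring.\<close>

definition toric_ideal :: "'v graph \<Rightarrow> ('v set, 'k::field) mpoly set" where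
  "toric_ideal G =
     a_kernel (poly_ring (edges G)) (poly_ring (verts G)) (subst (\<lambda>e. \<Prod>x\<in>e. Var x))"

text \<open>The cycle on \<open>m\<close> vertices, for \<open>m \<ge> 3\<close>.\<close>

definition cycle_graph :: "nat \<Rightarrow> nat graph" where
  "cycle_graph m = \<lparr>verts = {..<m}, edges = {{i, Suc i mod m} | i. i < m}\<rparr>"

text \<open>\<open>H\<close> is (any graph isomorphic to) the quotient of the disjoint union of \<open>G\<close> and the cycle that
  identifies the edge \<open>e\<close> with an edge \<open>f\<close> of the cycle: \<open>g\<close> and \<open>c\<close> are the maps of the two graphs
  into the quotient, which are injective and have only the endpoints of \<open>e\<close> and \<open>f\<close> in common.\<close>

definition cycle_gluing :: "'v graph \<Rightarrow> 'v set \<Rightarrow> nat \<Rightarrow> 'w graph \<Rightarrow> bool" where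
  "cycle_gluing G e m H \<longleftrightarrow>
     (\<exists>f\<in>edges (cycle_graph m). \<exists>(g :: 'v \<Rightarrow> 'w) (c :: nat \<Rightarrow> 'w).
        inj_on g (verts G) \<and> inj_on c (verts (cycle_graph m)) \<and>
        g ` e = c ` f \<and>
        g ` verts G \<inter> c ` verts (cycle_graph m) = g ` e \<and>
        verts H = g ` verts G \<union> c ` verts (cycle_graph m) \<and>
        edges H = (`) g ` edges G \<union> (`) c ` edges (cycle_graph m))"

end

theory Submission
  imports Defs "Jordan_Normal_Form.Determinant"
begin

text \<open>Let \<open>t\<^sub>0 = e, t\<^sub>1, \<dots>\<close> be the \<open>2d\<close> edges of the glued cycle. The toric ideal of \<open>H\<close> is generated by
  that of \<open>G\<close> and the binomial \<open>b = t\<^sub>0 t\<^sub>2 \<cdots> - t\<^sub>1 t\<^sub>3 \<cdots>\<close>: modulo \<open>b\<close> every polynomial can be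
  rewritten so that no monomial is divisible by \<open>t\<^sub>1 t\<^sub>3 \<cdots>\<close>, and then the part of a monomial in the new
  variables can be recovered from its image. Since \<open>b\<close> is homogeneous of degree \<open>d\<close> and a
  nonzerodivisor modulo the extension of \<open>I\<^sub>G\<close>, the minimal resolution of \<open>I\<^sub>H\<close> is the mapping cone of
  multiplication by \<open>b\<close> on that of \<open>I\<^sub>G\<close>, hence
  \<open>\<beta>\<^bsub>i,j\<^esub>(H) = \<beta>\<^bsub>i,j\<^esub>(G) + \<beta>\<^bsub>i-1,j-d\<^esub>(G)\<close> and the regularity grows by \<open>d - 1\<close>. As Betti numbers are defined
  by definite description, this needs that minimal graded free resolutions exist (by
  Dickson's lemma) and that their Betti numbers are unique (homotopic comparison maps agree
  modulo the variables).\<close>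

section \<open>Polynomials as finitely supported maps\<close>

text \<open>The two monomials of \<open>b\<close> play different roles. The odd one consists of new
  edges only, while the even one contains the old edge \<open>e\<close>. So \<open>K[E(H)]\<close>
  is viewed as polynomials in the new edges with coefficients in \<open>K[E(G)]\<close>. The
  exponent of \<open>t\<^sub>1\<close>, which is 1 in the odd monomial and 0 in the even one, then
  serves twice: as the measure that makes the rewriting terminate, and as the order in which a
  leading coefficient shows that \<open>b\<close> is a nonzerodivisor. The variables of the two
  rings even have different types, so extending \<open>I\<^sub>G\<close> includes a renaming. The
  extension is therefore defined through coefficients, and exactness, homogeneity and membership are
  checked one coefficient at a time. The cone stays minimal because \<open>b\<close> has positive
  degree and hence no constant term. In its shifted copy the internal degree grows by
  \<open>d\<close> and the homological degree by 1, which is the origin of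
  \<open>d - 1\<close>.\<close>

abbreviation "keys \<equiv> Poly_Mapping.keys"
abbreviation "lookup \<equiv> Poly_Mapping.lookup"
abbreviation "single \<equiv> Poly_Mapping.single"

abbreviation gr_free :: "'v set \<Rightarrow> int list \<Rightarrow> ('v, 'k::field) mpoly vec set" where
  "gr_free V t \<equiv> free_module V (length t)"

abbreviation gr_zero :: "int list \<Rightarrow> ('v, 'k::field) mpoly vec" where
  "gr_zero t \<equiv> 0\<^sub>v (length t)"

abbreviation polys :: "'v set \<Rightarrow> ('v, 'k::field) mpoly set" where
  "polys V \<equiv> carrier (poly_ring V)"

lemma polys_iff: "p \<in> polys V \<longleftrightarrow> (\<forall>m\<in>keys p. keys m \<subseteq> V)"
  by (auto simp: poly_ring_def monomials_def)

lemma keys_monomial_add [simp]: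
  fixes m n :: "'v \<Rightarrow>\<^sub>0 nat"
  shows "keys (m + n) = keys m \<union> keys n"
  by (auto simp: in_keys_iff lookup_add)

lemma monomial_add_eq_0 [simp]:
  fixes m n :: "'v \<Rightarrow>\<^sub>0 nat"
  shows "m + n = 0 \<longleftrightarrow> m = 0 \<and> n = 0"
  by (auto simp: poly_mapping_eq_iff fun_eq_iff lookup_add)

lemma poly_ring_ops [simp]:
  "monoid.mult (poly_ring V) = (*)" "one (poly_ring V) = 1" "zero (poly_ring V) = 0" "add (poly_ring V) = (+)"
  by (simp_all add: poly_ring_def)

lemma polys_0 [simp]: "0 \<in> polys V"
  and polys_1 [simp]: "1 \<in> polys V"
  by (simp_all add: polys_iff)

lemma polys_add [simp]: "p \<in> polys V \<Longrightarrow> q \<in> polys V \<Longrightarrow> p + q \<in> polys V"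
  using keys_add[of p q] by (auto simp: polys_iff)

lemma polys_uminus [simp]: "p \<in> polys V \<Longrightarrow> - p \<in> polys V"
  by (auto simp: polys_iff in_keys_iff)

lemma polys_diff [simp]: "p \<in> polys V \<Longrightarrow> q \<in> polys V \<Longrightarrow> p - q \<in> polys V"
  using polys_add[of p V "- q"] by simp

lemma polys_mult [simp]: "p \<in> polys V \<Longrightarrow> q \<in> polys V \<Longrightarrow> p * q \<in> polys V"
  using keys_mult[of p q] by (fastforce simp: polys_iff)

lemma polys_sum: "(\<And>x. x \<in> A \<Longrightarrow> f x \<in> polys V) \<Longrightarrow> sum f A \<in> polys V"
  by (induction A rule: infinite_finite_induct) auto

lemma polys_single: "keys m \<subseteq> V \<Longrightarrow> single m c \<in> polys V"
  by (simp add: polys_iff)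

lemma polys_Var: "x \<in> V \<Longrightarrow> Var x \<in> polys V"
  by (simp add: Var_def polys_single)

lemma cring_poly_ring: "cring (poly_ring V)"
proof (rule cringI)
  show "abelian_group (poly_ring V)"
    by (rule abelian_groupI) (auto simp: add.assoc add.commute intro!: bexI[of _ "- _"])
  show "Group.comm_monoid (poly_ring V)"
    by (rule comm_monoidI) (auto simp: mult.assoc mult.commute)
qed (auto simp: algebra_simps)

section \<open>Linear maps given on monomials\<close>

lemma poly_eq_sum_single:
  "p = (\<Sum>m\<in>keys p. single m (lookup p m))"
proof (rule poly_mapping_eqI)
  fix n
  show "lookup p n =
    lookup (\<Sum>m\<in>keys p. single m (lookup p m)) n"
    by (cases "n \<in> keys p")
       (auto simp: lookup_sum lookup_single when_def sum.delta in_keys_iff)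
qed

lemma additive_eqI:
  assumes "additive A" "additive B"
    and "\<And>m. m \<in> keys p \<Longrightarrow>
      A (single m (lookup p m)) = B (single m (lookup p m))"
  shows "A p = B p"
proof -
  have "A p = (\<Sum>m\<in>keys p. A (single m (lookup p m)))"
    by (subst poly_eq_sum_single) (simp add: additive.sum[OF assms(1)])
  also have "\<dots> = (\<Sum>m\<in>keys p. B (single m (lookup p m)))"
    using assms(3) by (intro sum.cong) auto
  also have "\<dots> = B p"
    by (subst (3) poly_eq_sum_single) (simp add: additive.sum[OF assms(2)])
  finally show ?thesis .
qed

text \<open>One operator for all maps that act term by term: \<open>Q\<close> selects terms,
  \<open>\<theta>\<close> renames their monomials, and terms whose new monomials coincide are added.
  Homogeneous components, single coefficients, the toric map and the coordinates over
  \<open>K[E(G)]\<close> are all instances, so additivity and composition are proved once.\<close>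

definition monmap :: "('m \<Rightarrow> bool) \<Rightarrow> ('m \<Rightarrow> 'n) \<Rightarrow> ('m \<Rightarrow>\<^sub>0 'k::ab_group_add) \<Rightarrow> ('n \<Rightarrow>\<^sub>0 'k)" where
  "monmap Q \<theta> p = (\<Sum>m\<in>keys p.
     if Q m then single (\<theta> m) (lookup p m) else 0)"

abbreviation mon_hom :: "('m \<Rightarrow> 'n) \<Rightarrow> ('m \<Rightarrow>\<^sub>0 'k::ab_group_add) \<Rightarrow> ('n \<Rightarrow>\<^sub>0 'k)" where
  "mon_hom \<equiv> monmap (\<lambda>_. True)"

lemma monmap_superset:
  assumes "finite A" "keys p \<subseteq> A"
  shows "monmap Q \<theta> p = (\<Sum>m\<in>A. if Q m then single (\<theta> m) (lookup p m) else 0)"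
  unfolding monmap_def using assms by (intro sum.mono_neutral_left) (auto simp: in_keys_iff)

lemma additive_monmap: "additive (monmap Q \<theta>)"
proof
  fix p q :: "'a \<Rightarrow>\<^sub>0 'b"
  let ?A = "keys p \<union> keys q"
  have "keys (p + q) \<subseteq> ?A" by (rule keys_add)
  then show "monmap Q \<theta> (p + q) = monmap Q \<theta> p + monmap Q \<theta> q"
    by (subst (1 2 3) monmap_superset[of ?A])
       (auto simp: lookup_add single_add simp flip: sum.distrib intro!: sum.cong)
qed

lemmas monmap_add = additive.add[OF additive_monmap]
lemmas monmap_sum = additive.sum[OF additive_monmap]
lemmas monmap_diff = additive.diff[OF additive_monmap]

lemma monmap_0 [simp]: "monmap Q \<theta> 0 = 0"
  by (simp add: monmap_def)

lemma monmap_single: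
  "monmap Q \<theta> (single m c) = (if Q m then single (\<theta> m) c else 0)"
  by (cases "c = 0") (auto simp: monmap_def)

text \<open>Both sides expand into the same double sum over pairs of terms. Separate filters and
  renamings on the factors cover multiplication by a homogeneous or a renamed polynomial, where one
  factor passes unfiltered.\<close>

lemma monmap_mult:
  fixes p q :: "('v, 'k::field) mpoly"
  assumes "\<And>m n. m \<in> keys p \<Longrightarrow> n \<in> keys q \<Longrightarrow>
      (Q (m + n) \<longleftrightarrow> Q1 m \<and> Q2 n) \<and> (Q1 m \<longrightarrow> Q2 n \<longrightarrow> \<theta> (m + n) = \<theta>1 m + \<theta>2 n)"
  shows "monmap Q \<theta> (p * q) = monmap Q1 \<theta>1 p * monmap Q2 \<theta>2 q"
proof -
  have "monmap Q \<theta> (p * q) = monmap Q \<theta>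
      ((\<Sum>m\<in>keys p. single m (lookup p m)) *
       (\<Sum>n\<in>keys q. single n (lookup q n)))"
    using poly_eq_sum_single[of p] poly_eq_sum_single[of q] by simp
  also have "\<dots> = (\<Sum>m\<in>keys p. \<Sum>n\<in>keys q.
      monmap Q \<theta> (single (m + n) (lookup p m * lookup q n)))"
    by (simp add: sum_product monmap_sum mult_single)
  also have "\<dots> = (\<Sum>m\<in>keys p. \<Sum>n\<in>keys q.
      (if Q1 m then single (\<theta>1 m) (lookup p m) else 0) *
      (if Q2 n then single (\<theta>2 n) (lookup q n) else 0))"
    using assms by (intro sum.cong refl) (auto simp: monmap_single mult_single)
  also have "\<dots> = monmap Q1 \<theta>1 p * monmap Q2 \<theta>2 q"
    by (simp add: sum_product monmap_def)
  finally show ?thesis .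
qed

lemma monmap_comp:
  "monmap Q \<theta> (monmap Q' \<theta>' p) = monmap (\<lambda>m. Q' m \<and> Q (\<theta>' m)) (\<lambda>m. \<theta> (\<theta>' m)) p"
  unfolding monmap_def[of Q' \<theta>'] monmap_sum
  by (auto simp: monmap_def[of "\<lambda>m. Q' m \<and> Q (\<theta>' m)"] monmap_single intro!: sum.cong)

lemma monmap_cong:
  assumes "\<And>m. m \<in> keys p \<Longrightarrow> Q m = Q' m \<and> (Q m \<longrightarrow> \<theta> m = \<theta>' m)"
  shows "monmap Q \<theta> p = monmap Q' \<theta>' p"
  unfolding monmap_def using assms by (intro sum.cong) auto

lemma monmap_id: "(\<And>m. m \<in> keys p \<Longrightarrow> Q m \<and> \<theta> m = m) \<Longrightarrow> monmap Q \<theta> p = p"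
  by (subst (2) poly_eq_sum_single) (auto simp: monmap_def intro!: sum.cong)

lemma keys_monmap: "keys (monmap Q \<theta> p) \<subseteq> \<theta> ` {m \<in> keys p. Q m}"
  unfolding monmap_def by (rule order.trans[OF keys_sum]) (auto split: if_splits)

lemma lookup_monmap:
  assumes "inj_on \<theta> M" "keys p \<subseteq> M" "m \<in> M"
  shows "lookup (monmap Q \<theta> p) (\<theta> m) = (if Q m then lookup p m else 0)"
proof -
  have "lookup (monmap Q \<theta> p) (\<theta> m) =
      (\<Sum>n\<in>keys p. if n = m then (if Q m then lookup p m else 0) else 0)"
    unfolding monmap_def lookup_sum using assms
    by (intro sum.cong refl) (auto simp: lookup_single when_def inj_on_def)
  then show ?thesis by (auto simp: in_keys_iff)
qed

lemma lookup_monmap_id: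
  "lookup (monmap Q (\<lambda>m. m) p) m = (if Q m then lookup p m else 0)"
  using lookup_monmap[of "\<lambda>m. m" UNIV p m Q] by simp

lemma lookup_single_mult:
  fixes p :: "('v, 'k::field) mpoly"
  shows "lookup (single r c * p) (r + m) = c * lookup p m"
proof -
  have eq: "monmap (\<lambda>n. n = m) (\<lambda>n. n) p = single m (lookup p m)" for m and p :: "('v, 'k) mpoly"
    by (rule poly_mapping_eqI) (auto simp: lookup_monmap_id lookup_single when_def)
  \<comment> \<open>Cancellation of \<open>r\<close> turns the filter for \<open>r + m\<close> on
    the product into the filter for \<open>m\<close> on \<open>p\<close>.\<close>
  have "monmap (\<lambda>n. n = r + m) (\<lambda>n. n) (single r c * p) =
      mon_hom (\<lambda>n. n) (single r c) * monmap (\<lambda>n. n = m) (\<lambda>n. n) p"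
    by (rule monmap_mult) (auto split: if_splits)
  then show ?thesis unfolding eq by (simp add: monmap_single mult_single) (metis lookup_single_eq)
qed

lemma monmap_eq_0D:
  assumes "inj_on \<theta> M" "keys p \<subseteq> M" "mon_hom \<theta> p = 0"
  shows "p = 0"
proof (rule poly_mapping_eqI)
  fix m
  show "lookup p m = lookup 0 m"
    using lookup_monmap[OF assms(1,2), of m "\<lambda>_. True"] assms(2,3) by (cases "m \<in> M") (auto simp: in_keys_iff)
qed

section \<open>Degrees and homogeneous components\<close>

lemma mdeg_superset:
  "finite A \<Longrightarrow> keys m \<subseteq> A \<Longrightarrow> mdeg m = (\<Sum>x\<in>A. lookup m x)"
  unfolding mdeg_def by (intro sum.mono_neutral_left) (auto simp: in_keys_iff)

lemma single_neq_0 [simp]: "c \<noteq> 0 \<Longrightarrow> single x c \<noteq> 0"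
  by (metis lookup_single_eq lookup_zero)

lemma mdeg_add [simp]: "mdeg (m + n) = mdeg m + mdeg n"
  by (subst (1 2 3) mdeg_superset[of "keys m \<union> keys n"])
     (auto simp: lookup_add sum.distrib)

lemma mdeg_0 [simp]: "mdeg 0 = 0"
  by (simp add: mdeg_def)

lemma mdeg_single [simp]: "mdeg (single x k) = k"
  by (subst mdeg_superset[of "{x}"]) auto

lemma mdeg_sum: "mdeg (sum f A) = (\<Sum>x\<in>A. mdeg (f x))"
  by (induction A rule: infinite_finite_induct) auto

lemma mdeg_eq_0 [simp]: "mdeg m = 0 \<longleftrightarrow> m = 0"
  by (auto simp: mdeg_def in_keys_iff poly_mapping_eq_iff fun_eq_iff)

definition hcomp :: "int \<Rightarrow> ('v, 'k::field) mpoly \<Rightarrow> ('v, 'k) mpoly" where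
  "hcomp n = monmap (\<lambda>m. int (mdeg m) = n) (\<lambda>m. m)"

lemma additive_hcomp: "additive (hcomp n)"
  unfolding hcomp_def by (rule additive_monmap)

lemmas hcomp_sum = additive.sum[OF additive_hcomp]
lemmas hcomp_add = additive.add[OF additive_hcomp]
lemmas hcomp_diff = additive.diff[OF additive_hcomp]

lemma lookup_hcomp:
  "lookup (hcomp n p) m = (if int (mdeg m) = n then lookup p m else 0)"
  by (simp add: hcomp_def lookup_monmap_id)

lemma keys_hcomp: "keys (hcomp n p) = {m \<in> keys p. int (mdeg m) = n}"
  by (auto simp: in_keys_iff lookup_hcomp split: if_splits)

lemma hcomp_polys [simp]: "p \<in> polys V \<Longrightarrow> hcomp n p \<in> polys V"
  by (auto simp: polys_iff keys_hcomp)

lemma homogeneous_hcomp [simp]: "homogeneous n (hcomp n p)"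
  by (simp add: homogeneous_def keys_hcomp)

lemma hcomp_homogeneous: "homogeneous i p \<Longrightarrow> hcomp n p = (if i = n then p else 0)"
  by (rule poly_mapping_eqI) (auto simp: lookup_hcomp homogeneous_def in_keys_iff)

lemma hcomp_mult: "homogeneous i p \<Longrightarrow> hcomp (i + n) (p * q) = p * hcomp n q"
  unfolding hcomp_def
  by (subst monmap_mult[where ?Q1.0 = "\<lambda>_. True" and ?\<theta>1.0 = "\<lambda>m. m"
        and ?Q2.0 = "\<lambda>m. int (mdeg m) = n" and ?\<theta>2.0 = "\<lambda>m. m"])
     (auto simp: homogeneous_def monmap_id)

lemma homogeneous_0 [simp]: "homogeneous n 0"
  by (simp add: homogeneous_def)

lemma homogeneous_add: "homogeneous n p \<Longrightarrow> homogeneous n q \<Longrightarrow> homogeneous n (p + q)"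
  using keys_add[of p q] by (auto simp: homogeneous_def)

lemma homogeneous_uminus: "homogeneous n p \<Longrightarrow> homogeneous n (- p)"
  by (auto simp: homogeneous_def in_keys_iff)

lemma homogeneous_mult: "homogeneous i p \<Longrightarrow> homogeneous j q \<Longrightarrow> homogeneous (i + j) (p * q)"
  using keys_mult[of p q] by (fastforce simp: homogeneous_def)

lemma homogeneous_sum: "(\<And>x. x \<in> A \<Longrightarrow> homogeneous n (f x)) \<Longrightarrow> homogeneous n (sum f A)"
  by (induction A rule: infinite_finite_induct) (auto intro: homogeneous_add)

lemma homogeneous_single: "int (mdeg m) = n \<Longrightarrow> homogeneous n (single m c)"
  by (simp add: homogeneous_def)

lemma homogeneous_1 [simp]: "homogeneous 0 1"
  by (simp add: homogeneous_def)

text \<open>Exponents are natural numbers, so only the pair \<open>0 + 0\<close> contributes to the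
  constant term. Taking constant terms is thus the ring map modulo the variables, on which all
  minimality arguments rest.\<close>

lemma lookup_mult_0:
  fixes p q :: "('v, 'k::field) mpoly"
  shows "lookup (p * q) 0 = lookup p 0 * lookup q 0"
proof -
  have eq: "monmap (\<lambda>m. m = 0) (\<lambda>m. m) p = single 0 (lookup p 0)" for p :: "('v, 'k) mpoly"
    by (rule poly_mapping_eqI) (auto simp: lookup_monmap_id lookup_single when_def)
  have "monmap (\<lambda>m. m = 0) (\<lambda>m. m) (p * q) = monmap (\<lambda>m. m = 0) (\<lambda>m. m) p * monmap (\<lambda>m. m = 0) (\<lambda>m. m) q"
    by (rule monmap_mult) auto
  then show ?thesis
    by (metis eq mult_single add_0 lookup_single_eq)
qed

text \<open>Polynomials without constant term form an ideal containing the variables; conversely,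
  every nonconstant term has a variable to split off. This turns the minimality condition on
  resolutions into vanishing constant terms.\<close>

lemma irrelevant_ideal_iff:
  "p \<in> Idl\<^bsub>poly_ring V\<^esub> (Var ` V) \<longleftrightarrow> p \<in> polys V \<and> lookup p 0 = 0"
proof -
  interpret cring "poly_ring V" by (rule cring_poly_ring)
  let ?J = "{p \<in> polys V. lookup p 0 = (0::'b)}"
  have sub: "Var ` V \<subseteq> polys V" by (auto intro: polys_Var)
  have a_inv: "a_inv (poly_ring V) p = - p" if "p \<in> polys V" for p :: "('a, 'b) mpoly"
    using that by (intro minus_equality) auto
  have "ideal ?J (poly_ring V)"
  proof (rule idealI)
    show "subgroup ?J (add_monoid (poly_ring V))"
      using a_inv by (intro add.subgroupI) (auto simp: lookup_add simp flip: a_inv_def)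
  qed (auto simp: ring_axioms lookup_mult_0)
  then have 1: "Idl\<^bsub>poly_ring V\<^esub> (Var ` V) \<subseteq> ?J"
    by (rule genideal_minimal) (auto simp: Var_def polys_single lookup_single when_def)
  have 2: "p \<in> Idl\<^bsub>poly_ring V\<^esub> (Var ` V)" if p: "p \<in> ?J" for p :: "('a, 'b) mpoly"
  proof -
    interpret I: ideal "Idl\<^bsub>poly_ring V\<^esub> (Var ` V :: ('a, 'b) mpoly set)" "poly_ring V"
      by (rule genideal_ideal[OF sub])
    have single: "single m c \<in> Idl\<^bsub>poly_ring V\<^esub> (Var ` V)"
      if m: "keys m \<subseteq> V" "m \<noteq> 0" for m and c :: 'b
    proof -
      obtain x where x: "x \<in> keys m"
        using m(2) by (metis all_not_in_conv keys_eq_empty)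
      have eq: "m = single x 1 + (m - single x 1)"
        using x by (intro poly_mapping_eqI) (auto simp: lookup_add lookup_minus lookup_single when_def in_keys_iff)
      then have "keys (m - single x 1) \<subseteq> V"
        using m(1) by (metis keys_monomial_add le_sup_iff)
      moreover have "(Var x :: ('a, 'b) mpoly) \<in> Idl\<^bsub>poly_ring V\<^esub> (Var ` V)"
        using x m(1) genideal_self[OF sub] by auto
      ultimately have "Var x * single (m - single x 1) c \<in> Idl\<^bsub>poly_ring V\<^esub> (Var ` V)"
        using I.I_r_closed[of "Var x" "single (m - single x 1) c"]
        by (simp add: polys_single)
      then show ?thesis using eq by (simp add: Var_def mult_single)
    qed
    have "(\<Sum>m\<in>A. single m (lookup p m)) \<in> Idl\<^bsub>poly_ring V\<^esub> (Var ` V)"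
      if "A \<subseteq> keys p" for A
    proof -
      have "finite A" using that by (meson finite_keys rev_finite_subset)
      then show ?thesis using that
      proof (induction A rule: finite_induct)
        case empty
        then show ?case using I.additive_subgroup_axioms additive_subgroup.zero_closed by fastforce
      next
        case (insert m A)
        have "single m (lookup p m) \<in> Idl\<^bsub>poly_ring V\<^esub> (Var ` V)"
          using p insert by (intro single) (auto simp: polys_iff in_keys_iff)
        then show ?case
          using insert I.a_closed[of "single m (lookup p m)"
              "\<Sum>m\<in>A. single m (lookup p m)"]
          by simp
      qed
    qed
    from this[of "keys p"] show ?thesis by (simp flip: poly_eq_sum_single)
  qed
  show ?thesis using 1 2 by auto
qed

section \<open>Finite generation of submodules of free modules\<close>

lemma free_module_iff:
  "v \<in> free_module V n \<longleftrightarrow> v \<in> carrier_vec n \<and> (\<forall>i<n. v $ i \<in> polys V)"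
  by (auto simp: free_module_def)

lemma free_moduleD:
  assumes "v \<in> free_module V n"
  shows "v \<in> carrier_vec n" "dim_vec v = n" "\<And>i. i < n \<Longrightarrow> v $ i \<in> polys V"
  using assms by (auto simp: free_module_iff)

lemma free_module_closed [simp]:
  "0\<^sub>v n \<in> free_module V n"
  "v \<in> free_module V n \<Longrightarrow> w \<in> free_module V n \<Longrightarrow> v + w \<in> free_module V n"
  "v \<in> free_module V n \<Longrightarrow> w \<in> free_module V n \<Longrightarrow> v - w \<in> free_module V n"
  "v \<in> free_module V n \<Longrightarrow> - v \<in> free_module V n"
  "c \<in> polys V \<Longrightarrow> v \<in> free_module V n \<Longrightarrow> c \<cdot>\<^sub>v v \<in> free_module V n"
  "unit_vec n i \<in> free_module V n"
  by (auto simp: free_module_iff unit_vec_def)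

definition free_submodule :: "'v set \<Rightarrow> nat \<Rightarrow> ('v, 'k::field) mpoly vec set \<Rightarrow> bool" where
  "free_submodule V n M \<longleftrightarrow> M \<subseteq> free_module V n \<and> 0\<^sub>v n \<in> M \<and>
     (\<forall>v\<in>M. \<forall>w\<in>M. v + w \<in> M) \<and> (\<forall>c\<in>polys V. \<forall>v\<in>M. c \<cdot>\<^sub>v v \<in> M)"

inductive_set gen_span :: "'v set \<Rightarrow> nat \<Rightarrow> ('v, 'k::field) mpoly vec set \<Rightarrow> ('v, 'k) mpoly vec set"
  for V n B where
  zero: "0\<^sub>v n \<in> gen_span V n B"
| add: "b \<in> B \<Longrightarrow> c \<in> polys V \<Longrightarrow> v \<in> gen_span V n B \<Longrightarrow> c \<cdot>\<^sub>v b + v \<in> gen_span V n B"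

lemma gen_span_subset: "free_submodule V n M \<Longrightarrow> B \<subseteq> M \<Longrightarrow> gen_span V n B \<subseteq> M"
proof
  fix v assume "free_submodule V n M" "B \<subseteq> M" "v \<in> gen_span V n B"
  from this(3,1,2) show "v \<in> M" by induction (auto simp: free_submodule_def)
qed

section \<open>Dickson's lemma and a well-founded term order\<close>

lemma ex_mono_subseq:
  fixes u :: "nat \<Rightarrow> nat"
  shows "\<exists>f. strict_mono (f :: nat \<Rightarrow> nat) \<and> mono (\<lambda>i. u (f i))"
proof -
  obtain f where f: "strict_mono f" "monoseq (\<lambda>i. u (f i))"
    using seq_monosub[of u] by blast
  show ?thesis
  proof (cases "incseq (\<lambda>i. u (f i))")
    case True
    then show ?thesis using f(1) by blast
  next
    case False
    then have dec: "decseq (\<lambda>i. u (f i))"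
      using f(2) by (auto simp: monoseq_iff)
    \<comment> \<open>A decreasing sequence of natural numbers is constant from the index of its
      least value on, hence also increasing there.\<close>
    obtain N where N: "\<And>i. u (f N) \<le> u (f i)"
      using ex_has_least_nat[of "\<lambda>_. True" 0 "\<lambda>i. u (f i)"] by auto
    have "u (f (i + N)) = u (f N)" for i
      using N[of "i + N"] decseqD[OF dec, of N "i + N"] by simp
    then have "mono (\<lambda>i. u (f (i + N)))" by (simp add: mono_def)
    moreover have "strict_mono (\<lambda>i. f (i + N))"
      using f(1) by (simp add: strict_mono_def)
    ultimately show ?thesis by blast
  qed
qed

text \<open>Each variable is treated by thinning out the subsequence already found for the others;
  monotonicity survives passing to subsequences.\<close>

lemma dickson:
  fixes s :: "nat \<Rightarrow> 'a \<Rightarrow> nat"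
  assumes "finite A"
  shows "\<exists>f. strict_mono (f :: nat \<Rightarrow> nat) \<and> (\<forall>x\<in>A. mono (\<lambda>i. s (f i) x))"
  using assms
proof induction
  case empty
  then show ?case using strict_mono_id by auto
next
  case (insert a A)
  then obtain f where f: "strict_mono (f :: nat \<Rightarrow> nat)" "\<And>x. x \<in> A \<Longrightarrow> mono (\<lambda>i. s (f i) x)" by blast
  obtain g where g: "strict_mono (g :: nat \<Rightarrow> nat)" "mono (\<lambda>i. s (f (g i)) a)"
    using ex_mono_subseq[of "\<lambda>i. s (f i) a"] by blast
  have "strict_mono (\<lambda>i. f (g i))"
    using f(1) g(1) by (simp add: strict_mono_def)
  moreover have "mono (\<lambda>i. s (f (g i)) x)" if "x \<in> A" for x
    using f(2)[OF that] strict_mono_mono[OF g(1)] by (auto simp: mono_def)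
  ultimately show ?case using g(2) by (intro exI[of _ "\<lambda>i. f (g i)"]) auto
qed

text \<open>\<open>T0\<close> consists of the elements of \<open>T\<close> that are minimal for
  divisibility. An infinite \<open>T0\<close> would contain two distinct comparable elements by
  \<open>dickson\<close>, and descending by degree from any \<open>t\<close> ends at a minimal
  element.\<close>

lemma dickson_basis:
  fixes T :: "('a \<Rightarrow>\<^sub>0 nat) set"
  assumes "finite A" "\<And>t. t \<in> T \<Longrightarrow> keys t \<subseteq> A"
  shows "\<exists>T0\<subseteq>T. finite T0 \<and> (\<forall>t\<in>T. \<exists>u\<in>T0. \<forall>x. lookup u x \<le> lookup t x)"
proof -
  let ?le = "\<lambda>u t. \<forall>x. lookup u x \<le> lookup t (x::'a)"
  define T0 where "T0 = {t \<in> T. \<forall>u\<in>T. ?le u t \<longrightarrow> u = t}"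
  have "finite T0"
  proof (rule ccontr)
    assume "infinite T0"
    then obtain s :: "nat \<Rightarrow> 'a \<Rightarrow>\<^sub>0 nat" where s: "inj s" "range s \<subseteq> T0"
      using infinite_countable_subset by blast
    obtain f where f: "strict_mono (f :: nat \<Rightarrow> nat)" "\<And>x. x \<in> A \<Longrightarrow> mono (\<lambda>i. lookup (s (f i)) x)"
      using dickson[OF assms(1), of "\<lambda>i. lookup (s i)"] by blast
    have "s (f 0) \<in> T0" "s (f 1) \<in> T0" using s by auto
    moreover have "?le (s (f 0)) (s (f 1))"
    proof
      fix x
      show "lookup (s (f 0)) x \<le> lookup (s (f 1)) x"
      proof (cases "x \<in> A")
        case True
        then show ?thesis using monoD[OF f(2)[OF True], of 0 1] by simp
      next
        case False
        then have "x \<notin> keys (s (f 0))" using assms(2) s by (auto simp: T0_def)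
        then show ?thesis by (simp add: in_keys_iff)
      qed
    qed
    ultimately have "s (f 0) = s (f 1)" by (auto simp: T0_def)
    then show False using s(1) f(1) by (metis injD zero_neq_one strict_mono_eq)
  qed
  moreover have "\<exists>u\<in>T0. ?le u t" if "t \<in> T" for t
    using that
  proof (induction "mdeg t" arbitrary: t rule: less_induct)
    case less
    show ?case
    proof (cases "t \<in> T0")
      case False
      then obtain u where u: "u \<in> T" "?le u t" "u \<noteq> t" using less.prems by (auto simp: T0_def)
      have eq: "t = u + (t - u)"
        using u(2) by (intro poly_mapping_eqI) (auto simp: lookup_add lookup_minus)
      then have "mdeg t = mdeg u + mdeg (t - u)" by (metis mdeg_add)
      moreover have "t - u \<noteq> 0" using eq u(3) by auto
      ultimately have "mdeg u < mdeg t" by (metis mdeg_eq_0 add_gr_0 less_add_same_cancel1 neq0_conv)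
      then obtain w where "w \<in> T0" "?le w u" using less.hyps u(1) by blast
      then show ?thesis using u(2) order_trans by blast
    qed auto
  qed
  ultimately show ?thesis by (intro exI[of _ T0]) (auto simp: T0_def)
qed

lemma single_le_single: "a \<le> b \<Longrightarrow> single i a \<le> single (i::nat) (b::nat)"
proof (cases "a = b")
  case False
  assume "a \<le> b"
  with False have "single i a < single i b"
    by (auto simp: less_poly_mapping.rep_eq less_fun_def lookup_single when_def intro!: exI[of _ i])
  then show ?thesis by simp
qed simp

text \<open>The order on finitely supported maps is lexicographic and compatible with addition;
  writing both sides as sums of \<open>single\<close> terms lets \<open>sum_mono\<close> compare
  them variable by variable.\<close>

lemma poly_mapping_le_pointwise:
  fixes p q :: "nat \<Rightarrow>\<^sub>0 nat"
  assumes "\<And>x. lookup p x \<le> lookup q x"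
  shows "p \<le> q"
proof -
  let ?A = "keys p \<union> keys q"
  have eq: "r = (\<Sum>x\<in>?A. single x (lookup r x))" if "keys r \<subseteq> ?A" for r :: "nat \<Rightarrow>\<^sub>0 nat"
  proof (rule poly_mapping_eqI)
    fix n show "lookup r n = lookup (\<Sum>x\<in>?A. single x (lookup r x)) n"
      using that by (cases "n \<in> ?A") (auto simp: lookup_sum lookup_single when_def in_keys_iff)
  qed
  have "(\<Sum>x\<in>?A. single x (lookup p x)) \<le> (\<Sum>x\<in>?A. single x (lookup q x))"
    using assms by (intro sum_mono single_le_single)
  then show ?thesis using eq[of p] eq[of q] by simp
qed

text \<open>With infinitely many variables lexicographic descent can go on forever. With all
  supports in the finite set \<open>A\<close>, Dickson's lemma yields two places in a descending
  chain where the later monomial is a multiple of the earlier one, hence not smaller.\<close>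

lemma wf_monomials:
  assumes "finite A"
  shows "wf {(p, q :: nat \<Rightarrow>\<^sub>0 nat). keys p \<subseteq> A \<and> keys q \<subseteq> A \<and> p < q}"
  unfolding wf_iff_no_infinite_down_chain
proof
  assume "\<exists>f. \<forall>i. (f (Suc i), f i) \<in> {(p, q :: nat \<Rightarrow>\<^sub>0 nat). keys p \<subseteq> A \<and> keys q \<subseteq> A \<and> p < q}"
  then obtain f where f: "\<And>i. f (Suc i) < (f i :: nat \<Rightarrow>\<^sub>0 nat)" "\<And>i. keys (f i) \<subseteq> A" by auto
  obtain g where g: "strict_mono (g :: nat \<Rightarrow> nat)" "\<And>x. x \<in> A \<Longrightarrow> mono (\<lambda>i. lookup (f (g i)) x)"
    using dickson[OF assms(1), of "\<lambda>i. lookup (f i)"] by blast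
  have "f (g 0) \<le> f (g 1)"
  proof (rule poly_mapping_le_pointwise)
    fix x show "lookup (f (g 0)) x \<le> lookup (f (g 1)) x"
    proof (cases "x \<in> A")
      case True
      then show ?thesis using monoD[OF g(2)[OF True], of 0 1] by simp
    next
      case False
      then have "x \<notin> keys (f (g 0))" using f(2) by auto
      then show ?thesis by (simp add: in_keys_iff)
    qed
  qed
  moreover have "g 0 < g 1" using g(1) by (simp add: strict_mono_def)
  then have "f (g 1) < f (g 0)"
  proof -
    have "f j < f i" if "i < j" for i j
      using that by (induction rule: less_Suc_induct) (use f(1) in \<open>auto intro: less_trans\<close>)
    then show ?thesis using \<open>g 0 < g 1\<close> by blast
  qed
  ultimately show False by simp
qed

text \<open>The term \<open>m\<close> in the \<open>k\<close>-th component is encoded as the monomial \<open>key (k, m)\<close> in variables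
  indexed by natural numbers, so that the lexicographic order of the library is a term order.\<close>

theorem finitely_generated_submodule:
  fixes M :: "('v, 'k::field) mpoly vec set"
  assumes fin: "finite V" and M: "free_submodule V n M"
  shows "\<exists>B\<subseteq>M. finite B \<and> gen_span V n B = M"
proof -
  \<comment> \<open>Variables get the indices below \<open>N\<close> and components the indices
    \<open>N + k\<close>, so all keys are monomials in \<open>N + n\<close> variables.\<close>
  obtain idx :: "'v \<Rightarrow> nat" and N where idx: "idx ` V = {i. i < N}" "inj_on idx V"
    using finite_imp_inj_to_nat_seg[OF fin] by blast
  define enc where "enc m = (\<Sum>x\<in>V. single (idx x) (lookup m x))" for m :: "'v \<Rightarrow>\<^sub>0 nat"
  define pos :: "nat \<Rightarrow> nat \<Rightarrow>\<^sub>0 nat" where "pos k = single (N + k) 1" for k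
  define key where "key = (\<lambda>(k, m). pos k + enc m)"
  define supp where "supp v = {(k, m). k < n \<and> m \<in> keys (v $ k)}" for v :: "('v, 'k) mpoly vec"
  define lead where "lead v = Max (key ` supp v)" for v
  let ?W = "{..<N + n}"
  have enc_add: "enc (m + m') = enc m + enc m'" for m m'
    by (simp add: enc_def lookup_add single_add sum.distrib)
  have lookup_enc: "lookup (enc m) (idx x) = lookup m x" if "x \<in> V" for m x
  proof -
    have "lookup (enc m) (idx x) = (\<Sum>y\<in>V. if y = x then lookup m x else 0)"
      unfolding enc_def lookup_sum using idx(2) that
      by (intro sum.cong refl) (auto simp: lookup_single when_def inj_on_def)
    then show ?thesis using that fin by simp
  qed
  have keys_enc: "keys (enc m) \<subseteq> {..<N}" for m
  proof -
    have "keys (enc m) \<subseteq> (\<Union>x\<in>V. keys (single (idx x) (lookup m x)))"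
      unfolding enc_def by (induction V rule: infinite_finite_induct) auto
    also have "\<dots> \<subseteq> {..<N}" using idx(1) by auto
    finally show ?thesis .
  qed
  have lookup_key1: "lookup (key (k, m)) (idx x) = lookup m x" if "x \<in> V" for k m x
  proof -
    have "idx x < N" using that idx(1) by auto
    then show ?thesis using that by (simp add: key_def lookup_add lookup_enc pos_def lookup_single when_def)
  qed
  have lookup_key2: "lookup (key (k, m)) (N + j) = (if j = k then 1 else 0)" for k m j
    using keys_enc[of m] by (auto simp: key_def lookup_add pos_def lookup_single when_def in_keys_iff subset_iff)
  have keys_key: "keys (key (k, m)) \<subseteq> ?W" if "k < n" for k m
    using that keys_enc[of m] by (auto simp: key_def pos_def)
  have inj_key: "k = j \<and> m = m'" if "key (k, m) = key (j, m')" "keys m \<subseteq> V" "keys m' \<subseteq> V" for k m j m'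
  proof
    have "(1::nat) = (if k = j then 1 else 0)"
      using arg_cong[OF that(1), of "\<lambda>r. lookup r (N + k)"] unfolding lookup_key2 by (simp only: refl if_True)
    then show "k = j" by (cases "k = j") simp_all
    show "m = m'"
    proof (rule poly_mapping_eqI)
      fix x show "lookup m x = lookup m' x"
      proof (cases "x \<in> V")
        case True show ?thesis using arg_cong[OF that(1), of "\<lambda>r. lookup r (idx x)"] unfolding lookup_key1[OF True] by assumption
      next
        case False then show ?thesis using that(2,3) by (metis in_keys_iff subsetD)
      qed
    qed
  qed
  have fin_supp: "finite (supp v)" for v
    by (rule finite_subset[of _ "SIGMA k:{..<n}. keys (v $ k)"]) (auto simp: supp_def)
  have Mf: "v \<in> free_module V n" if "v \<in> M" for v using that M by (auto simp: free_submodule_def)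
  have supp_ne: "supp v \<noteq> {}" if "v \<in> M" "v \<noteq> 0\<^sub>v n" for v
  proof
    assume "supp v = {}"
    then have "v $ k = 0" if "k < n" for k using that by (auto simp: supp_def)
    moreover have "dim_vec v = n" using Mf[OF that(1)] by (rule free_moduleD)
    ultimately have "v = 0\<^sub>v n" by (intro eq_vecI) auto
    with that(2) show False by simp
  qed
  have lead_in: "lead v \<in> key ` supp v" if "v \<in> M" "v \<noteq> 0\<^sub>v n" for v
    unfolding lead_def using supp_ne[OF that] fin_supp by (intro Max_in) auto
  have lead_ge: "key t \<le> lead v" if "t \<in> supp v" for t v
    unfolding lead_def using that fin_supp by (intro Max_ge) auto
  have keys_supp: "keys m \<subseteq> V" if "v \<in> M" "(k, m) \<in> supp v" for v k m
  proof -
    have "v $ k \<in> polys V" "m \<in> keys (v $ k)"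
      using free_moduleD(3)[OF Mf[OF that(1)], of k] that(2) by (auto simp: supp_def)
    then show ?thesis by (auto simp: polys_iff)
  qed
  have keys_lead: "keys (lead v) \<subseteq> ?W" if "v \<in> M" "v \<noteq> 0\<^sub>v n" for v
  proof -
    obtain k m where "lead v = key (k, m)" "k < n" using lead_in[OF \<open>v \<in> M\<close> \<open>v \<noteq> 0\<^sub>v n\<close>] by (auto simp: supp_def)
    then show ?thesis using keys_key[of k m] by simp
  qed
  \<comment> \<open>Finitely many leading keys divide all the others; one element of
    \<open>M\<close> for each of them will generate \<open>M\<close>.\<close>
  obtain T where T: "T \<subseteq> lead ` (M - {0\<^sub>v n})" "finite T"
    "\<And>t. t \<in> lead ` (M - {0\<^sub>v n}) \<Longrightarrow> \<exists>u\<in>T. \<forall>x. lookup u x \<le> lookup t x"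
  proof -
    have "keys t \<subseteq> ?W" if "t \<in> lead ` (M - {0\<^sub>v n})" for t
      using that keys_lead by blast
    from dickson_basis[OF finite_lessThan this] show ?thesis using that by metis
  qed
  obtain B where B: "B \<subseteq> M - {0\<^sub>v n}" "finite B" "lead ` B = T"
    using finite_subset_image[OF T(2,1)] by auto
  have "v \<in> gen_span V n B" if "v \<in> M" for v
    using that
  proof (induction v rule: wf_induct_rule[OF wf_inv_image[OF wf_monomials[of ?W], of lead]])
    case 1 then show ?case by simp
  next
    case (2 v)
    show ?case
    proof (cases "v = 0\<^sub>v n")
      case True then show ?thesis by (simp add: gen_span.zero)
    next
      case False
      obtain u where u: "u \<in> T" "\<And>x. lookup u x \<le> lookup (lead v) x"
        using T(3) 2(2) False by blast
      obtain b where b: "b \<in> B" "lead b = u" using u(1) B(3) by auto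
      have bM: "b \<in> M" "b \<noteq> 0\<^sub>v n" using b(1) B(1) by auto
      obtain k m where km: "(k, m) \<in> supp v" "lead v = key (k, m)" using lead_in[OF 2(2) False] by auto
      obtain k' m' where km': "(k', m') \<in> supp b" "lead b = key (k', m')" using lead_in[OF bM] by auto
      \<comment> \<open>The exponent at index \<open>N + k'\<close> is 1 in the key of
        \<open>b\<close>, so divisibility forces both leading terms into the same component.\<close>
      have "k' = k"
        using u(2)[of "N + k'"] lookup_key2[of k m k'] lookup_key2[of k' m' k'] b(2) km km'
        by (auto split: if_splits)
      note km' = km'[unfolded this]
      have le: "lookup m' x \<le> lookup m x" for x
      proof (cases "x \<in> V")
        case True then show ?thesis
          using u(2)[of "idx x"] lookup_key1[OF True, of k m] lookup_key1[OF True, of k m'] b(2) km km' by simp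
      next
        case False then show ?thesis
          using keys_supp[OF bM(1) km'(1)] by (metis in_keys_iff subsetD le0)
      qed
      define r where "r = m - m'"
      have m: "m = r + m'"
        using le unfolding r_def by (intro poly_mapping_eqI) (auto simp: lookup_add lookup_minus)
      have keys_r: "keys r \<subseteq> V" using keys_supp[OF 2(2) km(1)] m by auto
      define c where "c = lookup (v $ k) m / lookup (b $ k) m'"
      have b0: "lookup (b $ k) m' \<noteq> 0" using km'(1) by (auto simp: supp_def)
      have kn: "k < n" using km(1) by (auto simp: supp_def)
      \<comment> \<open>One division step: the multiple of \<open>b\<close> is chosen to cancel the
        leading term of \<open>v\<close>, so that \<open>lead\<close> drops.\<close>
      define w where "w = v + single r (- c) \<cdot>\<^sub>v b"
      have dims: "dim_vec v = n" "dim_vec b = n" using Mf[OF 2(2)] Mf[OF bM(1)] by (auto dest: free_moduleD)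
      have wM: "w \<in> M"
      proof -
        have "single r (- c) \<cdot>\<^sub>v b \<in> M"
          using M bM(1) polys_single[OF keys_r, of "- c"] unfolding free_submodule_def by blast
        then show ?thesis using M 2(2) unfolding w_def free_submodule_def by blast
      qed
      have veq: "v = single r c \<cdot>\<^sub>v b + w"
        unfolding w_def using dims
        by (intro eq_vecI) (auto simp: algebra_simps single_uminus)
      have "w \<in> gen_span V n B"
      proof (cases "w = 0\<^sub>v n")
        case True then show ?thesis by (simp add: gen_span.zero)
      next
        case w0: False
        have "key (j, l) < lead v" if jl: "(j, l) \<in> supp w" for j l
        proof -
          have jn: "j < n" using jl by (simp add: supp_def)
          have wj: "w $ j = v $ j + single r (- c) * b $ j"
            using jn dims by (simp add: w_def)
          have "l \<in> keys (v $ j) \<or> l \<in> keys (single r (- c) * b $ j)"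
            using jl keys_add[of "v $ j" "single r (- c) * b $ j"] by (auto simp: supp_def wj)
          then have "key (j, l) \<le> lead v"
          proof
            assume "l \<in> keys (v $ j)"
            then show ?thesis using lead_ge[of "(j, l)" v] jn by (simp add: supp_def)
          next
            assume "l \<in> keys (single r (- c) * b $ j)"
            then obtain l' where l': "l = r + l'" "l' \<in> keys (b $ j)"
              using keys_mult[of "single r (- c)" "b $ j"] by (auto split: if_splits)
            then have "key (j, l') \<le> key (k, m')"
              using lead_ge[of "(j, l')" b] jn km'(2) by (simp add: supp_def)
            then have "enc r + (pos j + enc l') \<le> enc r + (pos k + enc m')"
              by (simp only: key_def prod.case add_left_mono)
            then show ?thesis
              by (simp add: km(2) m l'(1) key_def enc_add ac_simps)
          qed
          moreover have "key (j, l) \<noteq> lead v"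
          proof
            assume "key (j, l) = lead v"
            then have [simp]: "j = k" "l = m"
              using inj_key[of j l k m] km keys_supp[OF wM jl] keys_supp[OF 2(2) km(1)] by auto
            have "lookup (single r (- c) * b $ k) m = - c * lookup (b $ k) m'"
              by (simp add: m lookup_single_mult)
            then have "lookup (w $ k) m = 0"
              using b0 wj by (simp add: lookup_add c_def)
            then show False using jl by (auto simp: supp_def)
          qed
          ultimately show ?thesis by simp
        qed
        then have "lead w < lead v" using lead_in[OF wM w0] by auto
        then show ?thesis using 2(1)[of w] wM keys_lead[OF wM w0] keys_lead[OF 2(2) False] by auto
      qed
      then show ?thesis
        using veq gen_span.add[OF b(1) polys_single[OF keys_r, of c]] by metis
    qed
  qed
  moreover have "gen_span V n B \<subseteq> M" using gen_span_subset[OF M] B(1) by blast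
  ultimately show ?thesis using B(1,2) by blast
qed

section \<open>Graded matrices and minimal generators\<close>

definition poly_mat :: "'v set \<Rightarrow> nat \<Rightarrow> nat \<Rightarrow> ('v, 'k::field) mpoly mat set" where
  "poly_mat V n m = {A \<in> carrier_mat n m. \<forall>i<n. \<forall>j<m. A $$ (i, j) \<in> polys V}"

lemma poly_mat_carrier: "A \<in> poly_mat V n m \<Longrightarrow> A \<in> carrier_mat n m"
  by (simp add: poly_mat_def)

lemma poly_matD: "A \<in> poly_mat V n m \<Longrightarrow> i < n \<Longrightarrow> j < m \<Longrightarrow> A $$ (i, j) \<in> polys V"
  by (simp add: poly_mat_def)

lemma mult_mat_vec_index:
  "A \<in> carrier_mat n m \<Longrightarrow> v \<in> carrier_vec m \<Longrightarrow> i < n \<Longrightarrow>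
    (A *\<^sub>v v) $ i = (\<Sum>j<m. A $$ (i, j) * v $ j)"
  by (auto simp: scalar_prod_def lessThan_atLeast0 intro!: sum.cong)

lemma mult_mat_index:
  "A \<in> carrier_mat n m \<Longrightarrow> B \<in> carrier_mat m r \<Longrightarrow> i < n \<Longrightarrow> k < r \<Longrightarrow>
    (A * B) $$ (i, k) = (\<Sum>j<m. A $$ (i, j) * B $$ (j, k))"
  by (auto simp: scalar_prod_def lessThan_atLeast0 intro!: sum.cong)

lemma mult_mat_vec_free [simp]:
  "A \<in> poly_mat V n m \<Longrightarrow> v \<in> free_module V m \<Longrightarrow> A *\<^sub>v v \<in> free_module V n"
  by (auto simp: free_module_iff poly_mat_def mult_mat_vec_index simp del: index_mult_mat_vec intro!: polys_sum)

lemma poly_mat_mult [simp]: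
  "A \<in> poly_mat V n m \<Longrightarrow> B \<in> poly_mat V m r \<Longrightarrow> A * B \<in> poly_mat V n r"
  by (auto simp: poly_mat_def mult_mat_index simp del: index_mult_mat intro!: polys_sum)

lemma poly_mat_closed [simp]:
  "A \<in> poly_mat V n m \<Longrightarrow> B \<in> poly_mat V n m \<Longrightarrow> A + B \<in> poly_mat V n m"
  "A \<in> poly_mat V n m \<Longrightarrow> B \<in> poly_mat V n m \<Longrightarrow> A - B \<in> poly_mat V n m"
  "1\<^sub>m n \<in> poly_mat V n n"
  by (auto simp: poly_mat_def)

lemma col_free [simp]: "A \<in> poly_mat V n m \<Longrightarrow> j < m \<Longrightarrow> col A j \<in> free_module V n"
  by (auto simp: free_module_iff poly_mat_def)

lemma mat_mult_unit_vec:
  fixes A :: "'a::semiring_1 mat"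
  assumes "A \<in> carrier_mat n m" "j < m"
  shows "A *\<^sub>v unit_vec m j = col A j"
  using assms by (intro eq_vecI) auto

text \<open>The degree-0 maps from the sum of the \<open>S(-t ! l)\<close> to the sum of the
  \<open>S(-s ! k)\<close>: the generator \<open>l\<close> sits in degree \<open>t ! l\<close> and
  the generator \<open>k\<close> in degree \<open>s ! k\<close>, so the entry must make up the
  difference.\<close>

definition gr_mat :: "'v set \<Rightarrow> int list \<Rightarrow> int list \<Rightarrow> ('v, 'k::field) mpoly mat set" where
  "gr_mat V s t = {A \<in> poly_mat V (length s) (length t).
     \<forall>k<length s. \<forall>l<length t. homogeneous (t ! l - s ! k) (A $$ (k, l))}"

lemma gr_mat_poly_mat: "A \<in> gr_mat V s t \<Longrightarrow> A \<in> poly_mat V (length s) (length t)"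
  by (simp add: gr_mat_def)

lemma gr_mat_carrier: "A \<in> gr_mat V s t \<Longrightarrow> A \<in> carrier_mat (length s) (length t)"
  by (simp add: gr_mat_def poly_mat_def)

lemma gr_mat_mult: "A \<in> gr_mat V s t \<Longrightarrow> B \<in> gr_mat V t r \<Longrightarrow> A * B \<in> gr_mat V s r"
proof -
  assume A: "A \<in> gr_mat V s t" and B: "B \<in> gr_mat V t r"
  have "homogeneous (r ! l - s ! k) ((A * B) $$ (k, l))" if "k < length s" "l < length r" for k l
  proof -
    have "homogeneous (r ! l - s ! k) (A $$ (k, j) * B $$ (j, l))" if "j < length t" for j
      using homogeneous_mult[of "t ! j - s ! k" "A $$ (k, j)" "r ! l - t ! j" "B $$ (j, l)"] A B that
        \<open>k < length s\<close> \<open>l < length r\<close> by (auto simp: gr_mat_def)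
    then show ?thesis
      using mult_mat_index[OF gr_mat_carrier[OF A] gr_mat_carrier[OF B] that]
      by (auto intro!: homogeneous_sum)
  qed
  then show ?thesis using A B poly_mat_mult[of A V _ _ B] by (auto simp: gr_mat_def)
qed

text \<open>The component of degree \<open>n\<close> in the sum of the \<open>S(-t ! k)\<close>. A
  coefficient of the generator \<open>k\<close> counts \<open>t ! k\<close> more than its own
  degree; negative differences give 0.\<close>

definition vcomp :: "int list \<Rightarrow> int \<Rightarrow> ('v, 'k::field) mpoly vec \<Rightarrow> ('v, 'k) mpoly vec" where
  "vcomp t n v = vec (length t) (\<lambda>k. hcomp (n - t ! k) (v $ k))"

definition vhom :: "int list \<Rightarrow> int \<Rightarrow> ('v, 'k::field) mpoly vec \<Rightarrow> bool" where
  "vhom t n v \<longleftrightarrow> (\<forall>k<length t. homogeneous (n - t ! k) (v $ k))"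

lemma vcomp_free [simp]: "v \<in> gr_free V t \<Longrightarrow> vcomp t n v \<in> gr_free V t"
  by (auto simp: vcomp_def free_module_iff)

lemma vhom_vcomp [simp]: "vhom t n (vcomp t n v)"
  by (simp add: vhom_def vcomp_def)

lemma vcomp_vhom: "v \<in> carrier_vec (length t) \<Longrightarrow> vhom t n v \<Longrightarrow> vcomp t n v = v"
  by (intro eq_vecI) (auto simp: vhom_def vcomp_def hcomp_homogeneous)

lemma vhom_col: "A \<in> gr_mat V s t \<Longrightarrow> l < length t \<Longrightarrow> vhom s (t ! l) (col A l)"
  using gr_mat_carrier[of A V s t] by (auto simp: vhom_def gr_mat_def)

lemma vcomp_mult:
  assumes A: "A \<in> gr_mat V s t" and v: "v \<in> carrier_vec (length t)"
  shows "vcomp s n (A *\<^sub>v v) = A *\<^sub>v vcomp t n v"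
proof (rule eq_vecI)
  have v': "vcomp t n v \<in> carrier_vec (length t)" by (simp add: vcomp_def)
  fix i assume "i < dim_vec (A *\<^sub>v vcomp t n v)"
  then have i: "i < length s" using gr_mat_carrier[OF A] by simp
  have "hcomp (n - s ! i) (A $$ (i, j) * v $ j) = A $$ (i, j) * hcomp (n - t ! j) (v $ j)" if "j < length t" for j
    using hcomp_mult[of "t ! j - s ! i" "A $$ (i, j)" "n - t ! j" "v $ j"] A i that by (auto simp: gr_mat_def)
  then show "vcomp s n (A *\<^sub>v v) $ i = (A *\<^sub>v vcomp t n v) $ i"
    using i mult_mat_vec_index[OF gr_mat_carrier[OF A] v i] mult_mat_vec_index[OF gr_mat_carrier[OF A] v' i]
    by (simp add: vcomp_def hcomp_sum del: index_mult_mat_vec)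
qed (use gr_mat_carrier[OF A] in \<open>simp add: vcomp_def\<close>)

lemma vcomp_support:
  "\<exists>N. finite N \<and> (\<forall>n. n \<notin> N \<longrightarrow> vcomp t n v = gr_zero t)"
proof -
  define N where "N = (\<Union>k<length t. (\<lambda>m. int (mdeg m) + t ! k) ` keys (v $ k))"
  have "finite N" by (auto simp: N_def)
  moreover have "vcomp t n v = gr_zero t" if "n \<notin> N" for n
  proof (rule eq_vecI)
    fix k assume "k < dim_vec (gr_zero t :: ('a, 'b) mpoly vec)"
    then have "k < length t" by simp
    have "int (mdeg m) \<noteq> n - t ! k" if "m \<in> keys (v $ k)" for m
    proof -
      have "int (mdeg m) + t ! k \<in> N" using that \<open>k < length t\<close> unfolding N_def by blast
      then show ?thesis using \<open>n \<notin> N\<close> by auto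
    qed
    then have "hcomp (n - t ! k) (v $ k) = 0"
      by (intro poly_mapping_eqI) (auto simp: lookup_hcomp in_keys_iff)
    then show "vcomp t n v $ k = gr_zero t $ k" using \<open>k < length t\<close> by (simp add: vcomp_def)
  qed (simp add: vcomp_def)
  ultimately show ?thesis by blast
qed

lemma submodule_vcompI:
  assumes M: "free_submodule V (length t) M" and v: "v \<in> carrier_vec (length t)"
    and "\<And>n. vcomp t n v \<in> M"
  shows "v \<in> M"
proof -
  \<comment> \<open>All degrees in which some entry of \<open>v\<close> has a term; summing the
    components over \<open>N\<close> restores \<open>v\<close>.\<close>
  define N where "N = (\<Union>k<length t. (\<lambda>m. int (mdeg m) + t ! k) ` keys (v $ k))"
  have fin: "finite N" by (auto simp: N_def)
  have *: "vec (length t) (\<lambda>k. \<Sum>n\<in>A. hcomp (n - t ! k) (v $ k)) \<in> M" if "finite A" for A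
    using that
  proof induction
    case empty
    have "vec (length t) (\<lambda>k. \<Sum>n\<in>{}. hcomp (n - t ! k) (v $ k)) = gr_zero t" by auto
    then show ?case using M by (simp add: free_submodule_def)
  next
    case (insert n A)
    have "vec (length t) (\<lambda>k. \<Sum>n\<in>insert n A. hcomp (n - t ! k) (v $ k)) =
        vcomp t n v + vec (length t) (\<lambda>k. \<Sum>n\<in>A. hcomp (n - t ! k) (v $ k))"
      using insert by (auto simp: vcomp_def)
    then show ?case using M insert assms(3) by (simp add: free_submodule_def)
  qed
  have "(\<Sum>n\<in>N. hcomp (n - t ! k) (v $ k)) = v $ k" if "k < length t" for k
  proof (rule poly_mapping_eqI)
    fix m
    have "lookup (\<Sum>n\<in>N. hcomp (n - t ! k) (v $ k)) m =
        (\<Sum>n\<in>N. if n = int (mdeg m) + t ! k then lookup (v $ k) m else 0)"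
      by (auto simp: lookup_sum lookup_hcomp intro!: sum.cong)
    also have "\<dots> = lookup (v $ k) m"
    proof (cases "m \<in> keys (v $ k)")
      case True
      then have "int (mdeg m) + t ! k \<in> N" using that unfolding N_def by blast
      then show ?thesis using fin by simp
    qed (auto simp: in_keys_iff intro!: sum.neutral)
    finally show "lookup (\<Sum>n\<in>N. hcomp (n - t ! k) (v $ k)) m = lookup (v $ k) m" .
  qed
  then have "vec (length t) (\<lambda>k. \<Sum>n\<in>N. hcomp (n - t ! k) (v $ k)) = v"
    using v by (intro eq_vecI) auto
  then show ?thesis using *[OF fin] by simp
qed

lemma mult_mat_smult_vec:
  fixes A :: "'a::comm_ring_1 mat"
  assumes "A \<in> carrier_mat n m" "v \<in> carrier_vec m"
  shows "A *\<^sub>v (c \<cdot>\<^sub>v v) = c \<cdot>\<^sub>v (A *\<^sub>v v)"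
  using assms by (intro eq_vecI) auto

lemma submodule_image:
  fixes A :: "('v, 'k::field) mpoly mat"
  assumes A: "A \<in> poly_mat V n m"
  shows "free_submodule V n ((*\<^sub>v) A ` free_module V m)"
proof -
  have c: "v \<in> carrier_vec m" if "v \<in> free_module V m" for v :: "('v, 'k) mpoly vec"
    using that by (simp add: free_module_iff)
  have cA: "A \<in> carrier_mat n m" using A by (rule poly_mat_carrier)
  show ?thesis
    unfolding free_submodule_def
  proof (intro conjI ballI)
    show "0\<^sub>v n \<in> (*\<^sub>v) A ` free_module V m"
      using cA by (intro image_eqI[of _ _ "0\<^sub>v m"]) auto
  next
    fix x y assume "x \<in> (*\<^sub>v) A ` free_module V m" "y \<in> (*\<^sub>v) A ` free_module V m"
    then obtain v w where "x = A *\<^sub>v v" "y = A *\<^sub>v w" "v \<in> free_module V m" "w \<in> free_module V m" by auto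
    then show "x + y \<in> (*\<^sub>v) A ` free_module V m"
      using mult_add_distrib_mat_vec[OF cA c c] by (intro image_eqI[of _ _ "v + w"]) auto
  next
    fix x and a :: "('v, 'k) mpoly" assume "x \<in> (*\<^sub>v) A ` free_module V m" "a \<in> polys V"
    then obtain v where "x = A *\<^sub>v v" "v \<in> free_module V m" by auto
    then show "a \<cdot>\<^sub>v x \<in> (*\<^sub>v) A ` free_module V m"
      using mult_mat_smult_vec[OF cA c] \<open>a \<in> polys V\<close> by (intro image_eqI[of _ _ "a \<cdot>\<^sub>v v"]) auto
  qed (use A in auto)
qed

lemma submodule_gen_span:
  assumes B: "B \<subseteq> free_module V n"
  shows "free_submodule V n (gen_span V n B)"
proof -
  have sub: "gen_span V n B \<subseteq> free_module V n"
  proof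
    fix v assume "v \<in> gen_span V n B" then show "v \<in> free_module V n"
    proof induction
      case (add b c v)
      then have "b \<in> free_module V n" using B by blast
      then show ?case using add by simp
    qed simp
  qed
  have c: "v \<in> carrier_vec n" if "v \<in> gen_span V n B" for v
    using that sub by (auto simp: free_module_iff)
  have cB: "b \<in> carrier_vec n" if "b \<in> B" for b
    using that B by (auto simp: free_module_iff)
  have add: "v + w \<in> gen_span V n B" if "v \<in> gen_span V n B" "w \<in> gen_span V n B" for v w
    using that
  proof induction
    case zero then show ?case using c by simp
  next
    case (add b a v)
    have "a \<cdot>\<^sub>v b + v + w = a \<cdot>\<^sub>v b + (v + w)"
      using cB[OF add(1)] c[OF add(3)] c[OF add.prems] by (intro assoc_add_vec) auto
    then show ?case using add gen_span.add by metis
  qed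
  have "a \<cdot>\<^sub>v v \<in> gen_span V n B" if "v \<in> gen_span V n B" "a \<in> polys V" for a v
    using that
  proof induction
    case zero
    have "a \<cdot>\<^sub>v 0\<^sub>v n = 0\<^sub>v n" by auto
    then show ?case by (simp add: gen_span.zero)
  next
    case (add b d v)
    have "a \<cdot>\<^sub>v (d \<cdot>\<^sub>v b + v) = (a * d) \<cdot>\<^sub>v b + a \<cdot>\<^sub>v v"
      using cB[OF add(1)] c[OF add(3)] by (simp add: smult_add_distrib_vec[of _ n] smult_smult_assoc)
    then show ?case using add gen_span.add[of b B "a * d"] by simp
  qed
  then show ?thesis using sub add by (auto simp: free_submodule_def gen_span.zero)
qed

lemma gen_span_base: "b \<in> B \<Longrightarrow> b \<in> carrier_vec n \<Longrightarrow> b \<in> gen_span V n B"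
  using gen_span.add[of b B 1 V "0\<^sub>v n" n] gen_span.zero[of n V B] by simp

text \<open>Only columns with a nonzero coefficient have to lie in \<open>B\<close>. This is how a
  syzygy with an invertible entry expresses one generator through the others.\<close>

lemma mult_mem_gen_span:
  assumes A: "A \<in> carrier_mat n m" and w: "w \<in> free_module V m"
    and B: "B \<subseteq> free_module V n" "\<And>l. l < m \<Longrightarrow> w $ l \<noteq> 0 \<Longrightarrow> col A l \<in> B"
  shows "A *\<^sub>v w \<in> gen_span V n B"
proof -
  have "vec n (\<lambda>i. \<Sum>l<j. A $$ (i, l) * w $ l) \<in> gen_span V n B" if "j \<le> m" for j
    using that
  proof (induction j)
    case 0
    have "vec n (\<lambda>i. \<Sum>l<0. A $$ (i, l) * w $ l) = 0\<^sub>v n" by auto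
    then show ?case by (simp add: gen_span.zero)
  next
    case (Suc j)
    show ?case
    proof (cases "w $ j = 0")
      case False
      have "vec n (\<lambda>i. \<Sum>l<Suc j. A $$ (i, l) * w $ l) = w $ j \<cdot>\<^sub>v col A j + vec n (\<lambda>i. \<Sum>l<j. A $$ (i, l) * w $ l)"
        using A Suc.prems by (auto simp: algebra_simps)
      then show ?thesis
        using gen_span.add[of "col A j" B "w $ j" V] Suc B(2)[OF _ False] w by (simp add: free_module_iff)
    qed (use Suc in simp)
  qed
  from this[of m] have "vec n (\<lambda>i. \<Sum>l<m. A $$ (i, l) * w $ l) \<in> gen_span V n B" by simp
  moreover have "A *\<^sub>v w = vec n (\<lambda>i. \<Sum>l<m. A $$ (i, l) * w $ l)"
    using A w by (intro eq_vecI) (auto simp: mult_mat_vec_index free_module_iff simp del: index_mult_mat_vec)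
  ultimately show ?thesis by simp
qed

definition gr_submodule :: "'v set \<Rightarrow> int list \<Rightarrow> ('v, 'k::field) mpoly vec set \<Rightarrow> bool" where
  "gr_submodule V s M \<longleftrightarrow> free_submodule V (length s) M \<and> (\<forall>v\<in>M. \<forall>n. vcomp s n v \<in> M)"

text \<open>A homogeneous generating set of least cardinality is minimal: a syzygy with a nonzero constant
  entry would make one of the generators superfluous.\<close>

theorem minimal_generators:
  fixes M :: "('v, 'k::field) mpoly vec set"
  assumes fin: "finite V" and M: "gr_submodule V s M"
  shows "\<exists>t A. A \<in> gr_mat V s t \<and> (*\<^sub>v) A ` gr_free V t = M \<and>
    (\<forall>v\<in>gr_free V t. A *\<^sub>v v = gr_zero s \<longrightarrow> (\<forall>k<length t. lookup (v $ k) 0 = 0))"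
proof -
  let ?n = "length s"
  define P where "P B \<longleftrightarrow> finite B \<and> B \<subseteq> M \<and> gen_span V ?n B = M \<and> (\<forall>b\<in>B. \<exists>n. vhom s n b)" for B
  have subM: "free_submodule V ?n M" and Mfree: "M \<subseteq> free_module V ?n"
    using M by (auto simp: gr_submodule_def free_submodule_def)
  have Mc: "v \<in> carrier_vec ?n" if "v \<in> M" for v
    using that Mfree by (auto simp: free_module_iff)
  obtain B0 where B0: "B0 \<subseteq> M" "finite B0" "gen_span V ?n B0 = M"
    using finitely_generated_submodule[OF fin subM] by blast
  obtain N :: "('v, 'k) mpoly vec \<Rightarrow> int set" where N: "\<And>b. finite (N b)" "\<And>b n. n \<notin> N b \<Longrightarrow> vcomp s n b = 0\<^sub>v ?n"
    using vcomp_support[of s] by metis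
  \<comment> \<open>The finitely many components of the generators in \<open>B0\<close>; they stay
    in \<open>M\<close> because \<open>M\<close> is graded.\<close>
  define B1 where "B1 = (\<Union>b\<in>B0. (\<lambda>n. vcomp s n b) ` N b)"
  have B1M: "B1 \<subseteq> M" using B0(1) M by (auto simp: B1_def gr_submodule_def)
  have B1s: "free_submodule V ?n (gen_span V ?n B1)"
    using B1M Mfree by (intro submodule_gen_span) auto
  have "b \<in> gen_span V ?n B1" if b: "b \<in> B0" for b
  proof (rule submodule_vcompI[OF B1s])
    show "b \<in> carrier_vec ?n" using b B0(1) Mc by auto
    fix n show "vcomp s n b \<in> gen_span V ?n B1"
    proof (cases "n \<in> N b")
      case True
      then show ?thesis using b B1M Mc by (intro gen_span_base) (auto simp: B1_def)
    qed (simp add: N gen_span.zero)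
  qed
  then have "gen_span V ?n B0 \<subseteq> gen_span V ?n B1" by (intro gen_span_subset[OF B1s]) auto
  then have "P B1"
  proof -
    have "finite B1" using B0(2) N(1) by (simp add: B1_def)
    moreover have "\<exists>n. vhom s n b" if "b \<in> B1" for b using that vhom_vcomp unfolding B1_def by blast
    ultimately show ?thesis
      using \<open>gen_span V ?n B0 \<subseteq> gen_span V ?n B1\<close> B0(3) B1M gen_span_subset[OF subM B1M]
      unfolding P_def by blast
  qed
  then obtain B where B: "P B" and B_min: "\<And>B'. P B' \<Longrightarrow> card B \<le> card B'"
    using ex_has_least_nat[of P B1 card] by blast
  have BM: "B \<subseteq> M" and Bfin: "finite B" using B by (auto simp: P_def)
  have Bfree: "B \<subseteq> free_module V ?n" using BM Mfree by auto
  obtain dg where dg: "\<And>b. b \<in> B \<Longrightarrow> vhom s (dg b) b" using B unfolding P_def by metis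
  obtain bs where bs: "set bs = B" "distinct bs" using finite_distinct_list[OF Bfin] by blast
  define t where "t = map dg bs"
  define A where "A = mat_of_cols ?n bs"
  have len: "length t = length bs" by (simp add: t_def)
  have cA: "A \<in> carrier_mat ?n (length t)" by (simp add: A_def t_def mat_of_cols_carrier)
  have bsB: "bs ! l \<in> B" if "l < length t" for l using that bs(1) by (auto simp: len)
  have bsf: "bs ! l \<in> free_module V ?n" if "l < length t" for l using bsB[OF that] Bfree by auto
  have bsc: "bs ! l \<in> carrier_vec ?n" if "l < length t" for l using bsf[OF that] by (rule free_moduleD)
  have colA: "col A l = bs ! l" if "l < length t" for l
    unfolding A_def using that bsc by (intro col_mat_of_cols) (auto simp: len)
  have Aidx: "A $$ (k, l) = (bs ! l) $ k" if "k < ?n" "l < length t" for k l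
    using colA[OF that(2)] cA that by (metis carrier_matD index_col)
  have gA: "A \<in> gr_mat V s t"
  proof -
    have "vhom s (t ! l) (bs ! l)" if "l < length t" for l
      using dg[OF bsB[OF that]] that by (simp add: t_def)
    then show ?thesis
      using cA free_moduleD(3)[OF bsf] by (simp add: gr_mat_def poly_mat_def Aidx vhom_def)
  qed
  have pA: "A \<in> poly_mat V ?n (length t)" using gA by (rule gr_mat_poly_mat)
  have "(*\<^sub>v) A ` gr_free V t \<subseteq> gen_span V ?n B"
    using bsB colA by (auto intro!: mult_mem_gen_span[OF cA _ Bfree])
  moreover have "gen_span V ?n B \<subseteq> (*\<^sub>v) A ` gr_free V t"
  proof (rule gen_span_subset[OF submodule_image[OF pA]], rule)
    fix b assume "b \<in> B"
    then obtain l where "l < length t" "b = bs ! l" using bs by (metis in_set_conv_nth len)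
    then show "b \<in> (*\<^sub>v) A ` gr_free V t"
      using mat_mult_unit_vec[OF cA] colA by (intro image_eqI[of _ _ "unit_vec (length t) l"]) auto
  qed
  ultimately have img: "(*\<^sub>v) A ` gr_free V t = M" using B by (auto simp: P_def)
  have "lookup (v $ k) 0 = 0"
    if v: "v \<in> gr_free V t" "A *\<^sub>v v = 0\<^sub>v ?n" and k: "k < length t" for v k
  proof (rule ccontr)
    define c where "c = lookup (v $ k) 0"
    assume "lookup (v $ k) 0 \<noteq> 0"
    then have c: "c \<noteq> 0" by (simp add: c_def)
    \<comment> \<open>The component of degree \<open>t ! k\<close> is again a syzygy, and its entry
      \<open>k\<close>, having degree 0, is exactly the constant \<open>c\<close>.\<close>
    define v' where "v' = vcomp t (t ! k) v"
    have v'f: "v' \<in> gr_free V t" using v(1) by (simp add: v'_def)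
    have "A *\<^sub>v v' = vcomp s (t ! k) (A *\<^sub>v v)"
      using vcomp_mult[OF gA] v(1) by (simp add: v'_def free_module_iff)
    also have "\<dots> = 0\<^sub>v ?n" unfolding v(2) by (auto simp: vcomp_def hcomp_def)
    finally have ker: "A *\<^sub>v v' = 0\<^sub>v ?n" .
    have v'k: "v' $ k = single 0 c"
      using k by (intro poly_mapping_eqI) (auto simp: v'_def vcomp_def lookup_hcomp c_def lookup_single when_def)
    have bkc: "bs ! k \<in> carrier_vec ?n" using bsc[OF k] .
    let ?u = "single 0 c \<cdot>\<^sub>v unit_vec (length t) k :: ('v, 'k) mpoly vec"
    \<comment> \<open>With the entry \<open>k\<close> deleted, the syzygy writes minus
      \<open>c\<close> times the generator \<open>bs ! k\<close> as a combination of the other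
      generators.\<close>
    define w where "w = v' - ?u"
    have uf: "?u \<in> gr_free V t" by (simp add: polys_single)
    have wf: "w \<in> gr_free V t" using v'f uf by (simp add: w_def)
    have "A *\<^sub>v w = A *\<^sub>v v' - A *\<^sub>v ?u"
      unfolding w_def using v'f uf by (intro mult_minus_distrib_mat_vec[OF cA]) (auto simp: free_module_iff)
    also have "A *\<^sub>v ?u = single 0 c \<cdot>\<^sub>v bs ! k"
      using mult_mat_smult_vec[OF cA] mat_mult_unit_vec[OF cA k] colA[OF k] by simp
    finally have Aw: "A *\<^sub>v w = - (single 0 c \<cdot>\<^sub>v bs ! k)"
      using ker bkc by (intro eq_vecI) auto
    let ?B' = "B - {bs ! k}"
    have B'f: "?B' \<subseteq> free_module V ?n" using Bfree by auto
    have "col A l \<in> ?B'" if "l < length t" "w $ l \<noteq> 0" for l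
    proof -
      have "w $ k = 0" using k v'f v'k by (simp add: w_def free_module_iff)
      then have "l \<noteq> k" using that by auto
      then show ?thesis using that k bs by (auto simp: colA len nth_eq_iff_index_eq)
    qed
    then have "A *\<^sub>v w \<in> gen_span V ?n ?B'" by (intro mult_mem_gen_span[OF cA wf B'f])
    then have "single 0 (- 1 / c) \<cdot>\<^sub>v (A *\<^sub>v w) \<in> gen_span V ?n ?B'"
      using submodule_gen_span[OF B'f] by (simp add: free_submodule_def polys_single)
    moreover have "single 0 (- 1 / c) \<cdot>\<^sub>v (A *\<^sub>v w) = bs ! k"
    proof -
      have "single 0 (- 1 / c) * - (single 0 c * x) = x" for x :: "('v, 'k) mpoly"
      proof -
        have "single 0 (- 1 / c) * - (single 0 c * x) = (single 0 (- 1 / c) * - single 0 c) * x"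
          by (simp add: mult.assoc)
        also have "single 0 (- 1 / c) * - single 0 c = (1 :: ('v, 'k) mpoly)"
          using c by (simp add: mult_single flip: single_uminus)
        finally show ?thesis by simp
      qed
      then show ?thesis unfolding Aw using bkc by (intro eq_vecI) auto
    qed
    ultimately have bk: "bs ! k \<in> gen_span V ?n ?B'" by simp
    have "B \<subseteq> gen_span V ?n ?B'"
    proof
      fix b assume "b \<in> B"
      then show "b \<in> gen_span V ?n ?B'"
        using bk BM Mc by (cases "b = bs ! k") (auto intro: gen_span_base)
    qed
    then have "gen_span V ?n B \<subseteq> gen_span V ?n ?B'" by (intro gen_span_subset submodule_gen_span[OF B'f])
    then have "P ?B'"
      using B gen_span_subset[OF subM, of ?B'] by (auto simp: P_def)
    then have "card B \<le> card ?B'" by (rule B_min)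
    moreover have "bs ! k \<in> B" using bsB[OF k] .
    ultimately show False using Bfin by (metis card_Diff1_less not_less)
  qed
  then show ?thesis using gA img by blast
qed

section \<open>Existence of minimal graded free resolutions\<close>

text \<open>The matrix is zero modulo the variables; by \<open>irrelevant_ideal_iff\<close> this is
  the minimality condition on a differential.\<close>

definition const_zero :: "('v, 'k::field) mpoly mat \<Rightarrow> bool" where
  "const_zero A \<longleftrightarrow> (\<forall>k<dim_row A. \<forall>l<dim_col A. lookup (A $$ (k, l)) 0 = 0)"

lemma const_zero_mult:
  assumes "A \<in> carrier_mat n m" "B \<in> carrier_mat m r" "const_zero A \<or> const_zero B"
  shows "const_zero (A * B)"
  unfolding const_zero_def
proof (intro allI impI)
  fix k l assume kl: "k < dim_row (A * B)" "l < dim_col (A * B)"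
  then have "lookup (A $$ (k, j) * B $$ (j, l)) 0 = 0" if "j < m" for j
    using assms that by (auto simp: const_zero_def lookup_mult_0)
  then show "lookup ((A * B) $$ (k, l)) 0 = 0"
    using mult_mat_index[OF assms(1,2), of k l] kl assms(1,2)
    by (auto simp: lookup_sum simp del: index_mult_mat(1))
qed

lemma const_zero_add:
  "A \<in> carrier_mat n m \<Longrightarrow> B \<in> carrier_mat n m \<Longrightarrow> const_zero A \<Longrightarrow> const_zero B \<Longrightarrow> const_zero (A + B)"
  by (auto simp: const_zero_def lookup_add)

text \<open>Lets two adjacent conjuncts be rewritten jointly in front of an arbitrary rest, as
  \<open>gr_mat_const_zero_iff\<close> describes only their combination.\<close>

lemma conj_cong_pair: "(P \<and> Q \<longleftrightarrow> P' \<and> Q') \<Longrightarrow> (P \<and> Q \<and> R \<longleftrightarrow> P' \<and> Q' \<and> R)"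
  by blast

lemma gr_mat_const_zero_iff:
  "(A \<in> carrier_mat (length p) (length q) \<and> (\<forall>k<length p. \<forall>l<length q.
      A $$ (k, l) \<in> polys V \<and> homogeneous (q ! l - p ! k) (A $$ (k, l)) \<and>
      A $$ (k, l) \<in> Idl\<^bsub>poly_ring V\<^esub> (Var ` V))) \<longleftrightarrow> A \<in> gr_mat V p q \<and> const_zero A"
proof (cases "A \<in> carrier_mat (length p) (length q)")
  case True
  then have "dim_row A = length p" "dim_col A = length q" by auto
  then show ?thesis
    using True by (auto simp: irrelevant_ideal_iff gr_mat_def poly_mat_def const_zero_def)
qed (auto dest: gr_mat_carrier)

lemma min_graded_free_resolution_iff:
  "min_graded_free_resolution V I a s D \<longleftrightarrow>
    a \<in> gr_free V (s 0) \<and>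
    (\<forall>k<length (s 0). homogeneous (s 0 ! k) (a $ k)) \<and>
    (\<forall>i. D i \<in> gr_mat V (s i) (s (Suc i))) \<and> (\<forall>i. const_zero (D i)) \<and>
    (\<forall>f\<in>polys V. \<exists>v\<in>gr_free V (s 0). f - a \<bullet> v \<in> I) \<and>
    {v \<in> gr_free V (s 0). a \<bullet> v \<in> I} = (*\<^sub>v) (D 0) ` gr_free V (s 1) \<and>
    (\<forall>i. {v \<in> gr_free V (s (Suc i)). D i *\<^sub>v v = gr_zero (s i)} =
         (*\<^sub>v) (D (Suc i)) ` gr_free V (s (Suc (Suc i))))"
proof -
  have "(\<forall>i. D i \<in> carrier_mat (length (s i)) (length (s (Suc i)))) \<and>
       (\<forall>i. \<forall>k<length (s i). \<forall>l<length (s (Suc i)).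
          D i $$ (k, l) \<in> polys V \<and>
          homogeneous (s (Suc i) ! l - s i ! k) (D i $$ (k, l)) \<and>
          D i $$ (k, l) \<in> Idl\<^bsub>poly_ring V\<^esub> (Var ` V)) \<and> C \<longleftrightarrow>
      (\<forall>i. D i \<in> gr_mat V (s i) (s (Suc i))) \<and> (\<forall>i. const_zero (D i)) \<and> C" for C
    by (rule conj_cong_pair) (simp only: all_conj_distrib[symmetric] gr_mat_const_zero_iff)
  then show ?thesis
    unfolding min_graded_free_resolution_def Let_def One_nat_def by (simp only:)
qed

definition graded_ideal :: "'v set \<Rightarrow> ('v, 'k::field) mpoly set \<Rightarrow> bool" where
  "graded_ideal V I \<longleftrightarrow> I \<subseteq> polys V \<and> 0 \<in> I \<and> (\<forall>f\<in>I. \<forall>g\<in>I. f + g \<in> I) \<and>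
     (\<forall>f\<in>I. \<forall>c\<in>polys V. c * f \<in> I) \<and> (\<forall>f\<in>I. \<forall>n. hcomp n f \<in> I)"

lemma graded_idealD:
  assumes "graded_ideal V I"
  shows "I \<subseteq> polys V" "0 \<in> I" "f \<in> I \<Longrightarrow> g \<in> I \<Longrightarrow> f + g \<in> I"
    "f \<in> I \<Longrightarrow> c \<in> polys V \<Longrightarrow> c * f \<in> I" "f \<in> I \<Longrightarrow> hcomp n f \<in> I"
    "f \<in> I \<Longrightarrow> - f \<in> I" "f \<in> I \<Longrightarrow> g \<in> I \<Longrightarrow> f - g \<in> I"
    "(\<And>x. x \<in> A \<Longrightarrow> h x \<in> I) \<Longrightarrow> sum h A \<in> I"
proof -
  show 1: "I \<subseteq> polys V" "0 \<in> I" and add: "\<And>f g. f \<in> I \<Longrightarrow> g \<in> I \<Longrightarrow> f + g \<in> I"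
    and mult: "\<And>f c. f \<in> I \<Longrightarrow> c \<in> polys V \<Longrightarrow> c * f \<in> I" and "f \<in> I \<Longrightarrow> hcomp n f \<in> I"
    using assms by (auto simp: graded_ideal_def)
  show um: "- f \<in> I" if "f \<in> I" for f using mult[OF that, of "- 1"] by simp
  show "f - g \<in> I" if "f \<in> I" "g \<in> I" using add[OF that(1) um[OF that(2)]] by simp
  show "sum h A \<in> I" if "\<And>x. x \<in> A \<Longrightarrow> h x \<in> I"
    using that by (induction A rule: infinite_finite_induct) (auto intro: 1 add)
qed

lemma vcomp_0: "vcomp t n (gr_zero t) = gr_zero t"
  by (auto simp: vcomp_def hcomp_def)

lemma gr_submodule_kernel:
  assumes A: "A \<in> gr_mat V s t"
  shows "gr_submodule V t {v \<in> gr_free V t. A *\<^sub>v v = gr_zero s}"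
proof -
  note cA = gr_mat_carrier[OF A]
  have "A *\<^sub>v (v + w) = A *\<^sub>v v + A *\<^sub>v w" if "v \<in> gr_free V t" "w \<in> gr_free V t" for v w
    using that by (intro mult_add_distrib_mat_vec[OF cA]) (auto dest: free_moduleD)
  moreover have "A *\<^sub>v (c \<cdot>\<^sub>v v) = c \<cdot>\<^sub>v (A *\<^sub>v v)" if "v \<in> gr_free V t" for v c
    using that by (intro mult_mat_smult_vec[OF cA]) (auto dest: free_moduleD)
  moreover have "A *\<^sub>v vcomp t n v = gr_zero s"
    if "v \<in> gr_free V t" "A *\<^sub>v v = gr_zero s" for v n
    using vcomp_mult[OF A free_moduleD(1)[OF that(1)], of n] that(2)
    by (simp add: vcomp_0)
  moreover have "A *\<^sub>v gr_zero t = gr_zero s" using cA by auto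
  ultimately show ?thesis
    unfolding gr_submodule_def free_submodule_def by auto
qed

text \<open>The start is \<open>F 0 = S\<close> with augmentation 1; then minimal generators of
  \<open>I\<close>, and of each kernel in turn, are adjoined. The entries of \<open>D 0\<close> have
  no constant term because elements of \<open>I\<close> have none, those of the later differentials
  because their columns are syzygies of minimal generators.\<close>

theorem resolution_exists:
  fixes I :: "('v, 'k::field) mpoly set"
  assumes fin: "finite V" and I: "graded_ideal V I"
    and proper: "\<And>f. f \<in> I \<Longrightarrow> lookup f 0 = 0"
  shows "\<exists>a s D. min_graded_free_resolution V I a s D"
proof -
  note hI = graded_idealD[OF I]
  let ?good = "\<lambda>(s, t, A). A \<in> gr_mat V s t \<and>
    (\<forall>v\<in>gr_free V t. A *\<^sub>v v = gr_zero s \<longrightarrow> (\<forall>k<length t. lookup (v $ k) 0 = (0::'k)))"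
  \<comment> \<open>The ideal as a submodule of \<open>S\<close>, whose single generator has degree
    0.\<close>
  define M0 where "M0 = {v \<in> free_module V 1. v $ 0 \<in> I}"
  have "gr_submodule V [0] M0"
    unfolding gr_submodule_def free_submodule_def
    using hI by (auto simp: M0_def vcomp_def free_module_iff)
  from minimal_generators[OF fin this] obtain t0 A0 where A0: "?good ([0], t0, A0)"
    "(*\<^sub>v) (A0) ` gr_free V t0 = M0" by auto
  let ?step = "\<lambda>x y. fst y = fst (snd x) \<and>
      (*\<^sub>v) (snd (snd y)) ` gr_free V (fst (snd y)) =
      {v \<in> gr_free V (fst (snd x)). snd (snd x) *\<^sub>v v = gr_zero (fst x)}"
  \<comment> \<open>A state \<open>(s, t, A)\<close> is a map \<open>A\<close> from the free module
    with degrees \<open>t\<close> to that with degrees \<open>s\<close>; its successor covers the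
    kernel of \<open>A\<close>. The clause for \<open>n = 0\<close> fixes the start, so that the
    image of \<open>D 0\<close> is \<open>M0\<close>.\<close>
  have "\<exists>F. \<forall>n. (?good (F n) \<and> (n = 0 \<longrightarrow> F n = ([0], t0, A0))) \<and> ?step (F n) (F (Suc n))"
  proof (rule dependent_nat_choice)
    show "\<exists>x. ?good x \<and> (0 = (0::nat) \<longrightarrow> x = ([0], t0, A0))" using A0(1) by blast
    fix x and n :: nat assume x: "?good x \<and> (n = 0 \<longrightarrow> x = ([0], t0, A0))"
    obtain s t A where xe: "x = (s, t, A)" by (cases x)
    have "gr_submodule V t {v \<in> gr_free V t. A *\<^sub>v v = gr_zero s}"
      using x by (intro gr_submodule_kernel) (auto simp: xe)
    from minimal_generators[OF fin this] obtain t' A' where "?good (t, t', A')"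
      "(*\<^sub>v) A' ` free_module V (length t') = {v \<in> gr_free V t. A *\<^sub>v v = gr_zero s}"
      by auto
    then show "\<exists>y. (?good y \<and> (Suc n = 0 \<longrightarrow> y = ([0], t0, A0))) \<and> ?step x y"
      by (intro exI[of _ "(t, t', A')"]) (simp add: xe)
  qed
  then obtain F where F0: "\<forall>n. (?good (F n) \<and> (n = 0 \<longrightarrow> F n = ([0], t0, A0))) \<and> ?step (F n) (F (Suc n))" by (rule exE)
  have F1: "?good (F n)" for n using conjunct1[OF conjunct1[OF spec[OF F0, of n]]] .
  have F2: "F 0 = ([0], t0, A0)" using conjunct2[OF conjunct1[OF spec[OF F0, of 0]]] by simp
  have F3: "?step (F n) (F (Suc n))" for n using conjunct2[OF spec[OF F0, of n]] .
  define s where "s n = fst (F n)" for n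
  define D where "D n = snd (snd (F n))" for n
  have t: "fst (snd (F n)) = s (Suc n)" for n using F3[of n] by (simp add: s_def)
  have Fe: "F n = (s n, s (Suc n), D n)" for n using t[of n] by (simp add: s_def D_def prod_eq_iff)
  have s0: "s 0 = [0]" using F2 by (simp add: s_def)
  have D: "D n \<in> gr_mat V (s n) (s (Suc n))" for n using F1[of n] by (simp add: Fe)
  have ker: "lookup (v $ k) 0 = 0"
    if "v \<in> gr_free V (s (Suc n))" "D n *\<^sub>v v = gr_zero (s n)" "k < length (s (Suc n))" for n v k
    using F1[of n] that by (simp add: Fe)
  have exact: "(*\<^sub>v) (D (Suc n)) ` gr_free V (s (Suc (Suc n))) =
      {v \<in> gr_free V (s (Suc n)). D n *\<^sub>v v = gr_zero (s n)}" for n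
    using F3[of n] by (simp add: Fe)
  have img0: "(*\<^sub>v) (D 0) ` gr_free V (s 1) = M0"
    using A0(2) F2 Fe[of 0] by simp
  have colD: "col (D n) l \<in> (*\<^sub>v) (D n) ` gr_free V (s (Suc n))" if "l < length (s (Suc n))" for n l
    using mat_mult_unit_vec[OF gr_mat_carrier[OF D] that] by (intro image_eqI[of _ _ "unit_vec (length (s (Suc n))) l"]) auto
  have idx: "D n $$ (k, l) = col (D n) l $ k" if "k < length (s n)" "l < length (s (Suc n))" for n k l
    using gr_mat_carrier[OF D[of n]] that by simp
  have cz: "const_zero (D n)" for n
  proof -
    have "lookup (D n $$ (k, l)) 0 = 0" if kl: "k < length (s n)" "l < length (s (Suc n))" for k l
    proof (cases n)
      case 0
      then have "col (D 0) l \<in> M0" using colD[OF kl(2)] img0 by simp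
      then show ?thesis using proper idx[OF kl] kl(1) 0 s0 by (simp add: M0_def)
    next
      case (Suc m)
      then have "col (D n) l \<in> {v \<in> gr_free V (s (Suc m)). D m *\<^sub>v v = gr_zero (s m)}"
        using colD[OF kl(2)] exact[of m] by simp
      then show ?thesis using ker[of "col (D n) l" m k] idx[OF kl] kl(1) Suc by simp
    qed
    then show ?thesis using gr_mat_carrier[OF D[of n]] by (auto simp: const_zero_def)
  qed
  define a where "a = vec 1 (\<lambda>_. 1 :: ('v, 'k) mpoly)"
  have av: "a \<bullet> v = v $ 0" if "v \<in> free_module V 1" for v
    using free_moduleD(2)[OF that] by (simp add: a_def scalar_prod_def)
  have "min_graded_free_resolution V I a s D"
    unfolding min_graded_free_resolution_iff
  proof (intro conjI allI ballI)
    fix f :: "('v, 'k) mpoly" assume f: "f \<in> polys V"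
    then have "vec 1 (\<lambda>_. f) \<in> free_module V 1" by (auto simp: free_module_iff)
    then show "\<exists>v\<in>gr_free V (s 0). f - a \<bullet> v \<in> I"
      using av[of "vec 1 (\<lambda>_. f)"] hI(2) by (intro bexI[of _ "vec 1 (\<lambda>_. f)"]) (simp_all add: s0)
  next
    show "{v \<in> gr_free V (s 0). a \<bullet> v \<in> I} = (*\<^sub>v) (D 0) ` gr_free V (s 1)"
      unfolding img0 M0_def using av by (auto simp: s0)
  qed (use D cz exact in \<open>auto simp: s0 a_def free_module_iff\<close>)
  then show ?thesis by blast
qed

section \<open>Uniqueness of the Betti numbers\<close>

lemma gr_mat_idx: "A \<in> gr_mat V s t \<Longrightarrow> k < length s \<Longrightarrow> l < length t \<Longrightarrow>
    A $$ (k, l) \<in> polys V \<and> homogeneous (t ! l - s ! k) (A $$ (k, l))"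
  by (simp add: gr_mat_def poly_mat_def)

lemma mat_of_col_fun:
  fixes A :: "'a::comm_ring_1 mat"
  assumes A: "A \<in> carrier_mat n m" and B: "B \<in> carrier_mat n r"
    and w: "\<And>l. l < r \<Longrightarrow> w l \<in> carrier_vec m \<and> A *\<^sub>v w l = col B l"
  shows "A * mat m r (\<lambda>(k, l). w l $ k) = B"
proof (rule mat_col_eqI)
  let ?X = "mat m r (\<lambda>(k, l). w l $ k)"
  fix l assume "l < dim_col B"
  then have l: "l < r" using B by simp
  have "col ?X l = w l" using w[OF l] l by (intro eq_vecI) auto
  moreover have "col (A * ?X) l = A *\<^sub>v col ?X l" using A l by (intro col_mult2) auto
  ultimately show "col (A * ?X) l = col B l" using w[OF l] by simp
qed (use A B in auto)

lemma lift_mat: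
  assumes A: "A \<in> poly_mat V n m" and B: "B \<in> carrier_mat n r"
    and "\<And>l. l < r \<Longrightarrow> col B l \<in> (*\<^sub>v) A ` free_module V m"
  shows "\<exists>X\<in>poly_mat V m r. A * X = B"
proof -
  have "\<forall>l. \<exists>w. l < r \<longrightarrow> w \<in> free_module V m \<and> A *\<^sub>v w = col B l"
    using assms(3) by (metis (no_types, lifting) imageE)
  then obtain w where w: "\<And>l. l < r \<Longrightarrow> w l \<in> free_module V m \<and> A *\<^sub>v w l = col B l" by metis
  have "A * mat m r (\<lambda>(k, l). w l $ k) = B"
    using w by (intro mat_of_col_fun[OF poly_mat_carrier[OF A] B]) (auto dest: free_moduleD)
  moreover have "mat m r (\<lambda>(k, l). w l $ k) \<in> poly_mat V m r"
    using w by (auto simp: poly_mat_def dest: free_moduleD)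
  ultimately show ?thesis by blast
qed

lemma lift_gr_mat:
  assumes A: "A \<in> gr_mat V s t" and B: "B \<in> gr_mat V s r"
    and "\<And>l. l < length r \<Longrightarrow> col B l \<in> (*\<^sub>v) A ` gr_free V t"
  shows "\<exists>X\<in>gr_mat V t r. A * X = B"
proof -
  have "\<forall>l. \<exists>w. l < length r \<longrightarrow> w \<in> gr_free V t \<and> A *\<^sub>v w = col B l"
    using assms(3) by (metis (no_types, lifting) imageE)
  then obtain w where w: "\<And>l. l < length r \<Longrightarrow> w l \<in> gr_free V t \<and> A *\<^sub>v w l = col B l" by metis
  \<comment> \<open>The component of degree \<open>r ! l\<close> of a preimage is still a preimage,
    since column \<open>l\<close> of \<open>B\<close> is homogeneous of that degree and
    \<open>A\<close> commutes with taking components.\<close>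
  define u where "u l = vcomp t (r ! l) (w l)" for l
  have u: "u l \<in> gr_free V t" "vhom t (r ! l) (u l)" "A *\<^sub>v u l = col B l" if l: "l < length r" for l
  proof -
    show "u l \<in> gr_free V t" "vhom t (r ! l) (u l)" using w[OF l] by (simp_all add: u_def)
    have "A *\<^sub>v u l = vcomp s (r ! l) (col B l)"
      using vcomp_mult[OF A free_moduleD(1), of "w l" V "r ! l"] w[OF l] by (simp add: u_def)
    also have "\<dots> = col B l"
      by (rule vcomp_vhom[OF free_moduleD(1)[OF col_free[OF gr_mat_poly_mat[OF B] l]] vhom_col[OF B l]])
    finally show "A *\<^sub>v u l = col B l" .
  qed
  have "A * mat (length t) (length r) (\<lambda>(k, l). u l $ k) = B"
    using u by (intro mat_of_col_fun[OF gr_mat_carrier[OF A] gr_mat_carrier[OF B]]) (auto dest: free_moduleD)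
  moreover have "mat (length t) (length r) (\<lambda>(k, l). u l $ k) \<in> gr_mat V t r"
    using u by (auto simp: gr_mat_def poly_mat_def vhom_def dest: free_moduleD)
  ultimately show ?thesis by blast
qed

section \<open>Comparison maps and homotopies\<close>

lemma resD:
  assumes "min_graded_free_resolution V I a s D"
  shows "a \<in> gr_free V (s 0)"
    and "\<And>k. k < length (s 0) \<Longrightarrow> homogeneous (s 0 ! k) (a $ k)"
    and "\<And>i. D i \<in> gr_mat V (s i) (s (Suc i))"
    and "\<And>i. const_zero (D i)"
    and "\<And>f. f \<in> polys V \<Longrightarrow> \<exists>v\<in>gr_free V (s 0). f - a \<bullet> v \<in> I"
    and "{v \<in> gr_free V (s 0). a \<bullet> v \<in> I} = (*\<^sub>v) (D 0) ` gr_free V (s 1)"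
    and "\<And>i. {v \<in> gr_free V (s (Suc i)). D i *\<^sub>v v = gr_zero (s i)} =
         (*\<^sub>v) (D (Suc i)) ` gr_free V (s (Suc (Suc i)))"
  using assms unfolding min_graded_free_resolution_iff by simp_all

lemma res_complex:
  assumes "min_graded_free_resolution V I a s D" "v \<in> gr_free V (s (Suc (Suc i)))"
  shows "D i *\<^sub>v (D (Suc i) *\<^sub>v v) = gr_zero (s i)"
  using resD(7)[OF assms(1), of i] assms(2) by blast

lemma res_complex_mat:
  assumes R: "min_graded_free_resolution V I a s D"
  shows "D i * D (Suc i) = 0\<^sub>m (length (s i)) (length (s (Suc (Suc i))))"
proof (rule mat_col_eqI)
  note c = gr_mat_carrier[OF resD(3)[OF R]]
  fix l assume "l < dim_col (0\<^sub>m (length (s i)) (length (s (Suc (Suc i)))) :: ('a, 'b) mpoly mat)"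
  then have l: "l < length (s (Suc (Suc i)))" by simp
  have "col (D i * D (Suc i)) l = D i *\<^sub>v col (D (Suc i)) l"
    using c[of i] c[of "Suc i"] l by (intro col_mult2) auto
  also have "\<dots> = D i *\<^sub>v (D (Suc i) *\<^sub>v unit_vec (length (s (Suc (Suc i)))) l)"
    using mat_mult_unit_vec[OF c l] by simp
  also have "\<dots> = gr_zero (s i)" by (rule res_complex[OF R]) simp
  finally show "col (D i * D (Suc i)) l = col (0\<^sub>m (length (s i)) (length (s (Suc (Suc i))))) l" using l by simp
qed (use gr_mat_carrier[OF resD(3)[OF R]] in auto)

lemma hcomp_scalar_prod:
  assumes "\<And>k. k < length t \<Longrightarrow> homogeneous (t ! k) (a $ k)" "v \<in> carrier_vec (length t)"
  shows "hcomp n (a \<bullet> v) = a \<bullet> vcomp t n v"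
proof -
  have "hcomp n (a $ k * v $ k) = a $ k * hcomp (n - t ! k) (v $ k)" if "k < length t" for k
    using hcomp_mult[OF assms(1)[OF that], of "n - t ! k" "v $ k"] by simp
  then show ?thesis
    using assms(2) by (simp add: scalar_prod_def hcomp_sum vcomp_def)
qed

lemma scalar_prod_mult_mat_vec:
  fixes A :: "'a::comm_ring_1 mat"
  assumes "A \<in> carrier_mat n m" "v \<in> carrier_vec m" "a \<in> carrier_vec n"
  shows "a \<bullet> (A *\<^sub>v v) = (\<Sum>k<m. v $ k * (a \<bullet> col A k))"
proof -
  have "a \<bullet> (A *\<^sub>v v) = (\<Sum>i<n. a $ i * (\<Sum>k<m. A $$ (i, k) * v $ k))"
    using assms mult_mat_vec_index[OF assms(1,2)]
    by (simp add: scalar_prod_def[of a] lessThan_atLeast0 del: index_mult_mat_vec)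
  also have "\<dots> = (\<Sum>k<m. \<Sum>i<n. a $ i * (A $$ (i, k) * v $ k))"
    unfolding sum_distrib_left by (rule sum.swap)
  also have "\<dots> = (\<Sum>k<m. v $ k * (a \<bullet> col A k))"
    using assms by (intro sum.cong refl) (auto simp: scalar_prod_def sum_distrib_left lessThan_atLeast0 mult_ac intro!: sum.cong)
  finally show ?thesis .
qed

text \<open>Lifts the identity of \<open>S/I\<close>: surjectivity of the second augmentation gives
  \<open>\<phi> 0\<close>, and each further map exists because the second complex is exact where
  consecutive maps of the first compose to zero.\<close>

lemma comparison_map:
  fixes I :: "('v, 'k::field) mpoly set"
  assumes I: "graded_ideal V I"
    and R: "min_graded_free_resolution V I a s D" and R': "min_graded_free_resolution V I a' s' D'"
  shows "\<exists>\<phi>. (\<forall>i. \<phi> i \<in> gr_mat V (s' i) (s i)) \<and>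
    (\<forall>v\<in>gr_free V (s 0). a \<bullet> v - a' \<bullet> (\<phi> 0 *\<^sub>v v) \<in> I) \<and>
    (\<forall>i. D' i * \<phi> (Suc i) = \<phi> i * D i)"
proof -
  note r = resD[OF R] and r' = resD[OF R'] and hI = graded_idealD[OF I]
  note dc = gr_mat_carrier[OF r(3)] and dc' = gr_mat_carrier[OF r'(3)]
  have "\<forall>k. \<exists>v. k < length (s 0) \<longrightarrow> v \<in> gr_free V (s' 0) \<and> a $ k - a' \<bullet> v \<in> I"
    using r(1) r'(5) by (metis free_moduleD(3))
  then obtain v where v: "\<And>k. k < length (s 0) \<Longrightarrow> v k \<in> gr_free V (s' 0) \<and> a $ k - a' \<bullet> v k \<in> I" by metis
  define w where "w k = vcomp (s' 0) (s 0 ! k) (v k)" for k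
  have w: "w k \<in> gr_free V (s' 0)" "vhom (s' 0) (s 0 ! k) (w k)" "a $ k - a' \<bullet> w k \<in> I"
    if k: "k < length (s 0)" for k
  proof -
    show "w k \<in> gr_free V (s' 0)" "vhom (s' 0) (s 0 ! k) (w k)" using v[OF k] by (simp_all add: w_def)
    have "hcomp (s 0 ! k) (a $ k - a' \<bullet> v k) = a $ k - a' \<bullet> w k"
      using hcomp_scalar_prod[OF r'(2), of "v k"] v[OF k] r(2)[OF k]
      by (simp add: hcomp_diff w_def hcomp_homogeneous free_module_iff)
    then show "a $ k - a' \<bullet> w k \<in> I" using hI(5) v[OF k] by metis
  qed
  define \<phi>0 where "\<phi>0 = mat (length (s' 0)) (length (s 0)) (\<lambda>(j, k). w k $ j)"
  have \<phi>0: "\<phi>0 \<in> gr_mat V (s' 0) (s 0)"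
    using w by (auto simp: \<phi>0_def gr_mat_def poly_mat_def vhom_def dest: free_moduleD)
  have col\<phi>0: "col \<phi>0 k = w k" if "k < length (s 0)" for k
    using w(1)[OF that] that by (intro eq_vecI) (auto simp: \<phi>0_def dest: free_moduleD)
  have aug: "a \<bullet> u - a' \<bullet> (\<phi>0 *\<^sub>v u) \<in> I" if u: "u \<in> gr_free V (s 0)" for u
  proof -
    have "a \<bullet> u - a' \<bullet> (\<phi>0 *\<^sub>v u) = (\<Sum>k<length (s 0). u $ k * (a $ k - a' \<bullet> w k))"
    proof -
      have "a' \<bullet> (\<phi>0 *\<^sub>v u) = (\<Sum>k<length (s 0). u $ k * (a' \<bullet> w k))"
        using scalar_prod_mult_mat_vec[OF gr_mat_carrier[OF \<phi>0] free_moduleD(1)[OF u] free_moduleD(1)[OF r'(1)]]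
        by (simp add: col\<phi>0)
      moreover have "a \<bullet> u = (\<Sum>k<length (s 0). u $ k * a $ k)"
        using free_moduleD(2)[OF u] by (simp add: scalar_prod_def lessThan_atLeast0 mult.commute)
      ultimately show ?thesis by (simp add: right_diff_distrib sum_subtractf)
    qed
    also have "\<dots> \<in> I" using u w(3) by (intro hI(8)) (auto intro: hI(4) dest: free_moduleD)
    finally show ?thesis .
  qed
  \<comment> \<open>The invariant says that the next square can be filled. Its clause for
    \<open>n = 0\<close> keeps the first map equal to \<open>\<phi>0\<close>, for which
    \<open>aug\<close> is known.\<close>
  let ?P = "\<lambda>n \<phi>. \<phi> \<in> gr_mat V (s' n) (s n) \<and>
    (\<forall>u\<in>gr_free V (s (Suc n)). \<phi> *\<^sub>v (D n *\<^sub>v u) \<in> (*\<^sub>v) (D' n) ` gr_free V (s' (Suc n))) \<and>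
    (n = 0 \<longrightarrow> \<phi> = \<phi>0)"
  have "\<exists>\<phi>. \<forall>n. ?P n (\<phi> n) \<and> D' n * \<phi> (Suc n) = \<phi> n * D n"
  proof (rule dependent_nat_choice)
    have "\<phi>0 *\<^sub>v (D 0 *\<^sub>v u) \<in> (*\<^sub>v) (D' 0) ` gr_free V (s' (Suc 0))"
      if u: "u \<in> gr_free V (s (Suc 0))" for u
    proof -
      have "D 0 *\<^sub>v u \<in> {v \<in> gr_free V (s 0). a \<bullet> v \<in> I}" using r(6) u by auto
      then have Du: "D 0 *\<^sub>v u \<in> gr_free V (s 0)" "a \<bullet> (D 0 *\<^sub>v u) \<in> I" by auto
      have "a' \<bullet> (\<phi>0 *\<^sub>v (D 0 *\<^sub>v u)) \<in> I" using hI(7)[OF Du(2) aug[OF Du(1)]] by simp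
      then have "\<phi>0 *\<^sub>v (D 0 *\<^sub>v u) \<in> {v \<in> gr_free V (s' 0). a' \<bullet> v \<in> I}"
        using mult_mat_vec_free[OF gr_mat_poly_mat[OF \<phi>0] Du(1)] by simp
      then show ?thesis using r'(6) by simp
    qed
    then show "\<exists>\<phi>. ?P 0 \<phi>" using \<phi>0 by (intro exI[of _ \<phi>0]) blast
    fix \<phi> and n :: nat assume \<phi>: "?P n \<phi>"
    have \<phi>g: "\<phi> \<in> gr_mat V (s' n) (s n)" using \<phi> by simp
    have col: "col (\<phi> * D n) l \<in> (*\<^sub>v) (D' n) ` gr_free V (s' (Suc n))" if l: "l < length (s (Suc n))" for l
    proof -
      have "col (\<phi> * D n) l = \<phi> *\<^sub>v (D n *\<^sub>v unit_vec (length (s (Suc n))) l)"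
        using mat_mult_unit_vec[OF dc l] col_mult2[OF gr_mat_carrier[OF \<phi>g] dc l] by simp
      then show ?thesis using \<phi> free_module_closed(6) by metis
    qed
    obtain \<phi>' where \<phi>': "\<phi>' \<in> gr_mat V (s' (Suc n)) (s (Suc n))" "D' n * \<phi>' = \<phi> * D n"
      using lift_gr_mat[OF r'(3) gr_mat_mult[OF \<phi>g r(3)] col] by blast
    have "\<phi>' *\<^sub>v (D (Suc n) *\<^sub>v u) \<in> (*\<^sub>v) (D' (Suc n)) ` gr_free V (s' (Suc (Suc n)))"
      if u: "u \<in> gr_free V (s (Suc (Suc n)))" for u
    proof -
      have Du: "D (Suc n) *\<^sub>v u \<in> gr_free V (s (Suc n))"
        using mult_mat_vec_free[OF gr_mat_poly_mat[OF r(3)] u] .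
      have "D' n *\<^sub>v (\<phi>' *\<^sub>v (D (Suc n) *\<^sub>v u)) = (D' n * \<phi>') *\<^sub>v (D (Suc n) *\<^sub>v u)"
        using assoc_mult_mat_vec[OF dc' gr_mat_carrier[OF \<phi>'(1)] free_moduleD(1)[OF Du]] by simp
      also have "\<dots> = \<phi> *\<^sub>v (D n *\<^sub>v (D (Suc n) *\<^sub>v u))"
        unfolding \<phi>'(2) using assoc_mult_mat_vec[OF gr_mat_carrier[OF \<phi>g] dc free_moduleD(1)[OF Du]] by simp
      also have "\<dots> = gr_zero (s' n)"
        using res_complex[OF R u] gr_mat_carrier[OF \<phi>g] by auto
      finally have "\<phi>' *\<^sub>v (D (Suc n) *\<^sub>v u) \<in> {v \<in> gr_free V (s' (Suc n)). D' n *\<^sub>v v = gr_zero (s' n)}"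
        using mult_mat_vec_free[OF gr_mat_poly_mat[OF \<phi>'(1)] Du] by simp
      then show ?thesis using r'(7) by simp
    qed
    then show "\<exists>\<phi>'. ?P (Suc n) \<phi>' \<and> D' n * \<phi>' = \<phi> * D n"
      using \<phi>' by (intro exI[of _ \<phi>']) simp
  qed
  then obtain \<phi> where \<phi>: "\<forall>n. ?P n (\<phi> n) \<and> D' n * \<phi> (Suc n) = \<phi> n * D n" by (rule exE)
  have "\<phi> 0 = \<phi>0" using spec[OF \<phi>, of 0] by simp
  then show ?thesis using \<phi> aug by (intro exI[of _ \<phi>]) simp
qed

text \<open>\<open>\<chi> - 1\<close> lifts the zero map of \<open>S/I\<close> and is therefore
  null-homotopic: in each step it is a sum of products of a homotopy with a differential, and such
  products vanish modulo the variables by minimality.\<close>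

lemma homotopic_identity:
  fixes I :: "('v, 'k::field) mpoly set"
  assumes I: "graded_ideal V I" and R: "min_graded_free_resolution V I a s D"
    and \<chi>: "\<And>i. \<chi> i \<in> gr_mat V (s i) (s i)"
    and aug: "\<And>v. v \<in> gr_free V (s 0) \<Longrightarrow> a \<bullet> v - a \<bullet> (\<chi> 0 *\<^sub>v v) \<in> I"
    and comm: "\<And>i. D i * \<chi> (Suc i) = \<chi> i * D i"
  shows "const_zero (\<chi> i - 1\<^sub>m (length (s i)))"
proof -
  note r = resD[OF R] and hI = graded_idealD[OF I]
  let ?n = "\<lambda>i. length (s i)"
  note dc = gr_mat_carrier[OF r(3)] and xc = gr_mat_carrier[OF \<chi>]
  define \<delta> where "\<delta> i = \<chi> i - 1\<^sub>m (?n i)" for i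
  have \<delta>p: "\<delta> i \<in> poly_mat V (?n i) (?n i)" for i
    unfolding \<delta>_def by (intro poly_mat_closed gr_mat_poly_mat \<chi>)
  note \<delta>c = poly_mat_carrier[OF \<delta>p]
  have \<delta>comm: "D i * \<delta> (Suc i) = \<delta> i * D i" for i
    unfolding \<delta>_def using mult_minus_distrib_mat[OF dc[of i] xc[of "Suc i"] one_carrier_mat]
      minus_mult_distrib_mat[OF xc[of i] one_carrier_mat dc[of i]] dc[of i]
    by (simp add: comm)
  \<comment> \<open>The induction carries the homotopy one step ahead: what \<open>h * D i\<close>
    leaves over of \<open>\<delta> (Suc i)\<close> is killed by \<open>D i\<close>, hence lifts
    through \<open>D (Suc i)\<close> by exactness.\<close>
  have "const_zero (\<delta> i) \<and> (\<exists>h\<in>poly_mat V (?n (Suc i)) (?n i).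
      D i * (\<delta> (Suc i) - h * D i) = 0\<^sub>m (?n i) (?n (Suc i)))"
  proof (induction i)
    case 0
    have "col (\<delta> 0) l \<in> (*\<^sub>v) (D 0) ` free_module V (?n 1)" if l: "l < ?n 0" for l
    proof -
      let ?e = "unit_vec (?n 0) l :: ('v, 'k) mpoly vec"
      have "\<delta> 0 *\<^sub>v ?e = \<chi> 0 *\<^sub>v ?e - 1\<^sub>m (?n 0) *\<^sub>v ?e"
        unfolding \<delta>_def by (rule minus_mult_distrib_mat_vec[OF xc one_carrier_mat]) simp
      then have eq: "col (\<delta> 0) l = \<chi> 0 *\<^sub>v ?e - ?e"
        using mat_mult_unit_vec[OF \<delta>c l] by simp
      have "a \<bullet> (\<chi> 0 *\<^sub>v ?e - ?e) = - (a \<bullet> ?e - a \<bullet> (\<chi> 0 *\<^sub>v ?e))"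
        using scalar_prod_minus_distrib[of a "?n 0" "\<chi> 0 *\<^sub>v ?e" ?e] free_moduleD(1)[OF r(1)] xc[of 0] by simp
      also have "\<dots> \<in> I" by (rule hI(6)[OF aug]) simp
      finally have "col (\<delta> 0) l \<in> {v \<in> free_module V (?n 0). a \<bullet> v \<in> I}"
        using col_free[OF \<delta>p l] by (simp add: eq)
      then show ?thesis using r(6) by simp
    qed
    then obtain h where h: "h \<in> poly_mat V (?n 1) (?n 0)" "D 0 * h = \<delta> 0"
      using lift_mat[OF gr_mat_poly_mat[OF r(3)[of 0]] \<delta>c[of 0]] by auto
    note hc = poly_mat_carrier[OF h(1)]
    have "const_zero (\<delta> 0)"
      using const_zero_mult[OF dc[of 0], of h] hc r(4)[of 0] by (simp add: h(2))
    moreover have "D 0 * (\<delta> (Suc 0) - h * D 0) = D 0 * \<delta> (Suc 0) - D 0 * (h * D 0)"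
      using hc dc[of 0] by (intro mult_minus_distrib_mat[OF dc \<delta>c]) auto
    then have "D 0 * (\<delta> (Suc 0) - h * D 0) = 0\<^sub>m (?n 0) (?n (Suc 0))"
      using assoc_mult_mat[OF dc[of 0] _ dc[of 0], of h] hc \<delta>c[of 0] dc[of 0] by (simp add: \<delta>comm h(2))
    ultimately show ?case using h(1) by auto
  next
    case (Suc i)
    then obtain h where h: "h \<in> poly_mat V (?n (Suc i)) (?n i)"
      "D i * (\<delta> (Suc i) - h * D i) = 0\<^sub>m (?n i) (?n (Suc i))" by blast
    note hc = poly_mat_carrier[OF h(1)]
    let ?E = "\<delta> (Suc i) - h * D i"
    have Ep: "?E \<in> poly_mat V (?n (Suc i)) (?n (Suc i))"
      by (intro poly_mat_closed \<delta>p poly_mat_mult[OF h(1) gr_mat_poly_mat[OF r(3)]])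
    note Ec = poly_mat_carrier[OF Ep]
    have "col ?E l \<in> (*\<^sub>v) (D (Suc i)) ` free_module V (?n (Suc (Suc i)))" if l: "l < ?n (Suc i)" for l
    proof -
      have "D i *\<^sub>v col ?E l = col (D i * ?E) l" using col_mult2[OF dc Ec l] by simp
      also have "\<dots> = 0\<^sub>v (?n i)" unfolding h(2) using l by simp
      finally have "col ?E l \<in> {v \<in> free_module V (?n (Suc i)). D i *\<^sub>v v = 0\<^sub>v (?n i)}"
        using col_free[OF Ep l] by simp
      then show ?thesis using r(7) by simp
    qed
    then obtain h' where h': "h' \<in> poly_mat V (?n (Suc (Suc i))) (?n (Suc i))" "D (Suc i) * h' = ?E"
      using lift_mat[OF gr_mat_poly_mat[OF r(3)[of "Suc i"]] Ec] by auto
    note hc' = poly_mat_carrier[OF h'(1)]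
    have hDc: "h * D i \<in> carrier_mat (?n (Suc i)) (?n (Suc i))" using hc dc[of i] by simp
    have \<delta>eq: "\<delta> (Suc i) = D (Suc i) * h' + h * D i"
      unfolding h'(2) using \<delta>c[of "Suc i"] hDc by (intro eq_matI) auto
    have "const_zero (\<delta> (Suc i))"
      unfolding \<delta>eq using const_zero_mult[OF dc[of "Suc i"] hc'] const_zero_mult[OF hc dc] r(4)
      by (intro const_zero_add[OF _ hDc]) (use dc[of "Suc i"] hc' in auto)
    moreover have "D (Suc i) * (\<delta> (Suc (Suc i)) - h' * D (Suc i)) = 0\<^sub>m (?n (Suc i)) (?n (Suc (Suc i)))"
    proof -
      have h'D: "h' * D (Suc i) \<in> carrier_mat (?n (Suc (Suc i))) (?n (Suc (Suc i)))" using hc' dc[of "Suc i"] by simp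
      have "D (Suc i) * (\<delta> (Suc (Suc i)) - h' * D (Suc i)) = \<delta> (Suc i) * D (Suc i) - D (Suc i) * (h' * D (Suc i))"
        using mult_minus_distrib_mat[OF dc \<delta>c h'D] by (simp add: \<delta>comm)
      also have "D (Suc i) * (h' * D (Suc i)) = (D (Suc i) * h') * D (Suc i)"
        using assoc_mult_mat[OF dc hc' dc] by simp
      also have "\<delta> (Suc i) * D (Suc i) = (D (Suc i) * h') * D (Suc i) + (h * D i) * D (Suc i)"
        unfolding \<delta>eq using dc[of "Suc i"] hc' hDc by (intro add_mult_distrib_mat[OF _ hDc dc]) auto
      also have "(h * D i) * D (Suc i) = h * (D i * D (Suc i))"
        using assoc_mult_mat[OF hc dc dc] by simp
      also have "\<dots> = 0\<^sub>m (?n (Suc i)) (?n (Suc (Suc i)))"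
        unfolding res_complex_mat[OF R] using hc by simp
      finally show ?thesis using dc[of "Suc i"] hc' by simp
    qed
    ultimately show ?case using h'(1) by blast
  qed
  then show ?thesis by (simp add: \<delta>_def)
qed

section \<open>Counting generators modulo the variables\<close>

lemma left_inverse_dim_le:
  fixes A B :: "'a::field mat"
  assumes A: "A \<in> carrier_mat m n" and B: "B \<in> carrier_mat n m" and BA: "B * A = 1\<^sub>m n"
  shows "n \<le> m"
proof (rule ccontr)
  assume "\<not> n \<le> m"
  then have lt: "m < n" by simp
  \<comment> \<open>Padding with zeros makes both matrices square without changing the product; the
    padded \<open>A'\<close> has the zero row \<open>m\<close>, so its determinant is 0 although it
    has a left inverse.\<close>
  define A' where "A' = mat n n (\<lambda>(i, j). if i < m then A $$ (i, j) else 0)"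
  define B' where "B' = mat n n (\<lambda>(i, j). if j < m then B $$ (i, j) else 0)"
  have A'c: "A' \<in> carrier_mat n n" and B'c: "B' \<in> carrier_mat n n" by (simp_all add: A'_def B'_def)
  have "B' * A' = 1\<^sub>m n"
  proof (rule eq_matI)
    fix i j assume "i < dim_row (1\<^sub>m n :: 'a mat)" "j < dim_col (1\<^sub>m n :: 'a mat)"
    then have ij: "i < n" "j < n" by auto
    have "(B' * A') $$ (i, j) = (\<Sum>k<n. B' $$ (i, k) * A' $$ (k, j))"
      by (rule mult_mat_index[OF B'c A'c ij])
    also have "\<dots> = (\<Sum>k<m. B $$ (i, k) * A $$ (k, j))"
      using lt ij by (intro sum.mono_neutral_cong_right) (auto simp: A'_def B'_def)
    also have "\<dots> = (B * A) $$ (i, j)" using mult_mat_index[OF B A ij] by simp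
    finally show "(B' * A') $$ (i, j) = 1\<^sub>m n $$ (i, j)" using BA by simp
  qed (use A'c B'c in auto)
  then have "det B' * det A' = 1" using det_mult[OF B'c A'c] by simp
  moreover have "det A' = 0"
  proof -
    have "A' = mat\<^sub>r n n (\<lambda>i. if i = m then 0\<^sub>v n else row A' i)"
      by (rule eq_matI) (auto simp: A'_def)
    then show ?thesis using det_row_0[OF lt, of "row A'"] A'c by auto
  qed
  ultimately show False by simp
qed

lemma count_list_filter: "count_list xs j = length (filter (\<lambda>k. xs ! k = j) [0..<length xs])"
proof -
  have "count_list xs j = length (filter ((=) j) (map ((!) xs) [0..<length xs]))"
    by (simp only: map_nth count_list_eq_length_filter)
  also have "\<dots> = length (filter (\<lambda>k. j = xs ! k) [0..<length xs])"
    by (simp only: filter_map length_map o_def)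
  also have "(\<lambda>k. j = xs ! k) = (\<lambda>k. xs ! k = j)" by auto
  finally show ?thesis .
qed

text \<open>Modulo the variables \<open>\<psi> * \<phi>\<close> is the identity. A homogeneous entry
  has a nonzero constant term only between generators of equal degree, so already the blocks of
  degree \<open>j\<close> give a left inverse over the field.\<close>

lemma count_le_of_retract:
  assumes \<phi>: "\<phi> \<in> gr_mat V s' s" and \<psi>: "\<psi> \<in> gr_mat V s s'"
    and cz: "const_zero (\<psi> * \<phi> - 1\<^sub>m (length s))"
  shows "count_list s j \<le> count_list s' j"
proof -
  define K where "K = filter (\<lambda>k. s ! k = j) [0..<length s]"
  define K' where "K' = filter (\<lambda>k. s' ! k = j) [0..<length s']"
  have K: "K ! p < length s" "s ! (K ! p) = j" if "p < length K" for p
    using nth_mem[OF that] by (auto simp: K_def)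
  have K': "K' ! p < length s'" "s' ! (K' ! p) = j" if "p < length K'" for p
    using nth_mem[OF that] by (auto simp: K'_def)
  have dist: "distinct K" "distinct K'" by (simp_all add: K_def K'_def)
  have setK': "set K' = {k. k < length s' \<and> s' ! k = j}" by (auto simp: K'_def)
  define A where "A = mat (length K') (length K) (\<lambda>(p, q). lookup (\<phi> $$ (K' ! p, K ! q)) 0)"
  define B where "B = mat (length K) (length K') (\<lambda>(q, p). lookup (\<psi> $$ (K ! q, K' ! p)) 0)"
  have Ac: "A \<in> carrier_mat (length K') (length K)" and Bc: "B \<in> carrier_mat (length K) (length K')"
    by (simp_all add: A_def B_def)
  have "B * A = 1\<^sub>m (length K)"
  proof (rule eq_matI)
    fix q r assume "q < dim_row (1\<^sub>m (length K) :: 'b mat)" "r < dim_col (1\<^sub>m (length K) :: 'b mat)"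
    then have qr: "q < length K" "r < length K" by auto
    let ?f = "\<lambda>k. lookup (\<psi> $$ (K ! q, k)) 0 * lookup (\<phi> $$ (k, K ! r)) 0"
    have "(B * A) $$ (q, r) = (\<Sum>p<length K'. ?f (K' ! p))"
      using mult_mat_index[OF Bc Ac qr] qr by (simp add: A_def B_def del: index_mult_mat(1))
    also have "\<dots> = (\<Sum>k\<in>set K'. ?f k)"
      using dist(2) by (simp add: sum.distinct_set_conv_list sum_list_sum_nth lessThan_atLeast0)
    \<comment> \<open>Generators of other degrees may be added to the sum: their entries in
      \<open>\<phi>\<close> have nonzero degree and hence no constant term.\<close>
    also have "\<dots> = (\<Sum>k<length s'. ?f k)"
    proof (intro sum.mono_neutral_left ballI)
      fix k assume "k \<in> {..<length s'} - set K'"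
      then have k: "k < length s'" "s' ! k \<noteq> j" by (auto simp: setK')
      have "homogeneous (j - s' ! k) (\<phi> $$ (k, K ! r))"
        using gr_mat_idx[OF \<phi> k(1) K(1)[OF qr(2)]] K(2)[OF qr(2)] by simp
      then have "lookup (\<phi> $$ (k, K ! r)) 0 = 0"
        using k(2) unfolding homogeneous_def by (metis in_keys_iff mdeg_0 of_nat_0 right_minus_eq)
      then show "?f k = 0" by simp
    qed (auto simp: setK')
    also have "\<dots> = lookup ((\<psi> * \<phi>) $$ (K ! q, K ! r)) 0"
      using mult_mat_index[OF gr_mat_carrier[OF \<psi>] gr_mat_carrier[OF \<phi>] K(1)[OF qr(1)] K(1)[OF qr(2)]]
      by (simp add: lookup_sum lookup_mult_0 del: index_mult_mat(1))
    also have "\<dots> = (if K ! q = K ! r then 1 else 0)"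
    proof -
      have "lookup ((\<psi> * \<phi> - 1\<^sub>m (length s)) $$ (K ! q, K ! r)) 0 = 0"
        using cz K(1)[OF qr(1)] K(1)[OF qr(2)] unfolding const_zero_def by simp
      then show ?thesis
        using K(1)[OF qr(1)] K(1)[OF qr(2)] gr_mat_carrier[OF \<psi>] gr_mat_carrier[OF \<phi>]
        by (simp add: lookup_minus split: if_splits)
    qed
    also have "\<dots> = 1\<^sub>m (length K) $$ (q, r)"
      using qr dist(1) by (simp add: nth_eq_iff_index_eq)
    finally show "(B * A) $$ (q, r) = 1\<^sub>m (length K) $$ (q, r)" .
  qed (use Ac Bc in auto)
  then have "length K \<le> length K'" by (rule left_inverse_dim_le[OF Ac Bc])
  then show ?thesis by (simp add: count_list_filter K_def K'_def)
qed

text \<open>Comparison maps in both directions compose to a lift of the identity of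
  \<open>S/I\<close>, which is the identity modulo the variables. Exchanging the two resolutions
  gives equality.\<close>

lemma betti_le:
  fixes I :: "('v, 'k::field) mpoly set"
  assumes I: "graded_ideal V I"
    and R: "min_graded_free_resolution V I a s D" and R': "min_graded_free_resolution V I a' s' D'"
  shows "count_list (s i) j \<le> count_list (s' i) j"
proof -
  note hI = graded_idealD[OF I]
  obtain \<phi> where \<phi>: "\<And>i. \<phi> i \<in> gr_mat V (s' i) (s i)"
    "\<And>v. v \<in> gr_free V (s 0) \<Longrightarrow> a \<bullet> v - a' \<bullet> (\<phi> 0 *\<^sub>v v) \<in> I"
    "\<And>i. D' i * \<phi> (Suc i) = \<phi> i * D i"
    using comparison_map[OF I R R'] by blast
  obtain \<psi> where \<psi>: "\<And>i. \<psi> i \<in> gr_mat V (s i) (s' i)"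
    "\<And>v. v \<in> gr_free V (s' 0) \<Longrightarrow> a' \<bullet> v - a \<bullet> (\<psi> 0 *\<^sub>v v) \<in> I"
    "\<And>i. D i * \<psi> (Suc i) = \<psi> i * D' i"
    using comparison_map[OF I R' R] by blast
  note pc = gr_mat_carrier[OF \<phi>(1)] and qc = gr_mat_carrier[OF \<psi>(1)]
  note dc = gr_mat_carrier[OF resD(3)[OF R]] and dc' = gr_mat_carrier[OF resD(3)[OF R']]
  have "const_zero (\<psi> i * \<phi> i - 1\<^sub>m (length (s i)))"
  proof (rule homotopic_identity[OF I R])
    show "\<psi> i * \<phi> i \<in> gr_mat V (s i) (s i)" for i by (rule gr_mat_mult[OF \<psi>(1) \<phi>(1)])
    fix v :: "('v, 'k) mpoly vec" assume v: "v \<in> gr_free V (s 0)"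
    have \<phi>v: "\<phi> 0 *\<^sub>v v \<in> gr_free V (s' 0)"
      using mult_mat_vec_free[OF gr_mat_poly_mat[OF \<phi>(1)] v] .
    have "(\<psi> 0 * \<phi> 0) *\<^sub>v v = \<psi> 0 *\<^sub>v (\<phi> 0 *\<^sub>v v)"
      using assoc_mult_mat_vec[OF qc pc free_moduleD(1)[OF v]] by simp
    then show "a \<bullet> v - a \<bullet> ((\<psi> 0 * \<phi> 0) *\<^sub>v v) \<in> I"
      using hI(3)[OF \<phi>(2)[OF v] \<psi>(2)[OF \<phi>v]] by simp
  next
    fix i
    have "D i * (\<psi> (Suc i) * \<phi> (Suc i)) = (D i * \<psi> (Suc i)) * \<phi> (Suc i)"
      using assoc_mult_mat[OF dc qc pc] by simp
    also have "\<dots> = \<psi> i * (D' i * \<phi> (Suc i))"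
      unfolding \<psi>(3) using assoc_mult_mat[OF qc dc' pc] by simp
    also have "\<dots> = (\<psi> i * \<phi> i) * D i"
      unfolding \<phi>(3) using assoc_mult_mat[OF qc pc dc] by simp
    finally show "D i * (\<psi> (Suc i) * \<phi> (Suc i)) = (\<psi> i * \<phi> i) * D i" .
  qed
  then show ?thesis by (rule count_le_of_retract[OF \<phi>(1) \<psi>(1)])
qed

theorem graded_betti_eq:
  assumes "graded_ideal V I" "min_graded_free_resolution V I a s D"
  shows "graded_betti V I i j = count_list (s i) j"
  unfolding graded_betti_def
proof (rule the_equality)
  show "\<exists>a' s' D'. min_graded_free_resolution V I a' s' D' \<and> count_list (s i) j = count_list (s' i) j"
    using assms(2) by blast
next
  fix n assume "\<exists>a' s' D'. min_graded_free_resolution V I a' s' D' \<and> n = count_list (s' i) j"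
  then show "n = count_list (s i) j"
    using betti_le[OF assms(1)] assms(2) by (metis le_antisym)
qed

section \<open>Extension of scalars along a free extension\<close>

text \<open>\<open>K[V']\<close> as a free module over \<open>K[V]\<close> via \<open>\<rho>\<close>: the basis is \<open>b\<close>, and \<open>cf u\<close> is the coordinate
  function of \<open>b u\<close>.\<close>

locale free_extension =
  fixes V :: "'v set" and V' :: "'w set"
    and \<rho> :: "('v, 'k::field) mpoly \<Rightarrow> ('w, 'k) mpoly"
    and cf :: "'u \<Rightarrow> ('w, 'k) mpoly \<Rightarrow> ('v, 'k) mpoly"
    and b :: "'u \<Rightarrow> ('w, 'k) mpoly"
  assumes additive_\<rho>: "additive \<rho>" and additive_cf: "\<And>u. additive (cf u)"
    and \<rho>_mult: "\<And>p q. p \<in> polys V \<Longrightarrow> q \<in> polys V \<Longrightarrow> \<rho> (p * q) = \<rho> p * \<rho> q"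
    and \<rho>_closed: "\<And>p. p \<in> polys V \<Longrightarrow> \<rho> p \<in> polys V'"
    and cf_closed: "\<And>u f. f \<in> polys V' \<Longrightarrow> cf u f \<in> polys V"
    and b_closed: "\<And>u f. cf u f \<noteq> 0 \<Longrightarrow> f \<in> polys V' \<Longrightarrow> b u \<in> polys V'"
    and \<rho>_homogeneous: "\<And>n p. p \<in> polys V \<Longrightarrow> homogeneous n p \<Longrightarrow> homogeneous n (\<rho> p)"
    and \<rho>_const: "\<And>p. p \<in> polys V \<Longrightarrow> lookup (\<rho> p) 0 = lookup p 0"
    and cf_mult: "\<And>u p f. p \<in> polys V \<Longrightarrow> f \<in> polys V' \<Longrightarrow> cf u (\<rho> p * f) = p * cf u f"
    and cf_hcomp: "\<And>u n f. f \<in> polys V' \<Longrightarrow> \<exists>m. cf u (hcomp n f) = hcomp m (cf u f)"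
    and expansion: "\<And>f. f \<in> polys V' \<Longrightarrow>
      \<exists>T. finite T \<and> (\<forall>u. u \<notin> T \<longrightarrow> cf u f = 0) \<and> f = (\<Sum>u\<in>T. b u * \<rho> (cf u f))"
begin

lemmas \<rho>_0 [simp] = additive.zero[OF additive_\<rho>]
lemmas cf_0 [simp] = additive.zero[OF additive_cf]
lemmas \<rho>_diff = additive.diff[OF additive_\<rho>]
lemmas \<rho>_sum = additive.sum[OF additive_\<rho>]
lemmas cf_add = additive.add[OF additive_cf]
lemmas cf_diff = additive.diff[OF additive_cf]
lemmas cf_sum = additive.sum[OF additive_cf]

text \<open>The ideal generated by the image of \<open>I\<close>, described through coordinates
  instead of generators; this is the form in which membership and exactness can be tested one basis
  element at a time.\<close>

definition ext :: "('v, 'k) mpoly set \<Rightarrow> ('w, 'k) mpoly set" where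
  "ext I = {f \<in> polys V'. \<forall>u. cf u f \<in> I}"

lemma expansion_superset:
  assumes "f \<in> polys V'" "finite T" "\<And>u. u \<notin> T \<Longrightarrow> cf u f = 0"
  shows "f = (\<Sum>u\<in>T. b u * \<rho> (cf u f))"
proof -
  obtain S where S: "finite S" "\<And>u. u \<notin> S \<Longrightarrow> cf u f = 0" "f = (\<Sum>u\<in>S. b u * \<rho> (cf u f))"
    using expansion[OF assms(1)] by blast
  have "(\<Sum>u\<in>S. b u * \<rho> (cf u f)) = (\<Sum>u\<in>S \<union> T. b u * \<rho> (cf u f))"
    using S assms by (intro sum.mono_neutral_left) auto
  also have "\<dots> = (\<Sum>u\<in>T. b u * \<rho> (cf u f))"
    using S assms by (intro sum.mono_neutral_right) auto
  finally show ?thesis using S(3) by simp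
qed

definition vcf :: "'u \<Rightarrow> ('w, 'k) mpoly vec \<Rightarrow> ('v, 'k) mpoly vec" where
  "vcf u v = map_vec (cf u) v"

definition comb :: "nat \<Rightarrow> 'u set \<Rightarrow> ('u \<Rightarrow> ('v, 'k) mpoly vec) \<Rightarrow> ('w, 'k) mpoly vec" where
  "comb n T w = vec n (\<lambda>k. \<Sum>u\<in>T. b u * \<rho> (w u $ k))"

lemma vcf_free: "v \<in> free_module V' n \<Longrightarrow> vcf u v \<in> free_module V n"
  by (auto simp: vcf_def free_module_iff cf_closed)

lemma comb_free:
  assumes "\<And>u. u \<in> T \<Longrightarrow> b u \<in> polys V' \<and> w u \<in> free_module V n"
  shows "comb n T w \<in> free_module V' n"
proof -
  have "b u * \<rho> (w u $ k) \<in> polys V'" if "u \<in> T" "k < n" for u k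
    using assms[OF that(1)] free_moduleD(3)[of "w u" V n k] that(2) by (simp add: \<rho>_closed)
  then show ?thesis by (auto simp: free_module_iff comb_def intro: polys_sum)
qed

lemma vcf_finite:
  assumes "v \<in> free_module V' n"
  shows "\<exists>T. finite T \<and> (\<forall>u. u \<notin> T \<longrightarrow> vcf u v = 0\<^sub>v n) \<and>
    (\<forall>u\<in>T. b u \<in> polys V') \<and> v = comb n T (\<lambda>u. vcf u v)"
proof -
  have "\<forall>k. \<exists>T. k < n \<longrightarrow> finite T \<and> (\<forall>u. u \<notin> T \<longrightarrow> cf u (v $ k) = 0)"
    using expansion free_moduleD(3)[OF assms] by metis
  then obtain T where T: "\<And>k. k < n \<Longrightarrow> finite (T k)" "\<And>k u. k < n \<Longrightarrow> u \<notin> T k \<Longrightarrow> cf u (v $ k) = 0"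
    by metis
  \<comment> \<open>Only indices with a nonzero coordinate are kept, because \<open>b_closed\<close>
    places the basis element in the ring for these.\<close>
  define S where "S = {u \<in> \<Union> (T ` {..<n}). \<exists>k<n. cf u (v $ k) \<noteq> 0}"
  have S: "finite S" using T(1) by (auto simp: S_def)
  have S0: "cf u (v $ k) = 0" if "k < n" "u \<notin> S" for k u
    using that T(2) by (auto simp: S_def)
  have "vcf u v = 0\<^sub>v n" if "u \<notin> S" for u
    using S0[OF _ that] free_moduleD(2)[OF assms] by (intro eq_vecI) (auto simp: vcf_def)
  moreover have "b u \<in> polys V'" if "u \<in> S" for u
    using that b_closed free_moduleD(3)[OF assms] by (auto simp: S_def)
  moreover have "v = comb n S (\<lambda>u. vcf u v)"
  proof (rule eq_vecI)
    fix k assume "k < dim_vec (comb n S (\<lambda>u. vcf u v))"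
    then have k: "k < n" by (simp add: comb_def)
    have "v $ k = (\<Sum>u\<in>S. b u * \<rho> (cf u (v $ k)))"
      using free_moduleD(3)[OF assms k] S S0[OF k] by (rule expansion_superset)
    then show "v $ k = comb n S (\<lambda>u. vcf u v) $ k"
      using k free_moduleD(2)[OF assms] by (simp add: comb_def vcf_def)
  qed (use free_moduleD(2)[OF assms] in \<open>simp add: comb_def\<close>)
  ultimately show ?thesis using S by blast
qed

lemma map_mat_poly_mat: "A \<in> poly_mat V n m \<Longrightarrow> map_mat \<rho> A \<in> poly_mat V' n m"
  by (auto simp: poly_mat_def \<rho>_closed)

lemma vcf_mult:
  assumes A: "A \<in> poly_mat V n m" and v: "v \<in> free_module V' m"
  shows "vcf u (map_mat \<rho> A *\<^sub>v v) = A *\<^sub>v vcf u v"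
proof (rule eq_vecI)
  note Ac = poly_mat_carrier[OF A] and vc = free_moduleD[OF v] and wc = free_moduleD[OF vcf_free[OF v]]
  have Bc: "map_mat \<rho> A \<in> carrier_mat n m" using Ac by simp
  fix i assume "i < dim_vec (A *\<^sub>v vcf u v)"
  then have i: "i < n" using Ac by simp
  have "cf u (\<rho> (A $$ (i, j)) * v $ j) = A $$ (i, j) * cf u (v $ j)" if "j < m" for j
    using poly_matD[OF A i that] vc(3)[OF that] by (rule cf_mult)
  then show "vcf u (map_mat \<rho> A *\<^sub>v v) $ i = (A *\<^sub>v vcf u v) $ i"
    using mult_mat_vec_index[OF Bc vc(1) i] mult_mat_vec_index[OF Ac wc(1) i] i Ac vc(2)
    by (simp add: vcf_def cf_sum del: index_mult_mat_vec)
qed (use poly_mat_carrier[OF A] in \<open>simp add: vcf_def\<close>)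

lemma mult_comb:
  assumes A: "A \<in> poly_mat V n m" and w: "\<And>u. u \<in> T \<Longrightarrow> w u \<in> free_module V m"
  shows "map_mat \<rho> A *\<^sub>v comb m T w = comb n T (\<lambda>u. A *\<^sub>v w u)"
proof (rule eq_vecI)
  note Ac = poly_mat_carrier[OF A]
  have Bc: "map_mat \<rho> A \<in> carrier_mat n m" using Ac by simp
  have cc: "comb m T w \<in> carrier_vec m" by (simp add: comb_def)
  fix i assume "i < dim_vec (comb n T (\<lambda>u. A *\<^sub>v w u))"
  then have i: "i < n" by (simp add: comb_def)
  have "(map_mat \<rho> A *\<^sub>v comb m T w) $ i = (\<Sum>j<m. \<Sum>u\<in>T. \<rho> (A $$ (i, j)) * (b u * \<rho> (w u $ j)))"
    using mult_mat_vec_index[OF Bc cc i] i Ac by (simp add: comb_def sum_distrib_left)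
  also have "\<dots> = (\<Sum>u\<in>T. \<Sum>j<m. \<rho> (A $$ (i, j)) * (b u * \<rho> (w u $ j)))"
    by (rule sum.swap)
  also have "\<dots> = (\<Sum>u\<in>T. b u * \<rho> ((A *\<^sub>v w u) $ i))"
  proof (rule sum.cong[OF refl])
    fix u assume u: "u \<in> T"
    have "(A *\<^sub>v w u) $ i = (\<Sum>j<m. A $$ (i, j) * w u $ j)"
      using mult_mat_vec_index[OF Ac free_moduleD(1)[OF w[OF u]] i] .
    moreover have "\<rho> (A $$ (i, j) * w u $ j) = \<rho> (A $$ (i, j)) * \<rho> (w u $ j)" if "j < m" for j
      using poly_matD[OF A i that] free_moduleD(3)[OF w[OF u] that] by (rule \<rho>_mult)
    ultimately show "(\<Sum>j<m. \<rho> (A $$ (i, j)) * (b u * \<rho> (w u $ j))) = b u * \<rho> ((A *\<^sub>v w u) $ i)"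
      by (simp add: \<rho>_sum sum_distrib_left mult_ac)
  qed
  finally show "(map_mat \<rho> A *\<^sub>v comb m T w) $ i = comb n T (\<lambda>u. A *\<^sub>v w u) $ i"
    using i by (simp add: comb_def)
qed (use poly_mat_carrier[OF A] in \<open>simp add: comb_def\<close>)

text \<open>\<open>map_mat \<rho> A\<close> acts on each coordinate as \<open>A\<close>, so
  preimages can be chosen coordinate by coordinate and reassembled over finitely many indices.
  \<open>P\<close> stands for membership in the kernel of the augmentation or of a
  differential.\<close>

lemma exactness_transfer:
  assumes A: "A \<in> poly_mat V n m"
    and ex: "{v \<in> free_module V n. P v} = (*\<^sub>v) A ` free_module V m"
  shows "{v \<in> free_module V' n. \<forall>u. P (vcf u v)} = (*\<^sub>v) (map_mat \<rho> A) ` free_module V' m"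
proof (intro equalityI subsetI)
  fix v assume "v \<in> {v \<in> free_module V' n. \<forall>u. P (vcf u v)}"
  then have v: "v \<in> free_module V' n" "\<And>u. P (vcf u v)" by auto
  have "\<forall>u. \<exists>w. w \<in> free_module V m \<and> vcf u v = A *\<^sub>v w"
    using ex v(2) vcf_free[OF v(1)] by blast
  then obtain w where w: "\<And>u. w u \<in> free_module V m" "\<And>u. vcf u v = A *\<^sub>v w u" by metis
  obtain T where T: "finite T" "\<forall>u\<in>T. b u \<in> polys V'" "v = comb n T (\<lambda>u. vcf u v)"
    using vcf_finite[OF v(1)] by blast
  have "v = map_mat \<rho> A *\<^sub>v comb m T w"
    using mult_comb[OF A w(1)] T(3) by (simp add: w(2))
  moreover have "comb m T w \<in> free_module V' m" using T(2) w(1) by (intro comb_free) auto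
  ultimately show "v \<in> (*\<^sub>v) (map_mat \<rho> A) ` free_module V' m" by blast
next
  fix v assume "v \<in> (*\<^sub>v) (map_mat \<rho> A) ` free_module V' m"
  then obtain w where w: "w \<in> free_module V' m" "v = map_mat \<rho> A *\<^sub>v w" by blast
  have "P (A *\<^sub>v vcf u w)" for u using ex vcf_free[OF w(1)] by blast
  then show "v \<in> {v \<in> free_module V' n. \<forall>u. P (vcf u v)}"
    using w vcf_mult[OF A w(1)] mult_mat_vec_free[OF map_mat_poly_mat[OF A] w(1)] by simp
qed

lemma cf_scalar_prod:
  assumes a: "a \<in> free_module V n" and v: "v \<in> free_module V' n"
  shows "cf u (map_vec \<rho> a \<bullet> v) = a \<bullet> vcf u v"
proof -
  have "cf u (\<rho> (a $ j) * v $ j) = a $ j * cf u (v $ j)" if "j < n" for j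
    using free_moduleD(3)[OF a that] free_moduleD(3)[OF v that] by (rule cf_mult)
  then show ?thesis
    using free_moduleD(2)[OF a] free_moduleD(2)[OF v] by (simp add: scalar_prod_def vcf_def cf_sum)
qed

lemma scalar_prod_comb:
  assumes a: "a \<in> free_module V n" and w: "\<And>u. u \<in> T \<Longrightarrow> w u \<in> free_module V n"
  shows "map_vec \<rho> a \<bullet> comb n T w = (\<Sum>u\<in>T. b u * \<rho> (a \<bullet> w u))"
proof -
  have "map_vec \<rho> a \<bullet> comb n T w = (\<Sum>j<n. \<Sum>u\<in>T. \<rho> (a $ j) * (b u * \<rho> (w u $ j)))"
    using free_moduleD(2)[OF a] by (simp add: scalar_prod_def comb_def sum_distrib_left lessThan_atLeast0)
  also have "\<dots> = (\<Sum>u\<in>T. \<Sum>j<n. \<rho> (a $ j) * (b u * \<rho> (w u $ j)))"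
    by (rule sum.swap)
  also have "\<dots> = (\<Sum>u\<in>T. b u * \<rho> (a \<bullet> w u))"
  proof (rule sum.cong[OF refl])
    fix u assume u: "u \<in> T"
    have "a \<bullet> w u = (\<Sum>j<n. a $ j * w u $ j)"
      using free_moduleD(2)[OF w[OF u]] by (simp add: scalar_prod_def lessThan_atLeast0)
    moreover have "\<rho> (a $ j * w u $ j) = \<rho> (a $ j) * \<rho> (w u $ j)" if "j < n" for j
      using free_moduleD(3)[OF a that] free_moduleD(3)[OF w[OF u] that] by (rule \<rho>_mult)
    ultimately show "(\<Sum>j<n. \<rho> (a $ j) * (b u * \<rho> (w u $ j))) = b u * \<rho> (a \<bullet> w u)"
      by (simp add: \<rho>_sum sum_distrib_left mult_ac)
  qed
  finally show ?thesis .
qed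

lemma ext_ideal:
  assumes "graded_ideal V I"
  shows "0 \<in> ext I" "f \<in> ext I \<Longrightarrow> g \<in> ext I \<Longrightarrow> f + g \<in> ext I"
    and "b u \<in> polys V' \<Longrightarrow> h \<in> I \<Longrightarrow> b u * \<rho> h \<in> ext I"
proof -
  note hI = graded_idealD[OF assms]
  show "0 \<in> ext I" using hI(2) by (simp add: ext_def)
  show "f + g \<in> ext I" if "f \<in> ext I" "g \<in> ext I" using that hI(3) by (simp add: ext_def cf_add)
  show "b u * \<rho> h \<in> ext I" if "b u \<in> polys V'" "h \<in> I"
  proof -
    have h: "h \<in> polys V" using hI(1) that(2) by auto
    have "cf w (\<rho> h * b u) = h * cf w (b u)" for w using h that(1) by (rule cf_mult)
    moreover have "h * cf w (b u) \<in> I" for w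
      using hI(4)[OF that(2) cf_closed[OF that(1)]] by (simp add: mult.commute)
    ultimately show ?thesis using h that(1) by (simp add: ext_def mult.commute[of "b u"] \<rho>_closed)
  qed
qed

lemma ext_homogeneous:
  assumes I: "graded_ideal V I"
  shows "graded_ideal V' (ext I)"
proof -
  note hI = graded_idealD[OF I]
  have "q * f \<in> ext I" if f: "f \<in> ext I" and q: "q \<in> polys V'" for f q
  proof -
    have fp: "f \<in> polys V'" and cfI: "\<And>u. cf u f \<in> I" using f by (auto simp: ext_def)
    obtain T where T: "finite T" "\<forall>u. u \<notin> T \<longrightarrow> cf u f = 0" "f = (\<Sum>u\<in>T. b u * \<rho> (cf u f))"
      using expansion[OF fp] by blast
    \<comment> \<open>Regrouped as \<open>\<rho> (cf u f) * (q * b u)\<close>, the product has only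
      multiples of \<open>cf u f\<close> as coordinates.\<close>
    have "cf w (q * (b u * \<rho> (cf u f))) \<in> I" for u w
    proof (cases "cf u f = 0")
      case False
      then have "q * b u \<in> polys V'" using q b_closed[OF False fp] by simp
      then have "cf w (\<rho> (cf u f) * (q * b u)) = cf u f * cf w (q * b u)" "cf w (q * b u) \<in> polys V"
        using cf_mult[OF cf_closed[OF fp]] cf_closed by auto
      then have "cf w (q * (b u * \<rho> (cf u f))) = cf w (q * b u) * cf u f" by (simp add: mult_ac)
      also have "\<dots> \<in> I" using hI(4)[OF cfI] \<open>cf w (q * b u) \<in> polys V\<close> .
      finally show ?thesis .
    qed (simp add: hI(2))
    then have "(\<Sum>u\<in>T. cf w (q * (b u * \<rho> (cf u f)))) \<in> I" for w by (intro hI(8))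
    then have "cf w (q * (\<Sum>u\<in>T. b u * \<rho> (cf u f))) \<in> I" for w
      by (simp add: sum_distrib_left cf_sum)
    then show ?thesis using fp q T(3) by (simp add: ext_def)
  qed
  moreover have "hcomp n f \<in> ext I" if "f \<in> ext I" for f n
  proof -
    have "cf u (hcomp n f) \<in> I" for u
      using cf_hcomp[of f u n] that hI(5) by (auto simp: ext_def)
    then show ?thesis using that by (simp add: ext_def)
  qed
  ultimately show ?thesis
    using ext_ideal[OF I] unfolding graded_ideal_def by (auto simp: ext_def)
qed

text \<open>Base change along a free extension: exactness passes over coordinatewise, and minimality
  because \<open>\<rho>\<close> preserves degrees and constant terms. The degree lists
  \<open>s\<close> stay the same, hence so do the Betti numbers.\<close>

theorem ext_resolution:
  assumes I: "graded_ideal V I" and R: "min_graded_free_resolution V I a s D"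
  shows "min_graded_free_resolution V' (ext I) (map_vec \<rho> a) s (\<lambda>i. map_mat \<rho> (D i))"
  unfolding min_graded_free_resolution_iff
proof (intro conjI allI ballI impI)
  note r = resD[OF R] and hI = graded_idealD[OF I]
  note dp = gr_mat_poly_mat[OF r(3)]
  have lena: "dim_vec a = length (s 0)" using free_moduleD(2)[OF r(1)] .
  show "map_vec \<rho> a \<in> gr_free V' (s 0)"
    using r(1) by (auto simp: free_module_iff \<rho>_closed)
  fix k assume "k < length (s 0)"
  then show "homogeneous (s 0 ! k) (map_vec \<rho> a $ k)"
    using r(2) free_moduleD(3)[OF r(1)] lena by (auto intro!: \<rho>_homogeneous)
next
  note r = resD[OF R]
  fix i
  show "map_mat \<rho> (D i) \<in> gr_mat V' (s i) (s (Suc i))"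
    using r(3)[of i] by (auto simp: gr_mat_def poly_mat_def \<rho>_closed intro!: \<rho>_homogeneous)
  show "const_zero (map_mat \<rho> (D i))"
    using r(3)[of i] r(4)[of i] by (auto simp: gr_mat_def poly_mat_def const_zero_def \<rho>_const)
next
  note r = resD[OF R] and hI = graded_idealD[OF I]
  fix f :: "('w, 'k) mpoly" assume f: "f \<in> polys V'"
  have "\<forall>u. \<exists>v. v \<in> gr_free V (s 0) \<and> cf u f - a \<bullet> v \<in> I"
    using r(5)[OF cf_closed[OF f]] by blast
  then obtain v where v: "\<And>u. v u \<in> gr_free V (s 0)" "\<And>u. cf u f - a \<bullet> v u \<in> I" by metis
  define T where "T = {u. cf u f \<noteq> 0}"
  have T: "finite T" using expansion[OF f] unfolding T_def by (metis (mono_tags, lifting) finite_subset mem_Collect_eq subsetI)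
  have bT: "b u \<in> polys V'" if "u \<in> T" for u using that b_closed f by (auto simp: T_def)
  have "f - map_vec \<rho> a \<bullet> comb (length (s 0)) T v = (\<Sum>u\<in>T. b u * \<rho> (cf u f)) - (\<Sum>u\<in>T. b u * \<rho> (a \<bullet> v u))"
    using scalar_prod_comb[OF r(1), of T v] v(1) expansion_superset[OF f T] by (simp add: T_def)
  also have "\<dots> = (\<Sum>u\<in>T. b u * \<rho> (cf u f - a \<bullet> v u))"
    by (simp add: \<rho>_diff right_diff_distrib sum_subtractf)
  also have "\<dots> \<in> ext I"
    using T bT
    by (induction T rule: finite_induct) (auto intro!: ext_ideal[OF I] v(2))
  finally show "\<exists>v\<in>gr_free V' (s 0). f - map_vec \<rho> a \<bullet> v \<in> ext I"
    using comb_free[of T v "length (s 0)"] bT v(1) by blast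
next
  note r = resD[OF R] and hI = graded_idealD[OF I]
  note dp = gr_mat_poly_mat[OF r(3)]
  have ap: "map_vec \<rho> a \<in> gr_free V' (s 0)"
    using r(1) by (auto simp: free_module_iff \<rho>_closed)
  have "map_vec \<rho> a \<bullet> v \<in> ext I \<longleftrightarrow> (\<forall>u. a \<bullet> vcf u v \<in> I)" if v: "v \<in> gr_free V' (s 0)" for v
  proof -
    have "map_vec \<rho> a \<bullet> v \<in> polys V'"
      using free_moduleD[OF ap] free_moduleD[OF v] by (auto simp: scalar_prod_def intro!: polys_sum)
    then show ?thesis by (simp add: ext_def cf_scalar_prod[OF r(1) v])
  qed
  then have "{v \<in> gr_free V' (s 0). map_vec \<rho> a \<bullet> v \<in> ext I} =
      {v \<in> gr_free V' (s 0). \<forall>u. a \<bullet> vcf u v \<in> I}" by auto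
  also have "\<dots> = (*\<^sub>v) (map_mat \<rho> (D 0)) ` gr_free V' (s 1)"
    using exactness_transfer[OF dp[of 0], of "\<lambda>v. a \<bullet> v \<in> I"] r(6) by simp
  finally show "{v \<in> gr_free V' (s 0). map_vec \<rho> a \<bullet> v \<in> ext I} =
    (*\<^sub>v) (map_mat \<rho> (D 0)) ` gr_free V' (s 1)" .
  fix i
  have "map_mat \<rho> (D i) *\<^sub>v v = gr_zero (s i) \<longleftrightarrow> (\<forall>u. D i *\<^sub>v vcf u v = gr_zero (s i))"
    if v: "v \<in> gr_free V' (s (Suc i))" for v
  proof
    assume "map_mat \<rho> (D i) *\<^sub>v v = gr_zero (s i)"
    then show "\<forall>u. D i *\<^sub>v vcf u v = gr_zero (s i)"
      unfolding vcf_mult[OF dp v, symmetric] by (auto simp: vcf_def)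
  next
    assume *: "\<forall>u. D i *\<^sub>v vcf u v = gr_zero (s i)"
    have "map_mat \<rho> (D i) *\<^sub>v v \<in> gr_free V' (s i)"
      by (rule mult_mat_vec_free[OF map_mat_poly_mat[OF dp] v])
    then obtain T where "map_mat \<rho> (D i) *\<^sub>v v = comb (length (s i)) T (\<lambda>u. vcf u (map_mat \<rho> (D i) *\<^sub>v v))"
      using vcf_finite by blast
    then have "map_mat \<rho> (D i) *\<^sub>v v = comb (length (s i)) T (\<lambda>u. gr_zero (s i))"
      by (simp add: vcf_mult[OF dp v] *)
    also have "\<dots> = gr_zero (s i)" by (intro eq_vecI) (auto simp: comb_def)
    finally show "map_mat \<rho> (D i) *\<^sub>v v = gr_zero (s i)" .
  qed
  then have "{v \<in> gr_free V' (s (Suc i)). map_mat \<rho> (D i) *\<^sub>v v = gr_zero (s i)} =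
      {v \<in> gr_free V' (s (Suc i)). \<forall>u. D i *\<^sub>v vcf u v = gr_zero (s i)}" by auto
  also have "\<dots> = (*\<^sub>v) (map_mat \<rho> (D (Suc i))) ` gr_free V' (s (Suc (Suc i)))"
    using exactness_transfer[OF dp[of "Suc i"], of "\<lambda>v. D i *\<^sub>v v = gr_zero (s i)"] r(7) by simp
  finally show "{v \<in> gr_free V' (s (Suc i)). map_mat \<rho> (D i) *\<^sub>v v = gr_zero (s i)} =
    (*\<^sub>v) (map_mat \<rho> (D (Suc i))) ` gr_free V' (s (Suc (Suc i)))" .
qed

end

section \<open>Adding a nonzerodivisor\<close>

text \<open>In degree \<open>i\<close> the mapping cone of multiplication by \<open>b\<close> is \<open>F\<^sub>i \<oplus> F\<^bsub>i-1\<^esub>(-d)\<close>; its differential \<open>cD\<close> has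
  \<open>D i\<close> and \<open>E i\<close> on the diagonal, \<open>E\<close> being the shifted differential with \<open>F\<^bsub>-1\<^esub> = 0\<close>, and \<open>\<plusminus>b\<close> off
  the diagonal.\<close>

locale cone =
  fixes V :: "'v set" and I :: "('v, 'k::field) mpoly set" and b :: "('v, 'k) mpoly" and d :: nat
    and a s D
  assumes I: "graded_ideal V I"
    and R: "min_graded_free_resolution V I a s D"
    and b: "b \<in> polys V" "homogeneous (int d) b" "d \<ge> 1"
    and nonzerodivisor: "\<And>f. f \<in> polys V \<Longrightarrow> b * f \<in> I \<Longrightarrow> f \<in> I"
begin

definition J :: "('v, 'k) mpoly set" where
  "J = {f + b * g | f g. f \<in> I \<and> g \<in> polys V}"

lemma JI: "x = f + b * g \<Longrightarrow> f \<in> I \<Longrightarrow> g \<in> polys V \<Longrightarrow> x \<in> J"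
  by (auto simp: J_def)

definition shift :: "nat \<Rightarrow> int list" where
  "shift i = (case i of 0 \<Rightarrow> [] | Suc j \<Rightarrow> map (\<lambda>m. m + int d) (s j))"

definition cs :: "nat \<Rightarrow> int list" where
  "cs i = s i @ shift i"

definition E :: "nat \<Rightarrow> ('v, 'k) mpoly mat" where
  "E i = (case i of 0 \<Rightarrow> 0\<^sub>m 0 (length (s 0)) | Suc j \<Rightarrow> D j)"

text \<open>The alternating sign makes consecutive differentials of the cone compose to zero: the
  contributions of \<open>c (Suc i)\<close> and \<open>c i\<close> cancel.\<close>

definition c :: "nat \<Rightarrow> ('v, 'k) mpoly" where
  "c i = (- 1) ^ i * b"

definition cD :: "nat \<Rightarrow> ('v, 'k) mpoly mat" where
  "cD i = four_block_mat (D i) (c i \<cdot>\<^sub>m 1\<^sub>m (length (s i))) (0\<^sub>m (length (shift i)) (length (s (Suc i)))) (E i)"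

lemmas r = resD[OF R] and hI = graded_idealD[OF I]
lemmas dc = gr_mat_carrier[OF r(3)] and dp = gr_mat_poly_mat[OF r(3)]

lemma length_shift_Suc [simp]: "length (shift (Suc i)) = length (s i)"
  and length_cs: "length (cs i) = length (s i) + length (shift i)"
  by (simp_all add: shift_def cs_def)

lemma shift_0 [simp]: "shift 0 = []"
  by (simp add: shift_def)

lemma E_Suc [simp]: "E (Suc i) = D i"
  by (simp add: E_def)

lemma E_carrier: "E i \<in> carrier_mat (length (shift i)) (length (s i))"
  using dc by (cases i) (auto simp: E_def)

lemma c_Suc: "c (Suc i) = - c i"
  by (simp add: c_def)

lemma c_0 [simp]: "c 0 = b"
  by (simp add: c_def)

lemma c_closed: "c i \<in> polys V"
  using b(1) by (induction i) (simp_all add: c_Suc)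

lemma c_homogeneous: "homogeneous (int d) (c i)"
  using b(2) by (induction i) (simp_all add: c_Suc homogeneous_uminus)

text \<open>A nonzero constant term has degree 0, but \<open>c i\<close> is homogeneous of degree
  \<open>d \<ge> 1\<close>. Minimality of the cone rests on this.\<close>

lemma c_const: "lookup (c i) 0 = 0"
proof (rule ccontr)
  assume "lookup (c i) 0 \<noteq> 0"
  then have "0 \<in> keys (c i)" by (simp add: in_keys_iff)
  then show False using c_homogeneous[of i] b(3) by (auto simp: homogeneous_def)
qed

lemma cD_carrier: "cD i \<in> carrier_mat (length (cs i)) (length (cs (Suc i)))"
  using dc[of i] E_carrier[of i] unfolding cD_def length_cs by simp

lemma cD_index:
  assumes "k < length (cs i)" "l < length (cs (Suc i))"
  shows "cD i $$ (k, l) =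
    (if k < length (s i)
     then if l < length (s (Suc i)) then D i $$ (k, l) else if k = l - length (s (Suc i)) then c i else 0
     else if l < length (s (Suc i)) then 0 else E i $$ (k - length (s i), l - length (s (Suc i))))"
  using assms dc[of i] E_carrier[of i] unfolding cD_def length_cs by auto

lemma cs_nth:
  "k < length (cs i) \<Longrightarrow> cs i ! k = (if k < length (s i) then s i ! k else shift i ! (k - length (s i)))"
  by (simp add: cs_def nth_append)

lemma cD_entry:
  assumes kl: "k < length (cs i)" "l < length (cs (Suc i))"
  shows "cD i $$ (k, l) \<in> polys V \<and> homogeneous (cs (Suc i) ! l - cs i ! k) (cD i $$ (k, l)) \<and>
    lookup (cD i $$ (k, l)) 0 = 0"
proof -
  have De: "D j $$ (p, q) \<in> polys V \<and> homogeneous (s (Suc j) ! q - s j ! p) (D j $$ (p, q)) \<and>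
      lookup (D j $$ (p, q)) 0 = 0" if "p < length (s j)" "q < length (s (Suc j))" for j p q
    using gr_mat_idx[OF r(3)[of j] that] r(4)[of j] dc[of j] that by (auto simp: const_zero_def)
  have shift_nth: "shift (Suc j) ! q = s j ! q + int d" if "q < length (s j)" for j q
    using that by (simp add: shift_def)
  consider "k < length (s i)" "l < length (s (Suc i))" | "k < length (s i)" "l \<ge> length (s (Suc i))"
    | "k \<ge> length (s i)" "l < length (s (Suc i))" | "k \<ge> length (s i)" "l \<ge> length (s (Suc i))"
    by linarith
  then show ?thesis
  proof cases
    case 1
    then show ?thesis using De[OF 1] kl by (simp add: cD_index cs_nth)
  next
    case 2
    then show ?thesis
      using kl c_closed c_homogeneous c_const shift_nth[of k i]
      by (cases "k = l - length (s (Suc i))") (simp_all add: cD_index cs_nth)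
  next
    case 3
    then show ?thesis using kl by (simp add: cD_index)
  next
    case 4
    have "k - length (s i) < length (shift i)" using 4 kl by (simp add: length_cs)
    then obtain j where j: "i = Suc j" by (cases i) auto
    have lt: "k - length (s i) < length (s j)" "l - length (s (Suc i)) < length (s (Suc j))"
      using 4 kl by (simp_all add: length_cs j)
    then show ?thesis
      using De[OF lt] 4 kl shift_nth[of "k - length (s i)" j] shift_nth[of "l - length (s (Suc i))" i]
      by (simp add: cD_index cs_nth j)
  qed
qed

lemma cD_gr_mat: "cD i \<in> gr_mat V (cs i) (cs (Suc i))"
  using cD_entry cD_carrier by (simp add: gr_mat_def poly_mat_def)

lemma cD_const_zero: "const_zero (cD i)"
  using cD_entry[of _ i] cD_carrier[of i] by (auto simp: const_zero_def)

lemma cD_mult: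
  assumes "x \<in> carrier_vec (length (s (Suc i)))" "y \<in> carrier_vec (length (s i))"
  shows "cD i *\<^sub>v (x @\<^sub>v y) = (D i *\<^sub>v x + c i \<cdot>\<^sub>v y) @\<^sub>v (E i *\<^sub>v y)"
proof -
  have "(c i \<cdot>\<^sub>m 1\<^sub>m (length (s i))) *\<^sub>v y = c i \<cdot>\<^sub>v y"
    using assms(2) by (intro eq_vecI) auto
  moreover have "0\<^sub>m (length (shift i)) (length (s (Suc i))) *\<^sub>v x + E i *\<^sub>v y = E i *\<^sub>v y"
    using assms E_carrier[of i] by (intro eq_vecI) auto
  ultimately show ?thesis
    unfolding cD_def
    using four_block_mat_mult_vec[OF dc[of i] _ _ E_carrier[of i] assms,
        of "c i \<cdot>\<^sub>m 1\<^sub>m (length (s i))" "0\<^sub>m (length (shift i)) (length (s (Suc i)))"]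
    by simp
qed

lemma free_append:
  "x \<in> free_module V n \<Longrightarrow> y \<in> free_module V m \<Longrightarrow> x @\<^sub>v y \<in> free_module V (n + m)"
  by (auto simp: free_module_iff)

lemma free_split:
  assumes "v \<in> free_module V (n + m)"
  obtains x y where "x \<in> free_module V n" "y \<in> free_module V m" "v = x @\<^sub>v y"
proof
  show "vec_first v n \<in> free_module V n" "vec_last v m \<in> free_module V m"
    using assms by (auto simp: free_module_iff vec_first_def vec_last_def)
  show "v = vec_first v n @\<^sub>v vec_last v m"
    using vec_first_last_append[OF free_moduleD(1)[OF assms]] by simp
qed

lemma D_free: "v \<in> gr_free V (s (Suc i)) \<Longrightarrow> D i *\<^sub>v v \<in> gr_free V (s i)"
  by (rule mult_mat_vec_free[OF dp])

lemma scalar_prod_add_smult: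
  assumes "x \<in> gr_free V (s 0)" "y \<in> gr_free V (s 0)"
  shows "a \<bullet> (x + f \<cdot>\<^sub>v y) = a \<bullet> x + f * (a \<bullet> y)"
  using assms free_moduleD(1)[OF r(1)] by (simp add: scalar_prod_add_distrib[of _ "length (s 0)"] free_module_iff)

lemma scalar_prod_closed: "v \<in> gr_free V (s 0) \<Longrightarrow> a \<bullet> v \<in> polys V"
  using r(1) by (auto simp: scalar_prod_def free_module_iff intro!: polys_sum)

lemma D_add_smult:
  assumes "x \<in> gr_free V (s (Suc i))" "y \<in> gr_free V (s (Suc i))"
  shows "D i *\<^sub>v (x + f \<cdot>\<^sub>v y) = D i *\<^sub>v x + f \<cdot>\<^sub>v (D i *\<^sub>v y)"
  using assms mult_add_distrib_mat_vec[OF dc] mult_mat_smult_vec[OF dc] by (simp add: free_module_iff)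

lemma exact_0: "v \<in> gr_free V (s 0) \<Longrightarrow> a \<bullet> v \<in> I \<longleftrightarrow> v \<in> (*\<^sub>v) (D 0) ` gr_free V (s (Suc 0))"
  using r(6) by auto

lemma exact_Suc: "v \<in> gr_free V (s (Suc i)) \<Longrightarrow>
    D i *\<^sub>v v = gr_zero (s i) \<longleftrightarrow> v \<in> (*\<^sub>v) (D (Suc i)) ` gr_free V (s (Suc (Suc i)))"
  using r(7)[of i] by auto

text \<open>Modulo \<open>I\<close> the factor of \<open>b\<close> in an element of \<open>J\<close>
  is some \<open>a \<bullet> w\<close>; so \<open>v\<close> minus \<open>b\<close> times
  \<open>w\<close> is sent into \<open>I\<close> by the augmentation and lies in the image of
  \<open>D 0\<close>.\<close>

lemma J_mem_iff:
  assumes v: "v \<in> gr_free V (s 0)"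
  shows "a \<bullet> v \<in> J \<longleftrightarrow> (\<exists>x\<in>gr_free V (s 1). \<exists>y\<in>gr_free V (s 0). v = D 0 *\<^sub>v x + b \<cdot>\<^sub>v y)"
proof
  assume "a \<bullet> v \<in> J"
  then obtain f g where fg: "a \<bullet> v = f + b * g" "f \<in> I" "g \<in> polys V" by (auto simp: J_def)
  obtain w where w: "w \<in> gr_free V (s 0)" "g - a \<bullet> w \<in> I" using r(5)[OF fg(3)] by blast
  have "a \<bullet> (v + (- b) \<cdot>\<^sub>v w) = f + b * (g - a \<bullet> w)"
    using scalar_prod_add_smult[OF v w(1)] fg(1) by (simp add: right_diff_distrib)
  also have "\<dots> \<in> I" using fg(2) w(2) b(1) hI(3,4) by simp
  finally obtain x where x: "x \<in> gr_free V (s (Suc 0))" "v + (- b) \<cdot>\<^sub>v w = D 0 *\<^sub>v x"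
    using exact_0[of "v + (- b) \<cdot>\<^sub>v w"] v w(1) b(1) by auto
  have "v = (v + (- b) \<cdot>\<^sub>v w) + b \<cdot>\<^sub>v w"
    using free_moduleD[OF v] free_moduleD[OF w(1)] by (intro eq_vecI) auto
  then show "\<exists>x\<in>gr_free V (s 1). \<exists>y\<in>gr_free V (s 0). v = D 0 *\<^sub>v x + b \<cdot>\<^sub>v y"
    using x w(1) by auto
next
  assume "\<exists>x\<in>gr_free V (s 1). \<exists>y\<in>gr_free V (s 0). v = D 0 *\<^sub>v x + b \<cdot>\<^sub>v y"
  then obtain x y where x: "x \<in> gr_free V (s (Suc 0))" and y: "y \<in> gr_free V (s 0)"
    and v: "v = D 0 *\<^sub>v x + b \<cdot>\<^sub>v y" by auto
  have "a \<bullet> v = a \<bullet> (D 0 *\<^sub>v x) + b * (a \<bullet> y)"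
    unfolding v by (rule scalar_prod_add_smult[OF D_free[OF x] y])
  moreover have "a \<bullet> (D 0 *\<^sub>v x) \<in> I" using exact_0[OF D_free[OF x]] x by blast
  ultimately show "a \<bullet> v \<in> J" using scalar_prod_closed[OF y] by (auto simp: J_def)
qed

lemma append_empty: "y \<in> carrier_vec 0 \<Longrightarrow> x @\<^sub>v y = x"
  by (intro eq_vecI) auto

lemma cone_exact_0:
  "{v \<in> gr_free V (cs 0). a \<bullet> v \<in> J} = (*\<^sub>v) (cD 0) ` gr_free V (cs 1)"
proof (intro equalityI subsetI)
  fix v assume "v \<in> {v \<in> gr_free V (cs 0). a \<bullet> v \<in> J}"
  then have "v \<in> gr_free V (s 0)" "a \<bullet> v \<in> J" by (auto simp: length_cs)
  then obtain x y where x: "x \<in> gr_free V (s (Suc 0))" and y: "y \<in> gr_free V (s 0)"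
    and v: "v = D 0 *\<^sub>v x + b \<cdot>\<^sub>v y" using J_mem_iff by auto
  have "E 0 *\<^sub>v y \<in> carrier_vec 0" by (rule carrier_vecI) (simp add: E_def)
  then have "cD 0 *\<^sub>v (x @\<^sub>v y) = v"
    using cD_mult[OF free_moduleD(1)[OF x] free_moduleD(1)[OF y]] by (simp add: append_empty v)
  then show "v \<in> (*\<^sub>v) (cD 0) ` gr_free V (cs 1)"
    using free_append[OF x y] by (intro image_eqI[of _ _ "x @\<^sub>v y"]) (simp_all add: length_cs)
next
  fix v assume "v \<in> (*\<^sub>v) (cD 0) ` gr_free V (cs 1)"
  then obtain w where w: "w \<in> free_module V (length (s (Suc 0)) + length (s 0))" "v = cD 0 *\<^sub>v w"
    by (auto simp: length_cs)
  obtain x y where x: "x \<in> gr_free V (s (Suc 0))" and y: "y \<in> gr_free V (s 0)"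
    and "w = x @\<^sub>v y" using free_split[OF w(1)] by metis
  moreover have "E 0 *\<^sub>v y \<in> carrier_vec 0" by (rule carrier_vecI) (simp add: E_def)
  ultimately have v: "v = D 0 *\<^sub>v x + b \<cdot>\<^sub>v y"
    using cD_mult[OF free_moduleD(1)[OF x] free_moduleD(1)[OF y]] w(2) by (simp add: append_empty)
  have "v \<in> gr_free V (s 0)" unfolding v using D_free[OF x] y b(1) by simp
  then show "v \<in> {v \<in> gr_free V (cs 0). a \<bullet> v \<in> J}"
    using J_mem_iff[of v] x y v by (auto simp: length_cs)
qed

lemma append_zero: "0\<^sub>v n @\<^sub>v 0\<^sub>v m = 0\<^sub>v (n + m)"
  by (intro eq_vecI) auto

lemma E_D:
  assumes "z \<in> gr_free V (s (Suc i))"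
  shows "E i *\<^sub>v (D i *\<^sub>v z) = gr_zero (shift i)"
proof (cases i)
  case 0
  then show ?thesis by (intro eq_vecI) (simp_all add: E_def)
next
  case (Suc j)
  then show ?thesis using res_complex[OF R, of z j] assms by simp
qed

lemma cone_exact_Suc:
  "{v \<in> gr_free V (cs (Suc i)). cD i *\<^sub>v v = gr_zero (cs i)} =
    (*\<^sub>v) (cD (Suc i)) ` gr_free V (cs (Suc (Suc i)))"
proof (intro equalityI subsetI)
  fix v assume "v \<in> {v \<in> gr_free V (cs (Suc i)). cD i *\<^sub>v v = gr_zero (cs i)}"
  then have v: "v \<in> free_module V (length (s (Suc i)) + length (s i))" "cD i *\<^sub>v v = gr_zero (cs i)"
    by (auto simp: length_cs)
  obtain x y where x: "x \<in> gr_free V (s (Suc i))" and y: "y \<in> gr_free V (s i)"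
    and vxy: "v = x @\<^sub>v y" using free_split[OF v(1)] by metis
  have Dx: "D i *\<^sub>v x + c i \<cdot>\<^sub>v y \<in> carrier_vec (length (s i))"
    using free_moduleD(1)[OF D_free[OF x]] free_moduleD(1)[OF y] by simp
  have "(D i *\<^sub>v x + c i \<cdot>\<^sub>v y) @\<^sub>v (E i *\<^sub>v y) = gr_zero (s i) @\<^sub>v gr_zero (shift i)"
    using cD_mult[OF free_moduleD(1)[OF x] free_moduleD(1)[OF y]] v(2) vxy by (simp add: append_zero length_cs)
  then have eq: "D i *\<^sub>v x + c i \<cdot>\<^sub>v y = gr_zero (s i)" "E i *\<^sub>v y = gr_zero (shift i)"
    using append_vec_eq[OF Dx, of "gr_zero (s i)"] by simp_all
  \<comment> \<open>In positive degree \<open>y\<close> is a cycle, hence a boundary. In degree 0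
    the first equation puts \<open>b * (a \<bullet> y)\<close> into \<open>I\<close>, and this is
    where \<open>b\<close> being a nonzerodivisor enters.\<close>
  have "y \<in> (*\<^sub>v) (D i) ` gr_free V (s (Suc i))"
  proof (cases i)
    case 0
    have "0 = a \<bullet> (D 0 *\<^sub>v x + b \<cdot>\<^sub>v y)"
      using eq(1) free_moduleD(1)[OF r(1)] by (simp add: 0)
    also have "\<dots> = a \<bullet> (D 0 *\<^sub>v x) + b * (a \<bullet> y)"
      using D_free[OF x] y by (intro scalar_prod_add_smult) (simp_all add: 0)
    finally have "b * (a \<bullet> y) = - (a \<bullet> (D 0 *\<^sub>v x))" by (simp add: eq_neg_iff_add_eq_0 add.commute)
    moreover have "a \<bullet> (D 0 *\<^sub>v x) \<in> I" using exact_0[of "D 0 *\<^sub>v x"] D_free[OF x] x by (auto simp: 0)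
    ultimately have "b * (a \<bullet> y) \<in> I" using hI(6) by simp
    then have "a \<bullet> y \<in> I" using nonzerodivisor[OF scalar_prod_closed] y by (simp add: 0)
    then show ?thesis using exact_0[of y] y by (simp add: 0)
  next
    case (Suc j)
    then show ?thesis using exact_Suc[of y j] y eq(2) by simp
  qed
  then obtain z where z: "z \<in> gr_free V (s (Suc i))" "y = D i *\<^sub>v z" by blast
  \<comment> \<open>Since \<open>y\<close> is the boundary of \<open>z\<close>, the first equation
    says that \<open>x\<close>, corrected by a multiple of \<open>z\<close>, is a cycle.\<close>
  have "D i *\<^sub>v (x + c i \<cdot>\<^sub>v z) = gr_zero (s i)"
    using D_add_smult[OF x z(1)] eq(1) z(2) by simp
  moreover have "x + c i \<cdot>\<^sub>v z \<in> gr_free V (s (Suc i))" using x z(1) c_closed by simp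
  ultimately obtain t where t: "t \<in> gr_free V (s (Suc (Suc i)))" "x + c i \<cdot>\<^sub>v z = D (Suc i) *\<^sub>v t"
    using exact_Suc by blast
  have "x = (x + c i \<cdot>\<^sub>v z) + c (Suc i) \<cdot>\<^sub>v z"
    using free_moduleD[OF x] free_moduleD[OF z(1)] by (intro eq_vecI) (auto simp: c_Suc)
  then have "cD (Suc i) *\<^sub>v (t @\<^sub>v z) = v"
    using cD_mult[OF free_moduleD(1)[OF t(1)] free_moduleD(1)[OF z(1)]] by (simp add: vxy z(2) t(2))
  then show "v \<in> (*\<^sub>v) (cD (Suc i)) ` gr_free V (cs (Suc (Suc i)))"
    using free_append[OF t(1) z(1)] by (intro image_eqI[of _ _ "t @\<^sub>v z"]) (simp_all add: length_cs)
next
  fix v assume "v \<in> (*\<^sub>v) (cD (Suc i)) ` gr_free V (cs (Suc (Suc i)))"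
  then obtain w where w: "w \<in> free_module V (length (s (Suc (Suc i))) + length (s (Suc i)))" "v = cD (Suc i) *\<^sub>v w"
    by (auto simp: length_cs)
  obtain t z where t: "t \<in> gr_free V (s (Suc (Suc i)))" and z: "z \<in> gr_free V (s (Suc i))"
    and "w = t @\<^sub>v z" using free_split[OF w(1)] by metis
  then have v: "v = (D (Suc i) *\<^sub>v t + c (Suc i) \<cdot>\<^sub>v z) @\<^sub>v (D i *\<^sub>v z)"
    using cD_mult[OF free_moduleD(1)[OF t] free_moduleD(1)[OF z]] w(2) by simp
  let ?x = "D (Suc i) *\<^sub>v t + c (Suc i) \<cdot>\<^sub>v z"
  have x: "?x \<in> gr_free V (s (Suc i))" using D_free[OF t] z c_closed by simp
  have "D i *\<^sub>v ?x + c i \<cdot>\<^sub>v (D i *\<^sub>v z) = gr_zero (s i)"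
    using D_add_smult[OF D_free[OF t] z] res_complex[OF R t] free_moduleD[OF D_free[OF z]]
    by (intro eq_vecI) (auto simp: c_Suc)
  then have "cD i *\<^sub>v v = gr_zero (cs i)"
    using cD_mult[OF free_moduleD(1)[OF x] free_moduleD(1)[OF D_free[OF z]]] E_D[OF z]
    by (simp add: v append_zero length_cs)
  moreover have "v \<in> gr_free V (cs (Suc i))"
    using free_append[OF x D_free[OF z]] by (simp add: v length_cs)
  ultimately show "v \<in> {v \<in> gr_free V (cs (Suc i)). cD i *\<^sub>v v = gr_zero (cs i)}" by simp
qed

theorem cone_resolution: "min_graded_free_resolution V J a cs cD"
  unfolding min_graded_free_resolution_iff
proof (intro conjI allI ballI)
  have cs0: "cs 0 = s 0" by (simp add: cs_def)
  show "a \<in> gr_free V (cs 0)" "k < length (cs 0) \<longrightarrow> homogeneous (cs 0 ! k) (a $ k)" for k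
    using r(1,2) by (simp_all add: cs0)
  fix f :: "('v, 'k) mpoly" assume "f \<in> polys V"
  then obtain v where v: "v \<in> gr_free V (s 0)" "f - a \<bullet> v \<in> I" using r(5) by blast
  then have "f - a \<bullet> v \<in> J" by (intro JI[of _ "f - a \<bullet> v" 0]) simp_all
  then show "\<exists>v\<in>gr_free V (cs 0). f - a \<bullet> v \<in> J" using v(1) by (auto simp: cs0)
qed (use cD_gr_mat cD_const_zero cone_exact_0 cone_exact_Suc in \<open>simp_all\<close>)

lemma J_homogeneous: "graded_ideal V J"
  unfolding graded_ideal_def
proof (intro conjI ballI allI)
  show "J \<subseteq> polys V" using hI(1) b(1) by (auto simp: J_def)
  show "0 \<in> J" by (rule JI[of _ 0 0]) (use hI(2) in simp_all)
  fix f assume "f \<in> J"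
  then obtain p q where f: "f = p + b * q" "p \<in> I" "q \<in> polys V" by (auto simp: J_def)
  show "f + g \<in> J" if g: "g \<in> J" for g
  proof -
    obtain p' q' where g: "g = p' + b * q'" "p' \<in> I" "q' \<in> polys V" using g by (auto simp: J_def)
    show ?thesis
      by (rule JI[of _ "p + p'" "q + q'"]) (use f g hI(3) in \<open>simp_all add: algebra_simps\<close>)
  qed
  show "e * f \<in> J" if "e \<in> polys V" for e
    by (rule JI[of _ "e * p" "e * q"]) (use f that hI(4)[of p e] in \<open>simp_all add: algebra_simps\<close>)
  show "hcomp n f \<in> J" for n
    by (rule JI[of _ "hcomp n p" "hcomp (n - int d) q"])
       (use f hI(5) hcomp_mult[OF b(2), of "n - int d" q] in \<open>simp_all add: hcomp_add\<close>)
qed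

lemma count_shift: "count_list (shift (Suc i)) j = count_list (s i) (j - int d)"
proof -
  have "count_list (map (\<lambda>m. m + int d) xs) j = count_list xs (j - int d)" for xs
    by (induction xs) auto
  then show ?thesis by (simp add: shift_def)
qed

text \<open>A generator of degree \<open>j\<close> in step \<open>i\<close> reappears in step
  \<open>i + 1\<close> with degree \<open>j + d\<close>. So every value \<open>j - i\<close> also
  occurs increased by \<open>d - 1\<close>, which is nonnegative and therefore decides the
  supremum.\<close>

theorem cone_regularity: "reg_quotient V J = reg_quotient V I + ereal (real (d - 1))"
proof -
  define A where "A = {ereal (real_of_int (j - int i)) | i j. count_list (s i) j \<noteq> 0}"
  let ?c = "ereal (real (d - 1))"
  have RI: "reg_quotient V I = Sup A"
    unfolding reg_quotient_def graded_betti_eq[OF I R] A_def ..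
  have "reg_quotient V J = Sup {ereal (real_of_int (j - int i)) | i j. count_list (cs i) j \<noteq> 0}"
    unfolding reg_quotient_def graded_betti_eq[OF J_homogeneous cone_resolution] ..
  also have "{ereal (real_of_int (j - int i)) | i j. count_list (cs i) j \<noteq> 0} = A \<union> (\<lambda>x. x + ?c) ` A"
  proof (intro equalityI subsetI)
    fix x assume "x \<in> {ereal (real_of_int (j - int i)) | i j. count_list (cs i) j \<noteq> 0}"
    then obtain i j where x: "x = ereal (real_of_int (j - int i))" and "count_list (cs i) j \<noteq> 0" by blast
    then consider "count_list (s i) j \<noteq> 0" | "count_list (shift i) j \<noteq> 0" by (auto simp: cs_def)
    then show "x \<in> A \<union> (\<lambda>x. x + ?c) ` A"
    proof cases
      case 1
      then show ?thesis using x unfolding A_def by blast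
    next
      case 2
      then obtain k where k: "i = Suc k" by (cases i) auto
      then have "count_list (s k) (j - int d) \<noteq> 0" using 2 count_shift by simp
      then have "ereal (real_of_int ((j - int d) - int k)) \<in> A" unfolding A_def by blast
      moreover have "x = ereal (real_of_int ((j - int d) - int k)) + ?c"
        using b(3) by (simp add: x k of_nat_diff)
      ultimately show ?thesis by blast
    qed
  next
    fix x assume "x \<in> A \<union> (\<lambda>x. x + ?c) ` A"
    then show "x \<in> {ereal (real_of_int (j - int i)) | i j. count_list (cs i) j \<noteq> 0}"
    proof
      assume "x \<in> A"
      then obtain i j where x: "x = ereal (real_of_int (j - int i))" and "count_list (s i) j \<noteq> 0"
        by (auto simp: A_def)
      then have "count_list (cs i) j \<noteq> 0" by (simp add: cs_def)
      then show ?thesis using x by blast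
    next
      assume "x \<in> (\<lambda>x. x + ?c) ` A"
      then obtain i j where x: "x = ereal (real_of_int (j - int i)) + ?c" and "count_list (s i) j \<noteq> 0"
        by (auto simp: A_def)
      then have "count_list (cs (Suc i)) (j + int d) \<noteq> 0" using count_shift[of i "j + int d"] by (simp add: cs_def)
      moreover have "x = ereal (real_of_int ((j + int d) - int (Suc i)))"
        using b(3) by (simp add: x of_nat_diff)
      ultimately show ?thesis by blast
    qed
  qed
  also have "Sup (A \<union> (\<lambda>x. x + ?c) ` A) = Sup A + ?c"
  \<comment> \<open>Without any generators the supremum is \<open>-\<infinity>\<close>, which
    absorbs the summand.\<close>
  proof (cases "A = {}")
    case True
    then show ?thesis by (simp add: bot_ereal_def)
  next
    case False
    have "Sup ((\<lambda>x. x + ?c) ` A) = Sup A + ?c"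
      using SUP_ereal_add_left[OF False, of ?c "\<lambda>x. x"] by simp
    moreover have "Sup A \<le> Sup A + ?c" by (simp add: ereal_le_add_self)
    ultimately show ?thesis by (simp add: Sup_union_distrib sup_absorb2)
  qed
  finally show ?thesis by (simp add: RI)
qed

end

section \<open>Gluing a cycle to a graph\<close>

text \<open>The exponents of the image of a monomial under the toric map: each edge passes its
  exponent on to its endpoints. Summing over a fixed edge set makes the map visibly
  additive.\<close>

definition tmon :: "'v set set \<Rightarrow> ('v set \<Rightarrow>\<^sub>0 nat) \<Rightarrow> ('v \<Rightarrow>\<^sub>0 nat)" where
  "tmon E m = (\<Sum>e\<in>E. \<Sum>x\<in>e. single x (lookup m e))"

lemma tmon_add: "tmon E (m + n) = tmon E m + tmon E n"
  by (simp add: tmon_def lookup_add single_add sum.distrib)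

lemma prod_single: "(\<Prod>x\<in>A. single (f x) (1::'k::field)) = single (\<Sum>x\<in>A. f x) 1"
  for f :: "'a \<Rightarrow> 'w \<Rightarrow>\<^sub>0 nat"
  by (induction A rule: infinite_finite_induct) (auto simp: mult_single)

lemma Var_power: "(Var x :: ('v, 'k::field) mpoly) ^ n = single (single x n) 1"
  by (induction n) (auto simp: Var_def mult_single simp flip: single_add)

lemma subst_toric:
  fixes p :: "('v set, 'k::field) mpoly"
  assumes "finite E" "p \<in> polys E"
  shows "subst (\<lambda>e. \<Prod>x\<in>e. Var x) p = mon_hom (tmon E) p"
  unfolding subst_def monmap_def
proof (rule sum.cong[OF refl])
  fix m assume "m \<in> keys p"
  then have m: "keys m \<subseteq> E" using assms(2) by (auto simp: polys_iff)
  have "(\<Prod>e\<in>keys m. (\<Prod>x\<in>e. Var x :: ('v, 'k) mpoly) ^ lookup m e) =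
      single (\<Sum>e\<in>keys m. \<Sum>x\<in>e. single x (lookup m e)) 1"
    by (simp add: prod_power_distrib Var_power prod_single)
  also have "(\<Sum>e\<in>keys m. \<Sum>x\<in>e. single x (lookup m e)) = tmon E m"
    unfolding tmon_def using assms(1) m by (intro sum.mono_neutral_left) (auto simp: in_keys_iff)
  finally show "Cst (lookup p m) *
      (\<Prod>e\<in>keys m. (\<Prod>x\<in>e. Var x :: ('v, 'k) mpoly) ^ lookup m e) =
      (if True then single (tmon E m) (lookup p m) else 0)"
    by (simp add: Cst_def mult_single)
qed

lemma toric_ideal_eq:
  assumes "finite (edges G)"
  shows "toric_ideal G = {p \<in> polys (edges G). mon_hom (tmon (edges G)) p = 0}"
  unfolding toric_ideal_def a_kernel_def kernel_def by (auto simp: subst_toric[OF assms])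

text \<open>Every edge has two endpoints, so the toric map doubles degrees and respects the
  gradings.\<close>

lemma mdeg_tmon:
  fixes m :: "'v set \<Rightarrow>\<^sub>0 nat"
  assumes "finite E" "\<forall>e\<in>E. card e = 2" "keys m \<subseteq> E"
  shows "mdeg (tmon E m) = 2 * mdeg m"
proof -
  have "mdeg (tmon E m) = (\<Sum>e\<in>E. card e * lookup m e)"
    by (simp add: tmon_def mdeg_sum)
  also have "\<dots> = 2 * mdeg m"
    using assms by (simp add: mdeg_superset[of E] sum_distrib_left)
  finally show ?thesis .
qed

text \<open>As degrees double, a component of \<open>f\<close> maps to the component of twice that
  degree of the image, and the monomial 1 is the only one with image 1. Hence components of a kernel
  element are again in the kernel, and its constant term is that of its image.\<close>

lemma
  fixes G :: "'v graph"
  assumes G: "finite_simple_graph G"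
  shows toric_homogeneous: "graded_ideal (edges G) (toric_ideal G :: ('v set, 'k::field) mpoly set)"
    and toric_const: "f \<in> (toric_ideal G :: ('v set, 'k) mpoly set) \<Longrightarrow> lookup f 0 = 0"
proof -
  have fin: "finite (edges G)"
    using G by (auto simp: finite_simple_graph_def intro: finite_subset[of _ "Pow (verts G)"])
  have c2: "\<forall>e\<in>edges G. card e = 2" using G by (auto simp: finite_simple_graph_def)
  let ?E = "edges G" and ?t = "mon_hom (tmon (edges G)) :: ('v set, 'k) mpoly \<Rightarrow> ('v, 'k) mpoly"
  have deg: "mdeg (tmon ?E m) = 2 * mdeg m" if "p \<in> polys ?E" "m \<in> keys p" for p :: "('v set, 'k) mpoly" and m
    using mdeg_tmon[OF fin c2] that by (auto simp: polys_iff)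
  have mult: "?t (p * q) = ?t p * ?t q" for p q
    by (rule monmap_mult) (simp add: tmon_add)
  show "graded_ideal ?E (toric_ideal G :: ('v set, 'k) mpoly set)"
    unfolding graded_ideal_def toric_ideal_eq[OF fin]
  proof (intro conjI ballI allI)
    fix f :: "('v set, 'k) mpoly" and n
    assume f: "f \<in> {p \<in> polys ?E. ?t p = 0}"
    have "?t (hcomp n f) = monmap (\<lambda>m. int (mdeg m) = n) (tmon ?E) f"
      by (simp add: hcomp_def monmap_comp)
    also have "\<dots> = monmap (\<lambda>m. int (mdeg (tmon ?E m)) = 2 * n) (tmon ?E) f"
      using f by (intro monmap_cong) (auto simp: deg)
    also have "\<dots> = hcomp (2 * n) (?t f)" by (simp add: hcomp_def monmap_comp)
    also have "\<dots> = 0" using f by (simp add: hcomp_def)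
    finally show "hcomp n f \<in> {p \<in> polys ?E. ?t p = 0}" using f by simp
  qed (auto simp: monmap_add mult)
  show "lookup f 0 = 0" if "f \<in> (toric_ideal G :: ('v set, 'k) mpoly set)"
  proof -
    have f: "f \<in> polys ?E" "?t f = 0" using that by (auto simp: toric_ideal_eq[OF fin])
    have "tmon ?E m = 0 \<longleftrightarrow> m = 0" if "m \<in> keys f" for m
      using deg[OF f(1) that] by (metis mdeg_eq_0 mult_eq_0_iff zero_neq_numeral)
    then have "monmap (\<lambda>m. m = 0) (\<lambda>_. 0) f = monmap (\<lambda>m. tmon ?E m = 0) (tmon ?E) f"
      by (intro monmap_cong) auto
    also have "\<dots> = monmap (\<lambda>m. m = 0) (\<lambda>m. m) (?t f)" by (simp add: monmap_comp)
    also have "\<dots> = 0" by (simp add: f(2))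
    finally have "monmap (\<lambda>m. m = 0) (\<lambda>_. 0 :: 'v \<Rightarrow>\<^sub>0 nat) f = 0" .
    moreover have "monmap (\<lambda>m. m = 0) (\<lambda>_. 0 :: 'v \<Rightarrow>\<^sub>0 nat) f = single 0 (lookup f 0)"
      by (simp add: monmap_def in_keys_iff)
    ultimately show ?thesis by (metis lookup_single_eq lookup_zero)
  qed
qed

text \<open>The vertices of the cycle are numbered so that the glued edge joins \<open>p 0\<close>
  and \<open>p 1\<close>; the new vertices are then \<open>p k\<close> with
  \<open>2 \<le> k < 2 * d\<close>, and the new edges run from \<open>p 1\<close> around to
  \<open>p 0\<close>.\<close>

locale graph_gluing =
  fixes G :: "'v graph" and e :: "'v set" and d :: nat and H :: "'w graph"
    and g :: "'v \<Rightarrow> 'w" and p :: "nat \<Rightarrow> 'w"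
  assumes G: "finite_simple_graph G" and e: "e \<in> edges G" and d: "d \<ge> 2"
    and inj_g: "inj_on g (verts G)" and inj_p: "inj_on p {..<2 * d}"
    and glue: "g ` e = {p 0, p 1}" "g ` verts G \<inter> p ` {..<2 * d} = {p 0, p 1}"
    and edges_H: "edges H = (`) g ` edges G \<union> (\<lambda>k. {p k, p (Suc k mod (2 * d))}) ` {..<2 * d}"
begin

definition t :: "nat \<Rightarrow> 'w set" where
  "t k = {p k, p (Suc k mod (2 * d))}"

definition U :: "'w set set" where
  "U = t ` {1..<2 * d}"

section \<open>Combinatorics of the glued graph\<close>

lemma edges_G: "x \<in> edges G \<Longrightarrow> x \<subseteq> verts G \<and> card x = 2 \<and> finite x"
  using G by (auto simp: finite_simple_graph_def intro: card_ge_0_finite)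

lemma finite_G: "finite (verts G)" "finite (edges G)"
  using G by (auto simp: finite_simple_graph_def intro: finite_subset[of _ "Pow (verts G)"])

lemma p_eq_iff: "i < 2 * d \<Longrightarrow> j < 2 * d \<Longrightarrow> p i = p j \<longleftrightarrow> i = j"
  using inj_p by (auto simp: inj_on_def)

lemma Suc_mod: "k < 2 * d \<Longrightarrow> Suc k mod (2 * d) = (if Suc k = 2 * d then 0 else Suc k)"
  using d by auto

lemma Suc_mod_less: "Suc k mod (2 * d) < 2 * d"
  using d by simp

lemma p_mem_t_iff: "i < 2 * d \<Longrightarrow> k < 2 * d \<Longrightarrow> p i \<in> t k \<longleftrightarrow> i = k \<or> i = Suc k mod (2 * d)"
  by (simp only: t_def insert_iff empty_iff p_eq_iff Suc_mod_less simp_thms)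

text \<open>If two different edges of the cycle had the same endpoints, then
  \<open>i = j + 1\<close> and \<open>j = i + 1\<close> modulo \<open>2 * d\<close>, which
  \<open>2 * d \<ge> 4\<close> excludes.\<close>

lemma t_inj: "i < 2 * d \<Longrightarrow> j < 2 * d \<Longrightarrow> t i = t j \<Longrightarrow> i = j"
proof (rule ccontr)
  assume ij: "i < 2 * d" "j < 2 * d" "t i = t j" "i \<noteq> j"
  have "p i \<in> t j" "p (Suc i mod (2 * d)) \<in> t j" using ij(3) by (auto simp: t_def)
  then show False
    using ij d p_mem_t_iff[of i j] p_mem_t_iff[of "Suc i mod (2 * d)" j] Suc_mod_less[of i]
    by (auto simp: Suc_mod split: if_splits)
qed

lemma p_notin_G: "2 \<le> k \<Longrightarrow> k < 2 * d \<Longrightarrow> p k \<notin> g ` verts G"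
proof
  assume k: "2 \<le> k" "k < 2 * d" "p k \<in> g ` verts G"
  then have "p k \<in> {p 0, p 1}" using glue(2) by blast
  then show False using k p_eq_iff[of k 0] p_eq_iff[of k 1] d by auto
qed

text \<open>Each of these edges has a new endpoint: \<open>p 2\<close> for \<open>t 1\<close>, and
  \<open>p k\<close> itself for \<open>k \<ge> 2\<close>, including the last edge, which closes up
  at the old vertex \<open>p 0\<close>.\<close>

lemma t_notin_G: "1 \<le> k \<Longrightarrow> k < 2 * d \<Longrightarrow> t k \<notin> (`) g ` edges G"
proof
  assume k: "1 \<le> k" "k < 2 * d" "t k \<in> (`) g ` edges G"
  then obtain x where "x \<in> edges G" "t k = g ` x" by blast
  then have sub: "t k \<subseteq> g ` verts G" using edges_G[of x] by blast
  show False
  proof (cases "k = 1")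
    case True
    then have "p 2 \<in> t k" using d by (simp add: t_def numeral_2_eq_2)
    then show False using p_notin_G[of 2] sub d by auto
  next
    case False
    then show False using p_notin_G[of k] sub k by (auto simp: t_def)
  qed
qed

lemma t_0: "t 0 = g ` e"
  using d by (simp add: t_def glue(1))

lemma t_0_in_G: "t 0 \<in> (`) g ` edges G"
  using e by (auto simp: t_0)

lemma V_eq: "edges H = (`) g ` edges G \<union> U"
proof -
  have "{..<2 * d} = insert 0 {1..<2 * d}" using d by auto
  then have "t ` {..<2 * d} = insert (t 0) U" by (simp add: U_def)
  then show ?thesis using t_0_in_G edges_H by (auto simp: t_def)
qed

lemma U_disjoint: "U \<inter> (`) g ` edges G = {}"
proof -
  have "t k \<notin> (`) g ` edges G" if "k \<in> {1..<2 * d}" for k using t_notin_G[of k] that by simp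
  then show ?thesis unfolding U_def by blast
qed

lemma finite_U: "finite U" "finite (edges H)"
  using finite_G by (simp_all add: V_eq) (simp_all add: U_def)

lemma t_in_H: "k < 2 * d \<Longrightarrow> t k \<in> edges H"
  using edges_H by (auto simp: t_def)

lemma inj_image: "inj_on ((`) g) (edges G)"
  using inj_g edges_G by (auto simp: inj_on_def inj_on_image_eq_iff[OF inj_g])

abbreviation "tG \<equiv> tmon (edges G)"
abbreviation "tH \<equiv> tmon (edges H)"

abbreviation "polysG \<equiv> polys (edges G)"
abbreviation "polysH \<equiv> polys (edges H)"

section \<open>Splitting a monomial of H into old and new edges\<close>

definition push :: "('v set \<Rightarrow>\<^sub>0 nat) \<Rightarrow> ('w set \<Rightarrow>\<^sub>0 nat)" where
  "push m = (\<Sum>x\<in>edges G. single (g ` x) (lookup m x))"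

definition pull :: "('w set \<Rightarrow>\<^sub>0 nat) \<Rightarrow> ('v set \<Rightarrow>\<^sub>0 nat)" where
  "pull n = (\<Sum>x\<in>edges G. single x (lookup n (g ` x)))"

text \<open>The new part stays in the ring of \<open>H\<close>, where it serves as the index of a
  basis element; the old part is carried back to \<open>G\<close> by \<open>pull\<close>.\<close>

definition restr :: "('w set \<Rightarrow>\<^sub>0 nat) \<Rightarrow> ('w set \<Rightarrow>\<^sub>0 nat)" where
  "restr n = (\<Sum>y\<in>U. single y (lookup n y))"

lemma push_add: "push (m + n) = push m + push n"
  and pull_add: "pull (u + v) = pull u + pull v"
  and restr_add: "restr (u + v) = restr u + restr v"
  by (simp_all add: push_def pull_def restr_def lookup_add single_add sum.distrib)

lemma lookup_restr: "lookup (restr n) y = (if y \<in> U then lookup n y else 0)"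
  using finite_U by (simp add: restr_def lookup_sum lookup_single when_def)

lemma lookup_pull: "lookup (pull n) x = (if x \<in> edges G then lookup n (g ` x) else 0)"
  using finite_G by (simp add: pull_def lookup_sum lookup_single when_def)

lemma lookup_push:
  "x \<in> edges G \<Longrightarrow> lookup (push m) (g ` x) = lookup m x"
  "y \<notin> (`) g ` edges G \<Longrightarrow> lookup (push m) y = 0"
proof -
  assume x: "x \<in> edges G"
  have "lookup (push m) (g ` x) = (\<Sum>z\<in>edges G. if z = x then lookup m x else 0)"
    unfolding push_def lookup_sum using inj_onD[OF inj_image _ _ x]
    by (intro sum.cong refl) (auto simp: lookup_single when_def)
  then show "lookup (push m) (g ` x) = lookup m x" using x finite_G by simp
next
  assume "y \<notin> (`) g ` edges G"
  then show "lookup (push m) y = 0"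
    by (auto simp: push_def lookup_sum lookup_single when_def intro!: sum.neutral)
qed

lemma keys_push: "keys (push m) \<subseteq> (`) g ` edges G"
  by (metis in_keys_iff lookup_push(2) subsetI)

lemma keys_pull: "keys (pull n) \<subseteq> edges G"
  by (auto simp: in_keys_iff lookup_pull split: if_splits)

lemma keys_restr: "keys (restr n) \<subseteq> U"
  by (auto simp: in_keys_iff lookup_restr split: if_splits)

lemma push_pull_restr: "keys n \<subseteq> edges H \<Longrightarrow> push (pull n) + restr n = n"
proof (rule poly_mapping_eqI)
  fix y assume n: "keys n \<subseteq> edges H"
  consider x where "x \<in> edges G" "y = g ` x" | "y \<in> U" | "y \<notin> edges H" using V_eq by auto
  then show "lookup (push (pull n) + restr n) y = lookup n y"
  proof cases
    case 1
    then have "y \<notin> U" using U_disjoint by auto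
    then show ?thesis using 1 by (simp add: lookup_add lookup_push(1) lookup_pull lookup_restr)
  next
    case 2
    then have "y \<notin> (`) g ` edges G" using U_disjoint by auto
    then show ?thesis using 2 by (simp add: lookup_add lookup_push(2) lookup_restr)
  next
    case 3
    then have "y \<notin> (`) g ` edges G" "y \<notin> U" "lookup n y = 0"
      using V_eq n by (auto simp: in_keys_iff)
    then show ?thesis by (simp add: lookup_add lookup_push(2) lookup_restr)
  qed
qed

lemma pull_push: "keys m \<subseteq> edges G \<Longrightarrow> pull (push m) = m"
  by (rule poly_mapping_eqI) (auto simp: lookup_pull lookup_push(1) in_keys_iff)

lemma restr_push [simp]: "restr (push m) = 0"
proof (rule poly_mapping_eqI)
  fix y show "lookup (restr (push m)) y = lookup 0 y"
    using U_disjoint lookup_push(2)[of y m] by (auto simp: lookup_restr)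
qed

lemma pull_new: "keys u \<subseteq> U \<Longrightarrow> pull u = 0"
proof (rule poly_mapping_eqI)
  fix x assume u: "keys u \<subseteq> U"
  have "lookup u (g ` x) = 0" if "x \<in> edges G"
  proof -
    have "g ` x \<notin> U" using U_disjoint that by blast
    then show ?thesis using u by (metis in_keys_iff subsetD)
  qed
  then show "lookup (pull u) x = lookup 0 x" by (simp add: lookup_pull)
qed

lemma restr_new: "keys u \<subseteq> U \<Longrightarrow> restr u = u"
  by (rule poly_mapping_eqI) (auto simp: lookup_restr in_keys_iff)

lemma restr_restr [simp]: "restr (restr n) = restr n"
  by (rule restr_new[OF keys_restr])

lemma mdeg_push: "keys m \<subseteq> edges G \<Longrightarrow> mdeg (push m) = mdeg m"
  using finite_G by (simp add: push_def mdeg_sum mdeg_superset[of "edges G"])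

lemma mdeg_split: "keys n \<subseteq> edges H \<Longrightarrow> mdeg n = mdeg (pull n) + mdeg (restr n)"
  using push_pull_restr[of n] mdeg_push[OF keys_pull[of n]] by (metis mdeg_add)

definition \<rho> :: "('v set, 'k::field) mpoly \<Rightarrow> ('w set, 'k) mpoly" where
  "\<rho> = mon_hom push"

text \<open>The coefficient of the monomial \<open>u\<close> when \<open>f\<close> is read as a
  polynomial in the new edges over \<open>K[E(G)]\<close>.\<close>

definition cf :: "('w set \<Rightarrow>\<^sub>0 nat) \<Rightarrow> ('w set, 'k::field) mpoly \<Rightarrow> ('v set, 'k) mpoly" where
  "cf u = monmap (\<lambda>n. restr n = u) pull"

lemma pull_0 [simp]: "pull 0 = 0" and push_0 [simp]: "push 0 = 0" and restr_0 [simp]: "restr 0 = 0"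
  by (simp_all add: pull_def push_def restr_def)

lemma cf_polys: "cf u f \<in> polysG"
  using keys_monmap[of "\<lambda>n. restr n = u" pull f] keys_pull unfolding cf_def polys_iff by blast

lemma monmap_expansion:
  fixes f :: "('w set, 'k::field) mpoly"
  assumes "f \<in> polysH"
  shows "f = (\<Sum>u\<in>restr ` keys f. single u 1 * \<rho> (cf u f))"
proof -
  let ?T = "restr ` keys f"
  \<comment> \<open>The index set \<open>?T\<close> is frozen, so both sides are additive in
    \<open>f\<close> and only single terms have to be compared.\<close>
  let ?B = "\<lambda>f. \<Sum>u\<in>?T. single u 1 * \<rho> (cf u f)"
  have add: "additive ?B"
    by standard (simp add: \<rho>_def cf_def monmap_add distrib_left sum.distrib)
  have add_id: "additive (\<lambda>f :: ('w set, 'k) mpoly. f)" by standard simp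
  show ?thesis
  proof (rule additive_eqI[OF add_id add, where p = f])
    fix m assume m: "m \<in> keys f"
    let ?c = "lookup f m"
    have "?B (single m ?c) = (\<Sum>u\<in>?T. if u = restr m then single (restr m + push (pull m)) ?c else 0)"
      by (intro sum.cong refl) (auto simp: \<rho>_def cf_def monmap_single mult_single)
    also have "\<dots> = single m ?c"
      using m assms push_pull_restr[of m] by (auto simp: polys_iff add.commute)
    finally show "single m ?c = ?B (single m ?c)" by simp
  qed
qed

text \<open>The monomials in the new edges form the basis. The index \<open>u\<close> runs over all
  monomials; one that involves an old edge is never of the form \<open>restr n\<close> and has
  coordinate 0. In \<open>cf_hcomp\<close> the degree drops by that of \<open>u\<close>.\<close>

sublocale free_extension "edges G" "edges H" "\<rho> :: ('v set, 'k::field) mpoly \<Rightarrow> _" cf "\<lambda>u. single u 1"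
proof
  fix p q :: "('v set, 'k) mpoly" and f f' :: "('w set, 'k) mpoly" and u n
  show "\<rho> (p + q) = \<rho> p + \<rho> q" by (simp add: \<rho>_def monmap_add)
  show "cf u (f + f') = cf u f + cf u f'" by (simp add: cf_def monmap_add)
  show "\<rho> (p * q) = \<rho> p * \<rho> q" unfolding \<rho>_def by (rule monmap_mult) (simp add: push_add)
  show "\<rho> p \<in> polysH"
    using keys_monmap[of "\<lambda>_. True" push p] keys_push V_eq unfolding \<rho>_def polys_iff by blast
  show "cf u f \<in> polysG" by (rule cf_polys)
  show "single u (1::'k) \<in> polysH" if "cf u f \<noteq> 0"
  proof -
    have "\<exists>n. restr n = u"
    proof (rule ccontr)
      assume "\<nexists>n. restr n = u"
      then have "cf u f = 0" by (simp add: cf_def monmap_def)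
      then show False using that by simp
    qed
    then show ?thesis using keys_restr V_eq by (intro polys_single) blast
  qed
  show "homogeneous n (\<rho> p)" if "p \<in> polysG" "homogeneous n p"
    using keys_monmap[of "\<lambda>_. True" push p] that unfolding homogeneous_def \<rho>_def polys_iff
    by (auto simp: mdeg_push)
  show "lookup (\<rho> p) 0 = lookup p 0" if "p \<in> polysG"
  proof -
    have "inj_on push {m. keys m \<subseteq> edges G}"
      by (rule inj_on_inverseI[of _ pull]) (simp add: pull_push)
    then show ?thesis
      using lookup_monmap[of push "{m. keys m \<subseteq> edges G}" p 0 "\<lambda>_. True"] that
      by (auto simp: \<rho>_def polys_iff)
  qed
  show "cf u (\<rho> p * f) = p * cf u f" if p: "p \<in> polysG"
  proof -
    have "restr k = 0" if "k \<in> keys (\<rho> p)" for k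
      using that keys_monmap[of "\<lambda>_. True" push p] by (auto simp: \<rho>_def)
    then have "cf u (\<rho> p * f) = mon_hom pull (\<rho> p) * cf u f"
      unfolding cf_def by (intro monmap_mult) (simp add: restr_add pull_add)
    also have "mon_hom pull (\<rho> p) = p"
      using p unfolding \<rho>_def monmap_comp by (intro monmap_id) (auto simp: pull_push polys_iff)
    finally show ?thesis .
  qed
  show "\<exists>m. cf u (hcomp n f) = hcomp m (cf u f)" if "f \<in> polysH"
  proof -
    have "cf u (hcomp n f) = monmap (\<lambda>k. int (mdeg k) = n \<and> restr k = u) pull f"
      by (simp add: cf_def hcomp_def monmap_comp)
    also have "\<dots> = monmap (\<lambda>k. restr k = u \<and> int (mdeg (pull k)) = n - int (mdeg u)) pull f"
      using that by (intro monmap_cong) (auto simp: polys_iff mdeg_split)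
    also have "\<dots> = hcomp (n - int (mdeg u)) (cf u f)"
      by (simp add: cf_def hcomp_def monmap_comp)
    finally show ?thesis by blast
  qed
  show "\<exists>T. finite T \<and> (\<forall>u. u \<notin> T \<longrightarrow> cf u f = 0) \<and> f = (\<Sum>u\<in>T. single u 1 * \<rho> (cf u f))"
    if f: "f \<in> polysH"
  proof (intro exI conjI allI impI)
    show "finite (restr ` keys f)" by simp
    show "cf u f = 0" if "u \<notin> restr ` keys f" for u
      using that by (auto simp: cf_def monmap_def intro!: sum.neutral)
    show "f = (\<Sum>u\<in>restr ` keys f. single u 1 * \<rho> (cf u f))"
      by (rule monmap_expansion[OF f])
  qed
qed

section \<open>The binomial of the cycle\<close>

definition odd_mon :: "'w set \<Rightarrow>\<^sub>0 nat" where
  "odd_mon = (\<Sum>k<d. single (t (2 * k + 1)) 1)"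

text \<open>Unlike the odd monomial it contains \<open>t 0\<close>, the glued edge, which is a
  variable of \<open>G\<close>; so \<open>odd_mon\<close> is the term to be rewritten.\<close>

definition even_mon :: "'w set \<Rightarrow>\<^sub>0 nat" where
  "even_mon = (\<Sum>k<d. single (t (2 * k)) 1)"

definition cycle_binomial :: "('w set, 'k::field) mpoly" where
  "cycle_binomial = single even_mon 1 - single odd_mon 1"

lemma keys_sum_single: "keys (\<Sum>k\<in>A. single (f k) (1::nat)) \<subseteq> f ` A"
  by (induction A rule: infinite_finite_induct) auto

lemma keys_odd: "keys odd_mon \<subseteq> U"
proof -
  have "t (2 * k + 1) \<in> U" if "k < d" for k
    using that by (auto simp: U_def)
  then show ?thesis unfolding odd_mon_def using keys_sum_single[of "\<lambda>k. t (2 * k + 1)" "{..<d}"] by auto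
qed

lemma keys_even: "keys even_mon \<subseteq> edges H"
  unfolding even_mon_def using keys_sum_single[of "\<lambda>k. t (2 * k)" "{..<d}"] t_in_H by auto

lemma lookup_odd:
  assumes "j < 2 * d"
  shows "lookup odd_mon (t j) = (if odd j then 1 else 0)"
proof -
  have "lookup odd_mon (t j) = (\<Sum>k<d. if k = j div 2 then (if odd j then 1 else 0) else 0)"
    unfolding odd_mon_def lookup_sum
  proof (rule sum.cong[OF refl])
    fix k assume "k \<in> {..<d}"
    then have "t (2 * k + 1) = t j \<longleftrightarrow> 2 * k + 1 = j" using t_inj[of "2 * k + 1" j] assms by auto
    moreover have "2 * k + 1 = j \<longleftrightarrow> k = j div 2 \<and> odd j" by presburger
    ultimately show "lookup (single (t (2 * k + 1)) 1) (t j) =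
      (if k = j div 2 then (if odd j then 1 else 0) else 0)"
      by (auto simp: lookup_single when_def)
  qed
  also have "j div 2 < d" using assms by linarith
  then have "(\<Sum>k<d. if k = j div 2 then (if odd j then 1 else 0) else 0) = (if odd j then 1 else (0::nat))" by simp
  finally show ?thesis .
qed

lemma lookup_even_1: "lookup even_mon (t 1) = 0"
proof -
  have "t (2 * k) \<noteq> t 1" if "k < d" for k
    using t_inj[of "2 * k" 1] that by auto
  then show ?thesis by (auto simp: even_mon_def lookup_sum lookup_single when_def)
qed

lemma binomial_polys: "(cycle_binomial :: ('w set, 'k::field) mpoly) \<in> polysH"
  unfolding cycle_binomial_def using keys_odd keys_even V_eq
  by (intro polys_diff polys_single) auto

lemma binomial_homogeneous: "homogeneous (int d) (cycle_binomial :: ('w set, 'k::field) mpoly)"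
proof -
  have "mdeg odd_mon = d" "mdeg even_mon = d" by (simp_all add: odd_mon_def even_mon_def mdeg_sum)
  then show ?thesis
    unfolding cycle_binomial_def diff_conv_add_uminus
    by (intro homogeneous_add homogeneous_uminus homogeneous_single) simp_all
qed

text \<open>All variables of the odd monomial are new, so multiplying by it merely shifts the
  basis.\<close>

lemma cf_shift_odd: "cf (u + odd_mon) (single odd_mon 1 * f) = cf u (f :: ('w set, 'k::field) mpoly)"
proof -
  have "odd_mon + v = u + odd_mon \<longleftrightarrow> v = u" for v by (metis add.commute add_left_imp_eq)
  then have "cf (u + odd_mon) (single odd_mon 1 * f) =
      mon_hom pull (single odd_mon 1) * cf u f"
    unfolding cf_def
    by (intro monmap_mult) (auto simp: restr_add pull_add restr_new[OF keys_odd] split: if_splits)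
  then show ?thesis by (simp add: monmap_single pull_new[OF keys_odd])
qed

text \<open>The even monomial has an old part, which multiplies the coefficient, and a new part,
  which shifts the index.\<close>

lemma cf_shift_even:
  "cf (restr even_mon + u) (single even_mon 1 * f) = single (pull even_mon) 1 * cf u (f :: ('w set, 'k::field) mpoly)"
proof -
  have "cf (restr even_mon + u) (single even_mon 1 * f) =
      mon_hom pull (single even_mon 1) * cf u f"
    unfolding cf_def
    by (rule monmap_mult) (auto simp: restr_add pull_add split: if_splits)
  then show ?thesis by (simp add: monmap_single)
qed

lemma cf_shift_even_0:
  assumes "\<nexists>u. v = restr even_mon + u"
  shows "cf v (single even_mon 1 * f) = (0 :: ('v set, 'k::field) mpoly)"
proof -
  have "cf v (single even_mon 1 * f) =
      mon_hom pull (single even_mon 1) * monmap (\<lambda>_. False) pull f"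
    unfolding cf_def using assms
    by (intro monmap_mult) (auto simp: restr_add split: if_splits)
  then show ?thesis by (simp add: monmap_def[of "\<lambda>_. False"])
qed

text \<open>Among the indices with coefficient outside \<open>I\<close>, let \<open>u\<close> have
  the largest exponent of \<open>t 1\<close>. The coefficient of the product at
  \<open>u + odd_mon\<close> is \<open>- cf u f\<close> plus a contribution of the even monomial,
  which comes from an index with larger exponent and so lies in \<open>I\<close>.\<close>

lemma binomial_nonzerodivisor:
  fixes f :: "('w set, 'k::field) mpoly"
  assumes I: "graded_ideal (edges G) I" and f: "f \<in> polysH" and bf: "cycle_binomial * f \<in> ext I"
  shows "f \<in> ext I"
proof (rule ccontr)
  note hI = graded_idealD[OF I]
  define Z where "Z = {u. cf u f \<notin> I}"
  assume "f \<notin> ext I"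
  then have "Z \<noteq> {}" using f by (auto simp: ext_def Z_def)
  have "Z \<subseteq> {u. cf u f \<noteq> 0}" using hI(2) by (auto simp: Z_def)
  moreover obtain T where "finite T" "\<forall>u. u \<notin> T \<longrightarrow> cf u f = 0" using expansion[OF f] by blast
  ultimately have "finite Z" by (metis (mono_tags, lifting) mem_Collect_eq rev_finite_subset subset_iff)
  let ?e = "\<lambda>u. lookup u (t 1)"
  have "Max (?e ` Z) \<in> ?e ` Z" using \<open>finite Z\<close> \<open>Z \<noteq> {}\<close> by simp
  then obtain u where u: "u \<in> Z" "?e u = Max (?e ` Z)" by auto
  have max: "cf v f \<in> I" if "?e v > ?e u" for v
  proof (rule ccontr)
    assume "cf v f \<notin> I"
    then have "?e v \<le> Max (?e ` Z)" using \<open>finite Z\<close> by (auto simp: Z_def)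
    then show False using that u(2) by simp
  qed
  have "cf (u + odd_mon) (single even_mon 1 * f) \<in> I"
  proof (cases "\<exists>v. u + odd_mon = restr even_mon + v")
    case True
    then obtain v where v: "u + odd_mon = restr even_mon + v" by blast
    \<comment> \<open>\<open>t 1\<close> occurs once in the odd monomial and not at all in the even
      one, so \<open>v\<close> exceeds \<open>u\<close> by one at \<open>t 1\<close>.\<close>
    have "?e (u + odd_mon) = ?e u + 1" using lookup_odd[of 1] d by (simp add: lookup_add)
    moreover have "?e (restr even_mon + v) = ?e v" using lookup_even_1 by (simp add: lookup_add lookup_restr)
    ultimately have "?e v > ?e u" using v by simp
    then show ?thesis
      unfolding v cf_shift_even using keys_pull by (intro hI(4) max polys_single)
  next
    case False
    then show ?thesis using cf_shift_even_0[of "u + odd_mon" f] hI(2) by simp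
  qed
  moreover have "cf (u + odd_mon) (cycle_binomial * f) \<in> I" using bf by (simp add: ext_def)
  ultimately have "cf (u + odd_mon) (single even_mon 1 * f) - cf (u + odd_mon) (cycle_binomial * f) \<in> I"
    by (rule hI(7))
  also have "cf (u + odd_mon) (single even_mon 1 * f) - cf (u + odd_mon) (cycle_binomial * f) = cf u f"
    by (simp add: cycle_binomial_def left_diff_distrib cf_diff cf_shift_odd)
  finally show False using u(1) by (simp add: Z_def)
qed

section \<open>Toric images and the vertices of H\<close>

definition xpush :: "('v \<Rightarrow>\<^sub>0 nat) \<Rightarrow> ('w \<Rightarrow>\<^sub>0 nat)" where
  "xpush m = (\<Sum>x\<in>verts G. single (g x) (lookup m x))"

lemma xpush_add: "xpush (m + n) = xpush m + xpush n"
  by (simp add: xpush_def lookup_add single_add sum.distrib)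

lemma xpush_sum: "xpush (sum f A) = (\<Sum>x\<in>A. xpush (f x))"
proof -
  have "xpush 0 = 0" by (simp add: xpush_def)
  then show ?thesis by (induction A rule: infinite_finite_induct) (auto simp: xpush_add)
qed

lemma xpush_single: "x \<in> verts G \<Longrightarrow> xpush (single x k) = single (g x) k"
proof -
  assume x: "x \<in> verts G"
  have "xpush (single x k) = (\<Sum>y\<in>verts G. if y = x then single (g x) k else 0)"
    unfolding xpush_def by (intro sum.cong) (auto simp: lookup_single when_def)
  then show ?thesis using x finite_G by simp
qed

lemma lookup_xpush: "x \<in> verts G \<Longrightarrow> lookup (xpush m) (g x) = lookup m x"
proof -
  assume x: "x \<in> verts G"
  have "lookup (xpush m) (g x) = (\<Sum>y\<in>verts G. if y = x then lookup m x else 0)"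
    unfolding xpush_def lookup_sum using inj_onD[OF inj_g _ _ x]
    by (intro sum.cong refl) (auto simp: lookup_single when_def)
  then show ?thesis using x finite_G by simp
qed

lemma lookup_xpush_0: "v \<notin> g ` verts G \<Longrightarrow> lookup (xpush m) v = 0"
  by (auto simp: xpush_def lookup_sum lookup_single when_def intro!: sum.neutral)

lemma xpush_inj: "inj_on xpush {m. keys m \<subseteq> verts G}"
proof (rule inj_onI)
  fix m n assume mn: "m \<in> {m. keys m \<subseteq> verts G}" "n \<in> {m. keys m \<subseteq> verts G}" "xpush m = xpush n"
  show "m = n"
  proof (rule poly_mapping_eqI)
    fix x show "lookup m x = lookup n x"
    proof (cases "x \<in> verts G")
      case True
      then show ?thesis using lookup_xpush[of x m] lookup_xpush[of x n] mn(3) by simp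
    next
      case False
      then have "x \<notin> keys m" "x \<notin> keys n" using mn by auto
      then show ?thesis by (simp add: in_keys_iff)
    qed
  qed
qed

text \<open>The toric maps commute with the renaming from \<open>G\<close> to \<open>H\<close>, as
  new edges have exponent 0 in \<open>push m\<close>.\<close>

lemma tmon_push:
  "tH (push m) = xpush (tG m)"
proof -
  have "tH (push m) = (\<Sum>y\<in>(`) g ` edges G. \<Sum>v\<in>y. single v (lookup (push m) y))"
    unfolding tmon_def using finite_U lookup_push(2)
    by (intro sum.mono_neutral_right) (auto simp: V_eq)
  also have "\<dots> = (\<Sum>x\<in>edges G. \<Sum>v\<in>g ` x. single v (lookup m x))"
    by (simp add: sum.reindex[OF inj_image] lookup_push(1))
  also have "\<dots> = (\<Sum>x\<in>edges G. \<Sum>z\<in>x. xpush (single z (lookup m x)))"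
  proof (rule sum.cong[OF refl])
    fix x assume "x \<in> edges G"
    then have x: "x \<subseteq> verts G" using edges_G by blast
    have "inj_on g x" by (rule inj_on_subset[OF inj_g x])
    then show "(\<Sum>v\<in>g ` x. single v (lookup m x)) =
        (\<Sum>z\<in>x. xpush (single z (lookup m x)))"
      using x by (auto simp: sum.reindex xpush_single intro!: sum.cong)
  qed
  also have "\<dots> = xpush (tG m)" by (simp add: tmon_def xpush_sum)
  finally show ?thesis .
qed

lemma tmon_split:
  "keys n \<subseteq> edges H \<Longrightarrow> tH n = xpush (tG (pull n)) + tH (restr n)"
  using push_pull_restr[of n] tmon_push[of "pull n"] tmon_add[of "edges H" "push (pull n)" "restr n"] by simp

lemma lookup_tmon: "finite E \<Longrightarrow> \<forall>e\<in>E. finite e \<Longrightarrow>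
  lookup (tmon E m) v = (\<Sum>e | e \<in> E \<and> v \<in> e. lookup m e)"
proof -
  assume E: "finite E" "\<forall>e\<in>E. finite e"
  have "lookup (tmon E m) v = (\<Sum>e\<in>E. if v \<in> e then lookup m e else 0)"
    unfolding tmon_def lookup_sum using E(2) by (intro sum.cong refl) (simp add: lookup_single when_def)
  then show ?thesis using E(1) by (simp add: sum.If_cases Int_def conj_commute)
qed

lemma finite_edges_H: "y \<in> edges H \<Longrightarrow> finite y"
  using edges_G edges_H by auto

text \<open>The vertex \<open>p (Suc k)\<close> is new, so \<open>t k\<close> and
  \<open>t (Suc k)\<close> are the only edges of \<open>H\<close> through it; at \<open>p 0\<close>
  and \<open>p 1\<close> further edges of \<open>G\<close> may meet.\<close>

lemma lookup_tmon_new: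
  assumes k: "1 \<le> k" "Suc k < 2 * d"
  shows "lookup (tH n) (p (Suc k)) = lookup n (t k) + lookup n (t (Suc k))"
proof -
  have "{y. y \<in> edges H \<and> p (Suc k) \<in> y} = {t k, t (Suc k)}"
  proof (intro equalityI subsetI)
    fix y assume "y \<in> {y. y \<in> edges H \<and> p (Suc k) \<in> y}"
    then have y: "y \<in> edges H" "p (Suc k) \<in> y" by auto
    have "y \<notin> (`) g ` edges G"
      using y(2) p_notin_G[of "Suc k"] k edges_G by (auto simp: image_iff subset_iff)
    then obtain j where j: "y = t j" "j < 2 * d" using y(1) by (auto simp: V_eq U_def)
    then have "Suc k = j \<or> Suc k = Suc j mod (2 * d)" using p_mem_t_iff[of "Suc k" j] y(2) k by simp
    then show "y \<in> {t k, t (Suc k)}" using j by (auto simp: Suc_mod split: if_splits)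
  next
    fix y assume "y \<in> {t k, t (Suc k)}"
    then show "y \<in> {y. y \<in> edges H \<and> p (Suc k) \<in> y}"
      using t_in_H[of k] t_in_H[of "Suc k"] k by (auto simp: t_def)
  qed
  moreover have "t k \<noteq> t (Suc k)" using t_inj[of k "Suc k"] k by auto
  ultimately show ?thesis using lookup_tmon[of "edges H" n "p (Suc k)"] finite_U finite_edges_H by simp
qed

text \<open>A monomial not divisible by the odd monomial of the cycle is determined on the new edges by
  the degrees of its image at the new vertices: along the cycle, two solutions differ by an
  alternating sequence \<open>\<delta>, -\<delta>, \<delta>, \<dots>\<close>, and \<open>\<delta> > 0\<close> makes one of them divisible.\<close>

lemma divisible_odd:
  assumes new: "\<And>k. 1 \<le> k \<Longrightarrow> Suc k < 2 * d \<Longrightarrow>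
      lookup (tH n) (p (Suc k)) = lookup (tH n') (p (Suc k))"
    and gt: "lookup n (t 1) < lookup n' (t 1)"
  shows "\<exists>m. n' = m + odd_mon"
proof -
  let ?A = "\<lambda>k. int (lookup n (t k))" and ?B = "\<lambda>k. int (lookup n' (t k))"
  have step: "?A k + ?A (Suc k) = ?B k + ?B (Suc k)" if "1 \<le> k" "Suc k < 2 * d" for k
    using new[OF that] lookup_tmon_new[OF that, of n] lookup_tmon_new[OF that, of n'] by linarith
  have diff: "?B k - ?A k = (if odd k then ?B 1 - ?A 1 else ?A 1 - ?B 1)" if "1 \<le> k" "k < 2 * d" for k
    using that
  proof (induction k rule: nat_induct_at_least)
    case base
    then show ?case by simp
  next
    case (Suc k)
    then show ?case using step[of k] by (auto split: if_splits)
  qed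
  have "lookup odd_mon y \<le> lookup n' y" for y
  proof (cases "\<exists>j. 1 \<le> j \<and> j < 2 * d \<and> y = t j")
    case True
    then obtain j where j: "1 \<le> j" "j < 2 * d" "y = t j" by blast
    then show ?thesis using diff[of j] gt lookup_odd[of j] by (auto split: if_splits)
  next
    case False
    then have "y \<notin> U" by (auto simp: U_def)
    then have "y \<notin> keys odd_mon" using keys_odd by auto
    then show ?thesis by (simp add: in_keys_iff)
  qed
  then have "n' = (n' - odd_mon) + odd_mon"
    by (intro poly_mapping_eqI) (simp add: lookup_add lookup_minus)
  then show ?thesis by blast
qed

lemma restr_unique:
  assumes new: "\<And>k. 1 \<le> k \<Longrightarrow> Suc k < 2 * d \<Longrightarrow>
      lookup (tH n) (p (Suc k)) = lookup (tH n') (p (Suc k))"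
    and irr: "\<nexists>m. n = m + odd_mon" "\<nexists>m. n' = m + odd_mon"
  shows "restr n = restr n'"
proof -
  have first: "lookup n (t 1) = lookup n' (t 1)"
    using divisible_odd[of n n'] divisible_odd[of n' n] new irr by (metis nat_neq_iff)
  have eq: "lookup n (t k) = lookup n' (t k)" if "1 \<le> k" "k < 2 * d" for k
    using that
  proof (induction k rule: nat_induct_at_least)
    case base
    then show ?case using first by simp
  next
    case (Suc k)
    then show ?case using new[of k] lookup_tmon_new[of k n] lookup_tmon_new[of k n'] by simp
  qed
  show ?thesis
    by (rule poly_mapping_eqI) (use eq in \<open>auto simp: lookup_restr U_def\<close>)
qed

section \<open>Rewriting modulo the binomial\<close>

definition irreducible_poly :: "('w set, 'k::field) mpoly \<Rightarrow> bool" where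
  "irreducible_poly f \<longleftrightarrow> (\<forall>n\<in>keys f. \<nexists>m. n = m + odd_mon)"

lemma reduction_single:
  assumes "keys n \<subseteq> edges H"
  shows "\<exists>f h. single n c = f + cycle_binomial * h \<and> f \<in> polysH \<and>
    h \<in> polysH \<and> irreducible_poly (f :: ('w set, 'k::field) mpoly)"
  using assms
proof (induction "lookup n (t 1)" arbitrary: n rule: less_induct)
  case less
  show ?case
  proof (cases "\<exists>m. n = m + odd_mon")
    case False
    then show ?thesis using less.prems
      by (intro exI[of _ "single n c"] exI[of _ 0]) (simp add: irreducible_poly_def polys_single)
  next
    case True
    then obtain m where m: "n = m + odd_mon" by blast
    have keys: "keys m \<subseteq> edges H" "keys (m + even_mon) \<subseteq> edges H"
      using less.prems m keys_even by auto
    have "lookup (m + even_mon) (t 1) < lookup n (t 1)"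
      using lookup_even_1 lookup_odd[of 1] d by (simp add: m lookup_add)
    from less.hyps[OF this keys(2)] obtain f h where fh:
      "single (m + even_mon) c = f + cycle_binomial * h" "f \<in> polysH"
      "h \<in> polysH" "irreducible_poly f" by blast
    have "single n c = single (m + even_mon) c - cycle_binomial * single m c"
      by (simp add: cycle_binomial_def left_diff_distrib mult_single m add.commute)
    also have "\<dots> = f + cycle_binomial * (h - single m c)"
      by (simp add: fh(1) right_diff_distrib)
    finally show ?thesis
      using fh(2-4) keys(1) by (metis polys_diff polys_single)
  qed
qed

lemma reduction:
  assumes "f \<in> polysH"
  shows "\<exists>f' h. f = f' + cycle_binomial * h \<and> f' \<in> polysH \<and>
    h \<in> polysH \<and> irreducible_poly (f' :: ('w set, 'k::field) mpoly)"
proof -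
  have "\<exists>f' h. (\<Sum>m\<in>A. single m (lookup f m)) = f' + cycle_binomial * h \<and> f' \<in> polysH \<and>
    h \<in> polysH \<and> irreducible_poly f'" if "A \<subseteq> keys f" "finite A" for A
    using that(2,1)
  proof induction
    case empty
    show ?case by (intro exI[of _ 0]) (simp add: irreducible_poly_def)
  next
    case (insert m A)
    then obtain f1 h1 where 1: "(\<Sum>m\<in>A. single m (lookup f m)) = f1 + cycle_binomial * h1"
      "f1 \<in> polysH" "h1 \<in> polysH" "irreducible_poly f1" by auto
    have "keys m \<subseteq> edges H" using insert assms by (auto simp: polys_iff)
    then obtain f2 h2 where 2: "single m (lookup f m) = f2 + cycle_binomial * h2"
      "f2 \<in> polysH" "h2 \<in> polysH" "irreducible_poly f2" using reduction_single by blast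
    have "(\<Sum>m\<in>insert m A. single m (lookup f m)) = (f2 + f1) + cycle_binomial * (h2 + h1)"
      using insert 1 2 by (simp add: algebra_simps)
    moreover have "irreducible_poly (f2 + f1)"
      using 1(4) 2(4) keys_add[of f2 f1] by (auto simp: irreducible_poly_def)
    ultimately show ?case using 1 2 polys_add by blast
  qed
  from this[of "keys f"] show ?thesis by (simp flip: poly_eq_sum_single)
qed

text \<open>By \<open>restr_unique\<close> the exponents of an image monomial at the new vertices
  determine the new part of its source. Hence terms of \<open>f\<close> with different new parts
  cannot cancel in the image, and every coefficient \<open>cf u f\<close> is killed by the toric map
  of \<open>G\<close> on its own.\<close>

lemma irreducible_toric:
  fixes f :: "('w set, 'k::field) mpoly"
  assumes f: "f \<in> polysH" "irreducible_poly f" and f0: "mon_hom (tH) f = 0"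
  shows "f \<in> ext (toric_ideal G)"
proof -
  have "mon_hom (tG) (cf u f) = 0" for u
  proof (cases "\<exists>n0\<in>keys f. restr n0 = u")
    case False
    then have "cf u f = 0" by (auto simp: cf_def monmap_def intro!: sum.neutral)
    then show ?thesis by simp
  next
    case True
    then obtain n0 where n0: "n0 \<in> keys f" "restr n0 = u" by blast
    have keysf: "keys n \<subseteq> edges H" if "n \<in> keys f" for n
      using f(1) that by (auto simp: polys_iff)
    \<comment> \<open>Agreement with the image of \<open>n0\<close> at the new vertices
      \<open>p 2\<close>, ..., \<open>p (2 * d - 1)\<close>.\<close>
    let ?Q = "\<lambda>m. \<forall>k. 1 \<le> k \<and> Suc k < 2 * d \<longrightarrow>
      lookup m (p (Suc k)) = lookup (tH n0) (p (Suc k))"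
    have Q: "?Q (tH n) \<longleftrightarrow> restr n = u" if n: "n \<in> keys f" for n
    proof
      assume "?Q (tH n)"
      then have "restr n = restr n0"
        using f(2) n n0(1) by (intro restr_unique) (auto simp: irreducible_poly_def)
      then show "restr n = u" using n0(2) by simp
    next
      assume r: "restr n = u"
      \<comment> \<open>The old part of a monomial contributes nothing at a new vertex, so there the
        image depends on \<open>restr n\<close> alone.\<close>
      show "?Q (tH n)"
      proof (intro allI impI)
        fix k assume k: "1 \<le> k \<and> Suc k < 2 * d"
        then have "p (Suc k) \<notin> g ` verts G" using p_notin_G[of "Suc k"] by simp
        then show "lookup (tH n) (p (Suc k)) = lookup (tH n0) (p (Suc k))"
          using tmon_split[OF keysf[OF n]] tmon_split[OF keysf[OF n0(1)]] r n0(2)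
          by (simp add: lookup_add lookup_xpush_0)
      qed
    qed
    have "0 = monmap ?Q (\<lambda>m. m) (mon_hom (tH) f)" by (simp add: f0)
    also have "\<dots> = monmap (\<lambda>n. ?Q (tH n)) (tH) f" by (simp add: monmap_comp)
    also have "\<dots> = monmap (\<lambda>n. restr n = u) (\<lambda>n. tH u + xpush (tG (pull n))) f"
      using Q keysf by (intro monmap_cong) (auto simp: tmon_split add.commute)
    also have "\<dots> = mon_hom (\<lambda>m. tH u + xpush m) (mon_hom (tG) (cf u f))"
      by (simp add: cf_def monmap_comp)
    finally have 0: "mon_hom (\<lambda>m. tH u + xpush m) (mon_hom (tG) (cf u f)) = 0"
      by simp
    show ?thesis
    \<comment> \<open>Translation by \<open>tH u\<close> and the renaming \<open>xpush\<close> are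
      injective on monomials, so both can be undone.\<close>
    proof (rule monmap_eq_0D[OF _ _ 0])
      show "inj_on (\<lambda>m. tH u + xpush m) {m. keys m \<subseteq> verts G}"
        using xpush_inj by (auto simp: inj_on_def)
      have "keys (tG m) \<subseteq> verts G" for m
      proof -
        have "lookup (tG m) v = 0" if "v \<notin> verts G" for v
          using that edges_G unfolding tmon_def lookup_sum
          by (intro sum.neutral ballI) (auto simp: lookup_single when_def)
        then show ?thesis by (metis in_keys_iff subsetI)
      qed
      then show "keys (mon_hom (tG) (cf u f)) \<subseteq> {m. keys m \<subseteq> verts G}"
        using keys_monmap[of "\<lambda>_. True" tG "cf u f"] by blast
    qed
  qed
  then show ?thesis using f(1) cf_polys by (auto simp: ext_def toric_ideal_eq[OF finite_G(2)])
qed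

section \<open>Generators of the toric ideal of H\<close>

lemma sum_pairs:
  fixes a :: "nat \<Rightarrow> 'a::comm_monoid_add" and n :: nat
  shows "(\<Sum>k<n. a (2 * k) + a (2 * k + 1)) = (\<Sum>j<2 * n. a j)"
  by (induction n) (simp_all add: add.assoc)

text \<open>The even and the odd edges are the two perfect matchings of the cycle, so both monomials
  map to the product of all its vertices.\<close>

lemma tmon_even_odd: "tH even_mon = tH odd_mon"
proof -
  have tsum: "tH (\<Sum>k<d. f k) = (\<Sum>k<d. tH (f k))" for f
  proof -
    have "tH 0 = 0" by (simp add: tmon_def)
    then have "tH (\<Sum>k<n. f k) = (\<Sum>k<n. tH (f k))" for n
      by (induction n) (simp_all add: tmon_add)
    then show ?thesis .
  qed
  let ?a = "\<lambda>j. single (p j) (1::nat)"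
  have tm: "tH (single (t k) 1) = ?a k + ?a (Suc k mod (2 * d))" if k: "k < 2 * d" for k
  proof -
    have "tH (single (t k) 1) =
        (\<Sum>y\<in>edges H. if y = t k then (\<Sum>v\<in>t k. single v 1) else 0)"
      unfolding tmon_def by (intro sum.cong refl) (auto simp: lookup_single when_def)
    also have "\<dots> = (\<Sum>v\<in>t k. single v 1)" using t_in_H[OF k] finite_U by simp
    also have "\<dots> = ?a k + ?a (Suc k mod (2 * d))"
    proof -
      have "k \<noteq> Suc k mod (2 * d)" using k d by (auto simp: Suc_mod)
      then have "p k \<noteq> p (Suc k mod (2 * d))" by (simp only: p_eq_iff[OF k Suc_mod_less] not_False_eq_True)
      then show ?thesis by (simp add: t_def)
    qed
    finally show ?thesis .
  qed
  have "tH even_mon = (\<Sum>k<d. ?a (2 * k) + ?a (2 * k + 1))"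
    unfolding even_mon_def tsum by (intro sum.cong refl) (subst tm; auto)
  also have "\<dots> = (\<Sum>j<2 * d. ?a j)" by (rule sum_pairs)
  \<comment> \<open>A cyclic shift of the index regroups the same vertices into the endpoints of the
    odd edges.\<close>
  also have "\<dots> = (\<Sum>j<2 * d. ?a (Suc j mod (2 * d)))"
  proof -
    obtain n where n: "2 * d = Suc n" using d by (cases "2 * d") auto
    have "(\<Sum>j<Suc n. ?a (Suc j mod Suc n)) = (\<Sum>j<n. ?a (Suc j)) + ?a 0" by simp
    also have "\<dots> = (\<Sum>j<Suc n. ?a j)" unfolding sum.lessThan_Suc_shift by (simp add: add.commute)
    finally show ?thesis by (simp add: n)
  qed
  also have "\<dots> = (\<Sum>k<d. ?a (Suc (2 * k) mod (2 * d)) + ?a (Suc (2 * k + 1) mod (2 * d)))"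
    by (rule sum_pairs[symmetric])
  also have "\<dots> = tH odd_mon"
    unfolding odd_mon_def tsum by (intro sum.cong refl) (subst tm; auto)
  finally show ?thesis .
qed

lemma toric_ideal_gluing:
  "(toric_ideal H :: ('w set, 'k::field) mpoly set) =
    {f + cycle_binomial * h | f h. f \<in> ext (toric_ideal G) \<and> h \<in> polysH}"
proof -
  let ?t = "mon_hom (tH) :: ('w set, 'k) mpoly \<Rightarrow> ('w, 'k) mpoly"
  have mult: "?t (f * h) = ?t f * ?t h" for f h
    by (rule monmap_mult) (simp add: tmon_add)
  have b0: "?t cycle_binomial = 0"
    by (simp add: cycle_binomial_def monmap_diff monmap_single tmon_even_odd)
  have t\<rho>: "?t (\<rho> q) = 0" if "q \<in> toric_ideal G" for q
  proof -
    have "?t (\<rho> q) = mon_hom xpush (mon_hom (tG) q)"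
      by (simp add: \<rho>_def monmap_comp tmon_push)
    then show ?thesis using that by (simp add: toric_ideal_eq[OF finite_G(2)])
  qed
  have ext0: "?t f = 0" if "f \<in> ext (toric_ideal G)" for f
  proof -
    have f: "f \<in> polysH" "\<And>u. cf u f \<in> toric_ideal G" using that by (auto simp: ext_def)
    obtain T where T: "f = (\<Sum>u\<in>T. single u 1 * \<rho> (cf u f))" using expansion[OF f(1)] by blast
    have "?t (\<Sum>u\<in>T. single u 1 * \<rho> (cf u f)) = 0"
      by (simp add: monmap_sum mult t\<rho>[OF f(2)])
    then show ?thesis using T by simp
  qed
  show ?thesis
  proof (intro equalityI subsetI)
    fix f assume "f \<in> (toric_ideal H :: ('w set, 'k) mpoly set)"
    then have f: "f \<in> polysH" "?t f = 0" by (auto simp: toric_ideal_eq[OF finite_U(2)])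
    obtain f' h where r: "f = f' + cycle_binomial * h" "f' \<in> polysH"
      "h \<in> polysH" "irreducible_poly f'" using reduction[OF f(1)] by blast
    have "?t f' = 0" using f(2) by (simp add: r(1) monmap_add mult b0)
    then have "f' \<in> ext (toric_ideal G)" using irreducible_toric[OF r(2,4)] by blast
    then show "f \<in> {f + cycle_binomial * h | f h. f \<in> ext (toric_ideal G) \<and> h \<in> polysH}"
      using r by blast
  next
    fix f :: "('w set, 'k) mpoly"
    assume "f \<in> {f + cycle_binomial * h | f h. f \<in> ext (toric_ideal G) \<and> h \<in> polysH}"
    then obtain f' h where r: "f = f' + cycle_binomial * h" "f' \<in> ext (toric_ideal G)" "h \<in> polysH" by blast
    have "f' \<in> polysH" using r(2) by (simp add: ext_def)
    then show "f \<in> toric_ideal H"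
      using r by (simp add: toric_ideal_eq[OF finite_U(2)] monmap_add mult b0 ext0 binomial_polys)
  qed
qed

theorem gluing_regularity:
  "reg_quotient (edges H) (toric_ideal H :: ('w set, 'k::field) mpoly set) =
   reg_quotient (edges G) (toric_ideal G :: ('v set, 'k) mpoly set) + ereal (real (d - 1))"
proof -
  let ?I = "toric_ideal G :: ('v set, 'k) mpoly set"
  have IG: "graded_ideal (edges G) ?I" by (rule toric_homogeneous[OF G])
  obtain a s D where RG: "min_graded_free_resolution (edges G) ?I a s D"
    using resolution_exists[OF finite_G(2) IG toric_const[OF G]] by blast
  have IH: "graded_ideal (edges H) (ext ?I)" by (rule ext_homogeneous[OF IG])
  note RH = ext_resolution[OF IG RG]
  interpret cone "edges H" "ext ?I" cycle_binomial d "map_vec \<rho> a" s "\<lambda>i. map_mat \<rho> (D i)"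
  proof
    show "1 \<le> d" using d by simp
  qed (fact IH RH binomial_polys binomial_homogeneous binomial_nonzerodivisor[OF IG])+
  have "J = (toric_ideal H :: ('w set, 'k) mpoly set)"
    unfolding J_def toric_ideal_gluing ..
  \<comment> \<open>The extended resolution has the same degree lists \<open>s\<close>, so the
    extension of scalars leaves the regularity unchanged.\<close>
  moreover have "reg_quotient (edges H) (ext ?I) = reg_quotient (edges G) ?I"
    unfolding reg_quotient_def graded_betti_eq[OF IG RG] graded_betti_eq[OF IH RH] ..
  ultimately show ?thesis using cone_regularity by simp
qed

end

theorem theorem6p9:
  fixes G :: "'v graph" and H :: "'w graph" and e :: "'v set" and d :: nat
  assumes "finite_simple_graph G"
    and "geom_vertex_decomposable (edges G)
           (toric_ideal G :: ('v set, 'k::{alg_closed_field, field_char_0}) mpoly set)"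
    and "e \<in> edges G"
    and "d \<ge> 2"
    and "cycle_gluing G e (2 * d) H"
  shows "reg_quotient (edges H) (toric_ideal H :: ('w set, 'k) mpoly set) =
         reg_quotient (edges G) (toric_ideal G :: ('v set, 'k) mpoly set) + ereal (real (d - 1))"
proof -
  let ?m = "2 * d"
  let ?C = "cycle_graph ?m"
  have "\<exists>f\<in>edges ?C. \<exists>(g :: 'v \<Rightarrow> 'w) (c :: nat \<Rightarrow> 'w). inj_on g (verts G) \<and> inj_on c (verts ?C) \<and>
      g ` e = c ` f \<and> g ` verts G \<inter> c ` verts ?C = g ` e \<and>
      edges H = (`) g ` edges G \<union> (`) c ` edges ?C"
    using assms(5) unfolding cycle_gluing_def by meson
  then obtain f and g :: "'v \<Rightarrow> 'w" and c :: "nat \<Rightarrow> 'w" where f: "f \<in> edges ?C"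
    and "inj_on g (verts G) \<and> inj_on c (verts ?C) \<and> g ` e = c ` f \<and>
      g ` verts G \<inter> c ` verts ?C = g ` e \<and> edges H = (`) g ` edges G \<union> (`) c ` edges ?C"
    by (elim bexE exE)
  then have inj_g: "inj_on g (verts G)" and inj_c: "inj_on c (verts ?C)"
    and gc: "g ` e = c ` f" "g ` verts G \<inter> c ` verts ?C = g ` e"
    and H: "edges H = (`) g ` edges G \<union> (`) c ` edges ?C" by simp_all
  obtain i0 where i0: "f = {i0, Suc i0 mod ?m}" "i0 < ?m" using f by (auto simp: cycle_graph_def)
  \<comment> \<open>The rotation of the cycle that moves the identified edge \<open>f\<close> to
    index 0, the numbering on which \<open>graph_gluing\<close> is based.\<close>
  define r where "r k = (i0 + k) mod ?m" for k
  have m0: "?m > 0" using assms(4) by simp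
  have r_less: "r k < ?m" for k using m0 by (simp add: r_def)
  have r_Suc: "r (Suc k mod ?m) = Suc (r k) mod ?m" for k by (simp add: r_def mod_simps)
  have "r k = (if i0 + k < ?m then i0 + k else i0 + k - ?m)" if "k < ?m" for k
    using that i0(2) by (simp add: r_def mod_if)
  then have inj_r: "inj_on r {..<?m}"
    using i0(2) by (auto simp: inj_on_def split: if_splits)
  have r_img: "r ` {..<?m} = {..<?m}"
    using inj_r r_less by (intro card_subset_eq) (auto simp: card_image)
  define p where "p k = c (r k)" for k
  have verts_c: "c ` verts (cycle_graph ?m) = p ` {..<?m}"
    unfolding p_def using r_img by (simp add: cycle_graph_def flip: image_image)
  have ge: "g ` e = {p 0, p 1}"
    using gc(1) i0 r_Suc[of 0] assms(4) by (simp add: p_def r_def)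
  have edges_c: "(`) c ` edges (cycle_graph ?m) = (\<lambda>k. {p k, p (Suc k mod ?m)}) ` {..<?m}"
  proof -
    have "edges (cycle_graph ?m) = (\<lambda>i. {i, Suc i mod ?m}) ` {..<?m}" by (auto simp: cycle_graph_def)
    also have "\<dots> = (\<lambda>i. {i, Suc i mod ?m}) ` r ` {..<?m}" by (simp only: r_img)
    finally show ?thesis by (simp add: image_image p_def r_Suc)
  qed
  interpret graph_gluing G e d H g p
  proof
    show "inj_on p {..<?m}"
      using comp_inj_on[OF inj_r, of c] inj_c by (simp add: r_img cycle_graph_def p_def[abs_def] comp_def)
    show "g ` verts G \<inter> p ` {..<?m} = {p 0, p 1}" using gc(2) verts_c ge by simp
    show "edges H = (`) g ` edges G \<union> (\<lambda>k. {p k, p (Suc k mod ?m)}) ` {..<?m}" using H edges_c by simp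
  qed (use assms inj_g ge in auto)
  show ?thesis by (rule gluing_regularity)
qed

end
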